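(* Consider the 3D axisymmetric Euler equation $$D_t(ru^\theta)=0,\qquad D_t\left(\frac{\omega^\theta}{r}\right)=\frac{\partial_z(ru^\theta)^2}{r^4},\qquad D_t:=\partial_t+u^r\partial_r+u^z\partial_z,$$ with $$(u^r,u^z)=\frac1r\big(-\partial_z\psi,\ \partial_r\psi\big),\qquad -\frac1r\partial_r\left(\frac1r\partial_r\psi\right)-\frac1{r^2}\partial_z^2\psi=\frac{\omega^\theta}{r},$$ set on the domain $$\Omega=\{(r,\theta,z): r\in[\pi,2\pi],\ \theta\in\mathbb{T},\ z\in\mathbb{T}\}$$ with no-penetration boundary condition at $r=\pi$ and $r=2\pi$ and periodic boundary conditions in $z$. Let the initial data $u_0^\theta\in C^\infty(\Omega)$ be even in $z$, and $\omega_0^\theta\in C^\infty(\Omega)$ be odd in $z$ (both independent of $\theta$). Assume that there exists $k_0>0$ such that $u_0^\theta\ge k_0>0$ on $z=\pi$, and $|u_0^\theta|\le\frac18k_0$ on $z=0$. Then there exist some constants $T_0(u_0)\ge 0$ and $c=c(u_0)>0$ such that the corresponding solution satisfies $$\|\omega^\theta(t)\|_{L^p(\Omega)}\ge c\,t^{3-\frac2p}\quad\text{for all }p\in[1,\infty],\ t\in[T_0,T)$$ and $$\|u(t)\|_{L^\infty(\Omega)}\ge c\,t\quad\text{for all }t\in[T_0,T),$$ where $T$ is the lifespan of the smooth solution. In particular, if $\int_0^\pi\int_\pi^{2\pi}\omega_0^\theta\,dr\,dz\ge 0$, then $T_0=0$ in both estimates above.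
   Context: $(r,\theta,z)$ are cylindrical coordinates and $\mathbb{T}=(-\pi,\pi]$ with periodic identification, so $\Omega$ is an annular cylinder, periodic in $z$. The velocity is $u=u^re_r+u^\theta e_\theta+u^ze_z$, where $u^r,u^\theta,u^z$ and the angular vorticity component $\omega^\theta$ depend only on $(r,z,t)$. No-penetration means $u^r=0$ at $r=\pi,2\pi$; in the class of $\omega^\theta$ odd in $z$ (which is preserved by the evolution) this corresponds to the stream function $\psi$ vanishing at $r=\pi$ and $r=2\pi$. $u_0$ denotes the initial velocity determined by $(u_0^\theta,\omega_0^\theta)$. $T\in(0,\infty]$ is the maximal time of existence of the smooth solution. For $p=\infty$, $\frac2p$ is read as $0$. The constants $T_0$ and $c$ depend only on the initial data (not on $p$ or $t$). *)

theory Defs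
  imports "HOL-Analysis.Analysis" "HOL-Probability.Essential_Supremum"
begin

text \<open>
  Smoothness up to the boundary. The sets used below are convex with nonempty interior,
  so derivatives within them are unique.
\<close>

primrec Ck_on :: "nat \<Rightarrow> 'a::real_normed_vector set \<Rightarrow> ('a \<Rightarrow> 'b::real_normed_vector) \<Rightarrow> bool" where
  "Ck_on 0 S f \<longleftrightarrow> continuous_on S f"
| "Ck_on (Suc k) S f \<longleftrightarrow>
     (\<exists>D. (\<forall>x\<in>S. (f has_derivative D x) (at x within S)) \<and> (\<forall>v. Ck_on k S (\<lambda>x. D x v)))"

definition smooth_on :: "'a::real_normed_vector set \<Rightarrow> ('a \<Rightarrow> 'b::real_normed_vector) \<Rightarrow> bool" where
  "smooth_on S f \<longleftrightarrow> (\<forall>k. Ck_on k S f)"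

text \<open>
  Axisymmetric scalar fields are functions of \<open>(r, z, t)\<close>, with \<open>z\<close> ranging over all of
  \<open>\<real>\<close> and periodicity imposed separately. Only values with \<open>r \<in> {pi..2*pi}\<close> matter:
  radial derivatives are one-sided at the walls, and time derivatives are one-sided at \<open>t = 0\<close>.
\<close>

type_synonym field = "real \<Rightarrow> real \<Rightarrow> real \<Rightarrow> real"

definition d_r :: "field \<Rightarrow> field" where
  "d_r f = (\<lambda>r z t. vector_derivative (\<lambda>s. f s z t) (at r within {pi..2*pi}))"

definition d_z :: "field \<Rightarrow> field" where
  "d_z f = (\<lambda>r z t. vector_derivative (\<lambda>s. f r s t) (at z))"

definition d_t :: "field \<Rightarrow> field" where
  "d_t f = (\<lambda>r z t. vector_derivative (\<lambda>s. f r z s) (at t within {0..}))"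

definition vel_r :: "field \<Rightarrow> field" where
  "vel_r \<psi> = (\<lambda>r z t. - (d_z \<psi> r z t) / r)"

definition vel_z :: "field \<Rightarrow> field" where
  "vel_z \<psi> = (\<lambda>r z t. d_r \<psi> r z t / r)"

definition material_deriv :: "field \<Rightarrow> field \<Rightarrow> field" where
  "material_deriv \<psi> f =
     (\<lambda>r z t. d_t f r z t + vel_r \<psi> r z t * d_r f r z t + vel_z \<psi> r z t * d_z f r z t)"

definition spacetime :: "ereal \<Rightarrow> (real \<times> real \<times> real) set" where
  "spacetime T = {pi..2*pi} \<times> UNIV \<times> {t. 0 \<le> t \<and> ereal t < T}"

text \<open>
  \<open>u\<close> and \<open>w\<close> are the angular components of velocity and vorticity. No penetration is imposed
  as \<open>\<psi> = 0\<close> on both walls; this excludes a free additive constant on one wall, i.e. a net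
  axial flux, which the vorticity does not determine and which vanishes for odd vorticity.
  Parity in \<open>z\<close> is not part of the notion of solution.
\<close>

definition euler_solution ::
    "(real \<Rightarrow> real \<Rightarrow> real) \<Rightarrow> (real \<Rightarrow> real \<Rightarrow> real) \<Rightarrow> ereal \<Rightarrow> field \<Rightarrow> field \<Rightarrow> field \<Rightarrow> bool" where
  "euler_solution u0 w0 T u w \<psi> \<longleftrightarrow>
     0 < T \<and>
     (\<forall>f\<in>{u, w, \<psi>}. smooth_on (spacetime T) (\<lambda>(r, z, t). f r z t) \<and>
        (\<forall>(r, z, t)\<in>spacetime T. f r (z + 2*pi) t = f r z t)) \<and>
     (\<forall>(r, z, t)\<in>spacetime T.
        material_deriv \<psi> (\<lambda>r z t. r * u r z t) r z t = 0 \<and>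
        material_deriv \<psi> (\<lambda>r z t. w r z t / r) r z t
          = d_z (\<lambda>r z t. (r * u r z t)^2) r z t / r^4 \<and>
        - (1 / r) * d_r (\<lambda>r z t. (1 / r) * d_r \<psi> r z t) r z t - (1 / r^2) * d_z (d_z \<psi>) r z t
          = w r z t / r) \<and>
     (\<forall>z t. 0 \<le> t \<and> ereal t < T \<longrightarrow> \<psi> pi z t = 0 \<and> \<psi> (2*pi) z t = 0) \<and>
     (\<forall>r\<in>{pi..2*pi}. \<forall>z. u r z 0 = u0 r z \<and> w r z 0 = w0 r z)"

text \<open>\<open>T\<close> is the lifespan: the smooth solution has no smooth extension beyond \<open>T\<close>.\<close>

definition maximal_euler_solution ::
    "(real \<Rightarrow> real \<Rightarrow> real) \<Rightarrow> (real \<Rightarrow> real \<Rightarrow> real) \<Rightarrow> ereal \<Rightarrow> field \<Rightarrow> field \<Rightarrow> field \<Rightarrow> bool" where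
  "maximal_euler_solution u0 w0 T u w \<psi> \<longleftrightarrow>
     euler_solution u0 w0 T u w \<psi> \<and>
     \<not> (\<exists>T' u' w' \<psi>'. T < T' \<and> euler_solution u0 w0 T' u' w' \<psi>' \<and>
          (\<forall>(r, z, t)\<in>spacetime T.
             u' r z t = u r z t \<and> w' r z t = w r z t \<and> \<psi>' r z t = \<psi> r z t))"

text \<open>
  The domain \<open>\<Omega>\<close> in coordinates \<open>(r, \<theta>, z)\<close>, with the volume measure \<open>r dr d\<theta> dz\<close>.
\<close>

definition Omega_measure :: "(real \<times> real \<times> real) measure" where
  "Omega_measure =
     density (restrict_space lborel ({pi..2*pi} \<times> {-pi<..pi} \<times> {-pi<..pi})) (\<lambda>(r, \<theta>, z). ennreal r)"

definition Lp_norm :: "ereal \<Rightarrow> (real \<times> real \<times> real \<Rightarrow> 'b::real_normed_vector) \<Rightarrow> real" where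
  "Lp_norm p f =
     (if p = \<infinity> then real_of_ereal (esssup Omega_measure (\<lambda>x. ereal (norm (f x))))
      else (\<integral>x. norm (f x) powr real_of_ereal p \<partial>Omega_measure) powr (1 / real_of_ereal p))"

text \<open>Components with respect to the orthonormal frame \<open>e\<^sub>r, e\<^sub>\<theta>, e\<^sub>z\<close>.\<close>

definition velocity :: "field \<Rightarrow> field \<Rightarrow> real \<Rightarrow> real \<times> real \<times> real \<Rightarrow> real \<times> real \<times> real" where
  "velocity u \<psi> t = (\<lambda>(r, \<theta>, z). (vel_r \<psi> r z t, u r z t, vel_z \<psi> r z t))"

end

theory Submission
  imports Defs
begin

text \<open>Put \<open>G = r u\<^sup>\<theta>\<close> and \<open>X = \<omega>\<^sup>\<theta> / r\<close>. The proof plays a linear growth of circulation against the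
conservation of energy.

\<^emph>\<open>Symmetry.\<close> Reflecting a solution in \<open>z\<close> gives a solution with the same initial data, and smooth
solutions are unique, so \<open>\<psi>\<close> is odd in \<open>z\<close> and vanishes on the cuts \<open>z = 0\<close> and \<open>z = pi\<close>
(\<open>stream_function_vanishes_on_cuts\<close>). No fluid crosses the boundary of the half domain
\<open>{pi..2*pi} \<times> {0..pi}\<close>, and fluid that starts on a cut stays on it.

\<^emph>\<open>Circulation.\<close> Since \<open>G\<close> is transported along the cuts, the bounds on the initial swirl persist:
\<open>G \<ge> pi k0\<close> at \<open>z = pi\<close> and \<open>\<bar>G\<bar> \<le> pi k0 / 4\<close> at \<open>z = 0\<close>. The integral of \<open>\<omega>\<^sup>\<theta>\<close> over the half domain is the
circulation along its boundary; transport does not change it, and the source \<open>\<partial>\<^sub>z (G\<^sup>2) / r\<^sup>3\<close>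
integrates to the difference of \<open>G\<^sup>2 / r\<^sup>3\<close> between the two cuts, which is bounded below. Thus the
circulation grows at least linearly (\<open>circulation_growth\<close>); the time \<open>T0\<close> makes up for a negative initial
value. As the boundary has length \<open>4 pi\<close>, the
velocity there is at least of order \<open>t\<close>.

\<^emph>\<open>Concentration.\<close> The kinetic energy is conserved, so a velocity of size \<open>t\<close> along a curve of length of order
one can fill only a layer whose width \<open>\<delta>\<close> keeps \<open>t\<^sup>2 \<delta>\<close> bounded. Quantitatively, the vorticity tested against a
cutoff that drops to zero in a boundary layer of width \<open>\<delta>\<close> has integral at most a constant times
\<open>\<delta> powr (- 1/2)\<close> (this is \<open>vorticity_cutoff_bound\<close>, optimised in \<open>\<kappa>\<close>). For \<open>\<delta> = C / t\<^sup>2\<close> with large \<open>C\<close> this is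
at most half of the guaranteed circulation, so the layer, whose measure is of order \<open>1 / t\<^sup>2\<close>, carries vorticity
with integral of order \<open>t\<close> (\<open>vorticity_concentrates\<close>). Convexity of the \<open>p\<close>-th power
(\<open>Lp_norm_lower_bound\<close>) turns this into a lower bound of order
\<open>t * (t\<^sup>2) powr (1 - 1/p) = t powr (3 - 2/p)\<close>.

Conservation of energy and uniqueness come from one identity: the time derivative of the energy of
the difference of two flows (\<open>has_derivative_energy\<close>). If the second flow is at rest, the right-hand
side vanishes; in general it is bounded by a multiple of the energy, after the vorticity in it has been
written through second derivatives of \<open>\<psi>\<close> and integrated by parts (\<open>source_stress_form\<close>).
Uniqueness at time zero also makes the initial energy, and hence all constants, depend on the initial
data only.\<close>

section \<open>Functions that are smooth up to the boundary\<close>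

lemma Ck_on_cong:
  assumes "\<And>x. x \<in> S \<Longrightarrow> f x = g x" "Ck_on k S f"
  shows "Ck_on k S g"
proof (cases k)
  case 0
  then show ?thesis using assms by (simp cong: continuous_on_cong)
next
  case (Suc m)
  then obtain D where D: "\<forall>x\<in>S. (f has_derivative D x) (at x within S)" "\<forall>v. Ck_on m S (\<lambda>x. D x v)"
    using assms by auto
  have "\<forall>x\<in>S. (g has_derivative D x) (at x within S)"
    using D(1) assms(1) by (metis has_derivative_transform)
  then show ?thesis using D Suc by auto
qed

lemma Ck_on_SucD: "Ck_on (Suc k) S f \<Longrightarrow> Ck_on k S f"
proof (induction k arbitrary: f)
  case 0
  then show ?case
    by (auto intro: has_derivative_continuous_on)
next
  case (Suc k)
  then show ?case by (metis Ck_on.simps(2))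
qed

lemma Ck_on_subset: "Ck_on k S f \<Longrightarrow> S' \<subseteq> S \<Longrightarrow> Ck_on k S' f"
proof (induction k arbitrary: f)
  case 0
  then show ?case by (auto intro: continuous_on_subset)
next
  case (Suc k)
  then obtain D where "\<forall>x\<in>S. (f has_derivative D x) (at x within S)" "\<forall>v. Ck_on k S (\<lambda>x. D x v)" by auto
  then show ?case
    using Suc by (auto intro!: exI[of _ D] intro: has_derivative_subset)
qed

lemma Ck_on_const: "Ck_on k S (\<lambda>x. c)"
proof (induction k arbitrary: c)
  case (Suc k)
  then show ?case by (auto intro!: exI[of _ "\<lambda>x v. 0"])
qed auto

lemma Ck_on_bounded_linear: "bounded_linear L \<Longrightarrow> Ck_on k S L"
  by (cases k) (auto intro!: exI[of _ "\<lambda>x. L"] Ck_on_const bounded_linear_imp_has_derivative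
      linear_continuous_on)

lemma Ck_on_add: "Ck_on k S f \<Longrightarrow> Ck_on k S g \<Longrightarrow> Ck_on k S (\<lambda>x. f x + g x)"
proof (induction k arbitrary: f g)
  case 0
  then show ?case by (auto intro: continuous_intros)
next
  case (Suc k)
  then obtain D D' where D: "\<forall>x\<in>S. (f has_derivative D x) (at x within S)" "\<forall>v. Ck_on k S (\<lambda>x. D x v)"
    and D': "\<forall>x\<in>S. (g has_derivative D' x) (at x within S)" "\<forall>v. Ck_on k S (\<lambda>x. D' x v)" by auto
  show ?case unfolding Ck_on.simps
    by (rule exI[of _ "\<lambda>x v. D x v + D' x v"]) (use D D' Suc.IH in \<open>auto intro: has_derivative_add\<close>)
qed

lemma Ck_on_mult:
  fixes f g :: "'a::real_normed_vector \<Rightarrow> real"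
  shows "Ck_on k S f \<Longrightarrow> Ck_on k S g \<Longrightarrow> Ck_on k S (\<lambda>x. f x * g x)"
proof (induction k arbitrary: f g)
  case 0
  then show ?case by (auto intro: continuous_intros)
next
  case (Suc k)
  then obtain D D' where D: "\<forall>x\<in>S. (f has_derivative D x) (at x within S)" "\<forall>v. Ck_on k S (\<lambda>x. D x v)"
    and D': "\<forall>x\<in>S. (g has_derivative D' x) (at x within S)" "\<forall>v. Ck_on k S (\<lambda>x. D' x v)" by auto
  have "Ck_on k S f" "Ck_on k S g" using Suc.prems Ck_on_SucD by blast+
  then show ?case unfolding Ck_on.simps
    by (intro exI[of _ "\<lambda>x v. f x * D' x v + D x v * g x"])
       (use D D' Suc.IH in \<open>auto intro!: has_derivative_mult Ck_on_add\<close>)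
qed

text \<open>Applied to the reflection of \<open>z\<close>, it makes the reflected fields smooth.\<close>

lemma Ck_on_compose_linear:
  assumes L: "bounded_linear L" "L ` S \<subseteq> S"
  shows "Ck_on k S f \<Longrightarrow> Ck_on k S (\<lambda>x. f (L x))"
proof (induction k arbitrary: f)
  case 0
  then have "continuous_on S f" by simp
  then show ?case using continuous_on_compose2[OF _ linear_continuous_on[OF L(1)] L(2), of f] by simp
next
  case (Suc k)
  then obtain D where D: "\<forall>x\<in>S. (f has_derivative D x) (at x within S)" "\<forall>v. Ck_on k S (\<lambda>x. D x v)" by auto
  have "((\<lambda>x. f (L x)) has_derivative (\<lambda>v. D (L x) (L v))) (at x within S)" if "x \<in> S" for x
    by (rule has_derivative_in_compose2[where t=S])
      (use D L that in \<open>auto intro: bounded_linear_imp_has_derivative\<close>)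
  then show ?case unfolding Ck_on.simps
    by (intro exI[of _ "\<lambda>x v. D (L x) (L v)"]) (use D Suc.IH in auto)
qed

lemma Ck_on_inverse:
  fixes L :: "'a::real_normed_vector \<Rightarrow> real"
  assumes L: "bounded_linear L" "\<And>x. x \<in> S \<Longrightarrow> L x \<noteq> 0"
  shows "Ck_on k S (\<lambda>x. inverse (L x))"
proof (induction k)
  case 0
  show ?case using continuous_on_inverse[OF linear_continuous_on[OF L(1)], of S] L(2) by auto
next
  case (Suc k)
  have "((\<lambda>x. inverse (L x)) has_derivative (\<lambda>v. - (inverse (L x) * L v * inverse (L x)))) (at x within S)"
    if "x \<in> S" for x
    by (rule Deriv.has_derivative_inverse) (use L that in \<open>auto intro: bounded_linear_imp_has_derivative\<close>)
  moreover have "Ck_on k S (\<lambda>x. - (inverse (L x) * L v * inverse (L x)))" for v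
  proof -
    have "Ck_on k S (\<lambda>x. (- L v) * (inverse (L x) * inverse (L x)))"
      by (intro Ck_on_mult Ck_on_const Suc)
    then show ?thesis by (simp add: algebra_simps)
  qed
  ultimately show ?case unfolding Ck_on.simps
    by (intro exI[of _ "\<lambda>x v. - (inverse (L x) * L v * inverse (L x))"]) auto
qed

section \<open>Smooth fields on space-time and their partial derivatives\<close>

definition smooth_field :: "ereal \<Rightarrow> field \<Rightarrow> bool" where
  "smooth_field T f \<longleftrightarrow> smooth_on (spacetime T) (\<lambda>(r, z, t). f r z t)"

lemma spacetime_iff [simp]:
  "(r, z, t) \<in> spacetime T \<longleftrightarrow> pi \<le> r \<and> r \<le> 2*pi \<and> 0 \<le> t \<and> ereal t < T"
  by (auto simp: spacetime_def)

lemma smooth_field_const [simp]: "smooth_field T (\<lambda>r z t. c)"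
  using Ck_on_const[of _ "spacetime T" c] by (simp add: smooth_field_def smooth_on_def split_def)

lemma smooth_field_radius [simp]: "smooth_field T (\<lambda>r z t. r)"
  using Ck_on_bounded_linear[OF bounded_linear_fst, of _ "spacetime T"]
  by (simp add: smooth_field_def smooth_on_def split_def)

text \<open>The axis \<open>r = 0\<close> is not in the domain, so all the equations have smooth coefficients.\<close>

lemma smooth_field_inverse_radius [simp]: "smooth_field T (\<lambda>r z t. inverse r)"
proof -
  have "fst x \<noteq> 0" if "x \<in> spacetime T" for x :: "real \<times> real \<times> real"
    using that pi_gt_zero by (cases x) (auto simp: not_le[symmetric])
  from Ck_on_inverse[OF bounded_linear_fst this]
  show ?thesis by (simp add: smooth_field_def smooth_on_def split_def)
qed

lemma smooth_field_add [simp]: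
  "smooth_field T f \<Longrightarrow> smooth_field T g \<Longrightarrow> smooth_field T (\<lambda>r z t. f r z t + g r z t)"
  using Ck_on_add[of _ "spacetime T" "\<lambda>(r, z, t). f r z t" "\<lambda>(r, z, t). g r z t"]
  by (simp add: smooth_field_def smooth_on_def split_def)

lemma smooth_field_mult [simp]:
  "smooth_field T f \<Longrightarrow> smooth_field T g \<Longrightarrow> smooth_field T (\<lambda>r z t. f r z t * g r z t)"
  using Ck_on_mult[of _ "spacetime T" "\<lambda>(r, z, t). f r z t" "\<lambda>(r, z, t). g r z t"]
  by (simp add: smooth_field_def smooth_on_def split_def)

lemma smooth_field_minus [simp]: "smooth_field T f \<Longrightarrow> smooth_field T (\<lambda>r z t. - f r z t)"
  using smooth_field_mult[of T "\<lambda>r z t. -1" f] by simp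

lemma smooth_field_diff [simp]:
  "smooth_field T f \<Longrightarrow> smooth_field T g \<Longrightarrow> smooth_field T (\<lambda>r z t. f r z t - g r z t)"
  using smooth_field_add[of T f "\<lambda>r z t. - g r z t"] by simp

lemma smooth_field_power [simp]: "smooth_field T f \<Longrightarrow> smooth_field T (\<lambda>r z t. f r z t ^ n)"
  by (induction n) simp_all

lemma smooth_field_divide [simp]:
  assumes "smooth_field T f"
  shows "smooth_field T (\<lambda>r z t. f r z t / r ^ n)" "smooth_field T (\<lambda>r z t. f r z t / r)"
    "smooth_field T (\<lambda>r z t. f r z t / c)"
proof -
  have "smooth_field T (\<lambda>r z t. f r z t * inverse r ^ n)" "smooth_field T (\<lambda>r z t. f r z t * inverse r)"
    "smooth_field T (\<lambda>r z t. f r z t * inverse c)"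
    by (simp_all only: smooth_field_mult smooth_field_power smooth_field_inverse_radius smooth_field_const assms)
  then show "smooth_field T (\<lambda>r z t. f r z t / r ^ n)" "smooth_field T (\<lambda>r z t. f r z t / r)"
    "smooth_field T (\<lambda>r z t. f r z t / c)"
    by (simp_all only: divide_inverse power_inverse)
qed

lemma smooth_field_reflect: "smooth_field T f \<Longrightarrow> smooth_field T (\<lambda>r z t. f r (- z) t)"
proof -
  have L: "bounded_linear (\<lambda>x::real\<times>real\<times>real. (fst x, - fst (snd x), snd (snd x)))"
    by (intro bounded_linear_Pair bounded_linear_minus bounded_linear_fst_comp bounded_linear_snd_comp
        bounded_linear_ident)
  have "(\<lambda>x::real\<times>real\<times>real. (fst x, - fst (snd x), snd (snd x))) ` spacetime T \<subseteq> spacetime T"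
    by auto
  from Ck_on_compose_linear[OF L this, of _ "\<lambda>(r, z, t). f r z t"]
  show "smooth_field T f \<Longrightarrow> smooth_field T (\<lambda>r z t. f r (- z) t)"
    by (simp add: smooth_field_def smooth_on_def split_def)
qed

lemma smooth_field_continuous:
  "smooth_field T f \<Longrightarrow> continuous_on (spacetime T) (\<lambda>(r, z, t). f r z t)"
  by (metis Ck_on.simps(1) smooth_field_def smooth_on_def)

text \<open>Time derivatives are taken within the half line, while smoothness is stated on the lifespan. The two
notions of limit agree because the lifespan is open at its upper end.\<close>

lemma at_within_lifespan:
  assumes "0 \<le> t" "ereal t < T"
  shows "at t within {t. 0 \<le> t \<and> ereal t < T} = at t within {0..}"
proof -
  obtain c where c: "t < c" "ereal c \<le> T"
  proof (cases T)
    case (real x) then show ?thesis using assms that[of x] by auto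
  next
    case PInf then show ?thesis using that[of "t+1"] by auto
  qed (use assms in auto)
  have "ereal s < T" if "s < c" for s using that c by (meson ereal_less_eq(3) less_ereal.simps(1) order_less_le_trans)
  then show ?thesis
    by (intro at_within_nhd[where S="{..<c}"]) (use c in auto)
qed

lemma at_within_radial_nontrivial: "pi \<le> r \<Longrightarrow> r \<le> 2*pi \<Longrightarrow> at r within {pi..2*pi} \<noteq> bot"
  using trivial_limit_within[of r "{pi..2*pi}"] by simp

lemma at_within_nonneg_nontrivial: "0 \<le> (t::real) \<Longrightarrow> at t within {0..} \<noteq> bot"
proof -
  assume "0 \<le> t"
  have "t islimpt {t..t+1}" by simp
  then have "t islimpt {0..}" by (rule islimpt_subset) (use \<open>0 \<le> t\<close> in auto)
  then show ?thesis using trivial_limit_within[of t "{0..}"] by simp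
qed

text \<open>The partial derivatives are values of the total derivative on the coordinate directions. Derivatives
within these intervals are unique, so they are the values that the operators \<open>d_r\<close>, \<open>d_z\<close>,
\<open>d_t\<close> select.\<close>

lemma partial_derivatives:
  assumes f: "((\<lambda>(r, z, t). f r z t) has_derivative D) (at (r, z, t) within spacetime T)"
    and m: "(r, z, t) \<in> spacetime T"
  shows "((\<lambda>s. f s z t) has_real_derivative D (1, 0, 0)) (at r within {pi..2*pi})"
    and "((\<lambda>s. f r s t) has_real_derivative D (0, 1, 0)) (at z)"
    and "((\<lambda>s. f r z s) has_real_derivative D (0, 0, 1)) (at t within {0..})"
    and "d_r f r z t = D (1, 0, 0)" "d_z f r z t = D (0, 1, 0)" "d_t f r z t = D (0, 0, 1)"
proof -
  have lin: "linear D" using f has_derivative_linear by blast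
  have along: "((\<lambda>s. (\<lambda>(r, z, t). f r z t) (h s)) has_real_derivative D v) (at a within A)"
    if "(h has_derivative (\<lambda>k. k *\<^sub>R v)) (at a within A)" "h a = (r, z, t)" "h ` A \<subseteq> spacetime T"
    for h v a A
  proof -
    have "((\<lambda>(r, z, t). f r z t) has_derivative D) (at (h a) within h ` A)"
      using has_derivative_subset[OF f that(3)] that(2) by simp
    from has_derivative_in_compose[OF that(1) this] show ?thesis
      by (rule has_derivative_imp_has_field_derivative) (simp add: linear_scale[OF lin])
  qed
  show a: "((\<lambda>s. f s z t) has_real_derivative D (1, 0, 0)) (at r within {pi..2*pi})"
  proof -
    have "((\<lambda>s. (s, z, t)) has_derivative (\<lambda>k. k *\<^sub>R (1, 0, 0))) (at r within {pi..2*pi})"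
      by (auto intro!: derivative_eq_intros simp: zero_prod_def)
    from along[OF this] show ?thesis using m by (simp add: image_subset_iff)
  qed
  show b: "((\<lambda>s. f r s t) has_real_derivative D (0, 1, 0)) (at z)"
  proof -
    have "((\<lambda>s. (r, s, t)) has_derivative (\<lambda>k. k *\<^sub>R (0, 1, 0))) (at z within UNIV)"
      by (auto intro!: derivative_eq_intros simp: zero_prod_def)
    from along[OF this] show ?thesis using m by (simp add: image_subset_iff)
  qed
  show c: "((\<lambda>s. f r z s) has_real_derivative D (0, 0, 1)) (at t within {0..})"
  proof -
    have "((\<lambda>s. (r, z, s)) has_derivative (\<lambda>k. k *\<^sub>R (0, 0, 1))) (at t within {t. 0 \<le> t \<and> ereal t < T})"
      by (auto intro!: derivative_eq_intros simp: zero_prod_def)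
    from along[OF this] show ?thesis using m at_within_lifespan[of t T] by (simp add: image_subset_iff)
  qed
  show "d_r f r z t = D (1, 0, 0)" "d_z f r z t = D (0, 1, 0)" "d_t f r z t = D (0, 0, 1)"
    unfolding d_r_def d_z_def d_t_def
    using a b c at_within_radial_nontrivial[of r] at_within_nonneg_nontrivial[of t] m
    by (auto simp: has_real_derivative_iff_has_vector_derivative intro!: vector_derivative_within)
qed

lemma smooth_field_derivative:
  assumes "smooth_field T f"
  obtains D where "\<And>x. x \<in> spacetime T \<Longrightarrow> ((\<lambda>(r, z, t). f r z t) has_derivative D x) (at x within spacetime T)"
    "\<And>v. Ck_on k (spacetime T) (\<lambda>x. D x v)"
  using assms unfolding smooth_field_def smooth_on_def by (metis Ck_on.simps(2))

lemma smooth_field_partials: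
  assumes "smooth_field T f" "(r, z, t) \<in> spacetime T"
  shows has_d_r: "((\<lambda>s. f s z t) has_real_derivative d_r f r z t) (at r within {pi..2*pi})"
    and has_d_z: "((\<lambda>s. f r s t) has_real_derivative d_z f r z t) (at z)"
    and has_d_t: "((\<lambda>s. f r z s) has_real_derivative d_t f r z t) (at t within {0..})"
proof -
  obtain D where "((\<lambda>(r, z, t). f r z t) has_derivative D (r, z, t)) (at (r, z, t) within spacetime T)"
    using smooth_field_derivative[OF assms(1)] assms(2) by metis
  note * = partial_derivatives[OF this assms(2)]
  show "((\<lambda>s. f s z t) has_real_derivative d_r f r z t) (at r within {pi..2*pi})"
    "((\<lambda>s. f r s t) has_real_derivative d_z f r z t) (at z)"
    "((\<lambda>s. f r z s) has_real_derivative d_t f r z t) (at t within {0..})"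
    using * by simp_all
qed

text \<open>Each \<open>Ck_on (Suc k)\<close> supplies its own total derivative. All of them agree with the partial
derivatives on space-time, so the partial derivatives are \<open>Ck_on k\<close> for every \<open>k\<close>.\<close>

lemma smooth_field_d [simp]:
  assumes "smooth_field T f"
  shows smooth_field_d_r: "smooth_field T (d_r f)"
    and smooth_field_d_z: "smooth_field T (d_z f)"
    and smooth_field_d_t: "smooth_field T (d_t f)"
proof -
  have "Ck_on k (spacetime T) (\<lambda>(r, z, t). d_r f r z t) \<and> Ck_on k (spacetime T) (\<lambda>(r, z, t). d_z f r z t)
    \<and> Ck_on k (spacetime T) (\<lambda>(r, z, t). d_t f r z t)" for k
  proof -
    obtain D where D: "\<And>x. x \<in> spacetime T \<Longrightarrow> ((\<lambda>(r, z, t). f r z t) has_derivative D x) (at x within spacetime T)"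
      "\<And>v. Ck_on k (spacetime T) (\<lambda>x. D x v)"
      using smooth_field_derivative[OF assms] by metis
    note * = partial_derivatives(4,5,6)[OF D(1)]
    show ?thesis
      using Ck_on_cong[OF _ D(2)[of "(1,0,0)"], of "\<lambda>(r, z, t). d_r f r z t"]
        Ck_on_cong[OF _ D(2)[of "(0,1,0)"], of "\<lambda>(r, z, t). d_z f r z t"]
        Ck_on_cong[OF _ D(2)[of "(0,0,1)"], of "\<lambda>(r, z, t). d_t f r z t"] *
      by (auto simp del: spacetime_iff)
  qed
  then show "smooth_field T (d_r f)" "smooth_field T (d_z f)" "smooth_field T (d_t f)"
    by (simp_all add: smooth_field_def smooth_on_def)
qed

lemma d_r_eqI:
  "((\<lambda>s. f s z t) has_real_derivative D) (at r within {pi..2*pi}) \<Longrightarrow> pi \<le> r \<Longrightarrow> r \<le> 2*pi \<Longrightarrow> d_r f r z t = D"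
  unfolding d_r_def using at_within_radial_nontrivial
  by (auto simp: has_real_derivative_iff_has_vector_derivative intro!: vector_derivative_within)

lemma d_z_eqI:
  "((\<lambda>s. f r s t) has_real_derivative D) (at z) \<Longrightarrow> d_z f r z t = D"
  unfolding d_z_def
  by (auto simp: has_real_derivative_iff_has_vector_derivative intro!: vector_derivative_at)

lemma d_t_eqI:
  "((\<lambda>s. f r z s) has_real_derivative D) (at t within {0..}) \<Longrightarrow> 0 \<le> t \<Longrightarrow> d_t f r z t = D"
  unfolding d_t_def using at_within_nonneg_nontrivial
  by (auto simp: has_real_derivative_iff_has_vector_derivative intro!: vector_derivative_within)

lemma has_real_derivative_cong_on:
  assumes "x \<in> S" "\<And>x. x \<in> S \<Longrightarrow> g x = f x" "(f has_real_derivative D) (at x within S)"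
  shows "(g has_real_derivative D) (at x within S)"
  using has_derivative_transform[OF assms(1,2)] assms(3) by (simp add: has_field_derivative_def)

text \<open>Equations that hold on space-time may be differentiated, although the fields are arbitrary outside.\<close>

lemma partials_cong:
  assumes f: "smooth_field T f" and fg: "\<And>r z t. (r, z, t) \<in> spacetime T \<Longrightarrow> f r z t = g r z t"
    and m: "(r, z, t) \<in> spacetime T"
  shows "d_r g r z t = d_r f r z t" "d_z g r z t = d_z f r z t" "d_t g r z t = d_t f r z t"
proof -
  show "d_r g r z t = d_r f r z t"
    by (rule d_r_eqI, rule has_real_derivative_cong_on[OF _ _ has_d_r[OF f m]]) (use m fg in auto)
  show "d_z g r z t = d_z f r z t"
    by (rule d_z_eqI, rule has_real_derivative_cong_on[OF _ _ has_d_z[OF f m]]) (use m fg in auto)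
  have "((\<lambda>s. g r z s) has_real_derivative d_t f r z t) (at t within {t. 0 \<le> t \<and> ereal t < T})"
    by (rule has_real_derivative_cong_on[where f="\<lambda>s. f r z s"])
       (use m fg has_d_t[OF f m] at_within_lifespan[of t T] in auto)
  then show "d_t g r z t = d_t f r z t"
    by (intro d_t_eqI) (use m at_within_lifespan[of t T] in auto)
qed

context
  fixes T :: ereal and f g :: field and r z t :: real
  assumes f: "smooth_field T f" and g: "smooth_field T g" and m: "(r, z, t) \<in> spacetime T"
begin

lemma partials_add:
  "d_r (\<lambda>r z t. f r z t + g r z t) r z t = d_r f r z t + d_r g r z t"
  "d_z (\<lambda>r z t. f r z t + g r z t) r z t = d_z f r z t + d_z g r z t"
  "d_t (\<lambda>r z t. f r z t + g r z t) r z t = d_t f r z t + d_t g r z t"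
  by (intro d_r_eqI d_z_eqI d_t_eqI DERIV_add has_d_r[OF f m] has_d_z[OF f m] has_d_t[OF f m]
      has_d_r[OF g m] has_d_z[OF g m] has_d_t[OF g m]; use m in simp)+

lemma partials_diff:
  "d_r (\<lambda>r z t. f r z t - g r z t) r z t = d_r f r z t - d_r g r z t"
  "d_z (\<lambda>r z t. f r z t - g r z t) r z t = d_z f r z t - d_z g r z t"
  "d_t (\<lambda>r z t. f r z t - g r z t) r z t = d_t f r z t - d_t g r z t"
  by (intro d_r_eqI d_z_eqI d_t_eqI DERIV_diff has_d_r[OF f m] has_d_z[OF f m] has_d_t[OF f m]
      has_d_r[OF g m] has_d_z[OF g m] has_d_t[OF g m]; use m in simp)+

lemma partials_mult:
  "d_r (\<lambda>r z t. f r z t * g r z t) r z t = d_r f r z t * g r z t + f r z t * d_r g r z t"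
  "d_z (\<lambda>r z t. f r z t * g r z t) r z t = d_z f r z t * g r z t + f r z t * d_z g r z t"
  "d_t (\<lambda>r z t. f r z t * g r z t) r z t = d_t f r z t * g r z t + f r z t * d_t g r z t"
  by (rule d_r_eqI d_z_eqI d_t_eqI, rule derivative_eq_intros, rule has_d_r[OF f m] has_d_z[OF f m] has_d_t[OF f m],
      rule has_d_r[OF g m] has_d_z[OF g m] has_d_t[OF g m]; use m in simp)+

end

lemma partials_const:
  "pi \<le> r \<Longrightarrow> r \<le> 2*pi \<Longrightarrow> d_r (\<lambda>r z t. h z t) r z t = 0"
  "d_z (\<lambda>r z t. h r t) r z t = 0"
  "0 \<le> t \<Longrightarrow> d_t (\<lambda>r z t. h r z) r z t = 0"
  by (rule d_r_eqI d_z_eqI d_t_eqI; simp)+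

lemma partials_minus:
  assumes "smooth_field T f" "(r, z, t) \<in> spacetime T"
  shows "d_r (\<lambda>r z t. - f r z t) r z t = - d_r f r z t" "d_z (\<lambda>r z t. - f r z t) r z t = - d_z f r z t"
    "d_t (\<lambda>r z t. - f r z t) r z t = - d_t f r z t"
  using partials_diff[OF smooth_field_const[of T 0] assms] assms(2) by (simp_all add: partials_const)

lemma d_r_radius:
  assumes "pi \<le> r" "r \<le> 2*pi"
  shows "d_r (\<lambda>r z t. r) r z t = 1" "d_r (\<lambda>r z t. inverse r) r z t = - (inverse r * inverse r)"
proof -
  have "r \<noteq> 0" using assms pi_gt_zero by linarith
  then show "d_r (\<lambda>r z t. r) r z t = 1" "d_r (\<lambda>r z t. inverse r) r z t = - (inverse r * inverse r)"
    using assms by (auto intro!: d_r_eqI derivative_eq_intros simp: power2_eq_square)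
qed

text \<open>Schwarz's theorem up to the boundary of a rectangle, where the derivatives are one-sided. Integrate
\<open>R = \<partial>\<^sub>y F\<close> in \<open>y\<close>, differentiate in \<open>x\<close> under the integral sign, and differentiate the result
in \<open>y\<close>.\<close>

lemma mixed_partials_commute_rectangle:
  fixes F P Q R S :: "real \<Rightarrow> real \<Rightarrow> real"
  assumes ab: "a < b" "c < d" and m: "x \<in> {a..b}" "y \<in> {c..d}"
    and P: "\<And>x y. x \<in> {a..b} \<Longrightarrow> y \<in> {c..d} \<Longrightarrow> ((\<lambda>s. F s y) has_real_derivative P x y) (at x within {a..b})"
    and Q: "\<And>x y. x \<in> {a..b} \<Longrightarrow> y \<in> {c..d} \<Longrightarrow> ((\<lambda>s. P x s) has_real_derivative Q x y) (at y within {c..d})"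
    and R: "\<And>x y. x \<in> {a..b} \<Longrightarrow> y \<in> {c..d} \<Longrightarrow> ((\<lambda>s. F x s) has_real_derivative R x y) (at y within {c..d})"
    and S: "\<And>x y. x \<in> {a..b} \<Longrightarrow> y \<in> {c..d} \<Longrightarrow> ((\<lambda>s. R s y) has_real_derivative S x y) (at x within {a..b})"
    and R_cont: "continuous_on ({a..b} \<times> {c..d}) (\<lambda>(x, y). R x y)"
    and S_cont: "continuous_on ({a..b} \<times> {c..d}) (\<lambda>(x, y). S x y)"
  shows "Q x y = S x y"
proof -
  have Scx: "continuous_on {c..d} (\<lambda>s. S x s)" if "x \<in> {a..b}" for x
    by (rule continuous_on_compose2[OF S_cont, of "{c..d}" "\<lambda>s. (x, s)", simplified])
       (use that in \<open>auto intro!: continuous_intros\<close>)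
  have Rc: "continuous_on {c..y} (\<lambda>s. R x s)" if "x \<in> {a..b}" "y \<in> {c..d}" for x y
    by (rule continuous_on_compose2[OF R_cont, of "{c..y}" "\<lambda>s. (x, s)", simplified])
       (use that in \<open>auto intro!: continuous_intros\<close>)
  have P_eq: "P x y - P x c = integral {c..y} (\<lambda>s. S x s)" if xy: "x \<in> {a..b}" "y \<in> {c..d}" for x y
  proof -
    have 1: "F x' y - F x' c = integral {c..y} (\<lambda>s. R x' s)" if "x' \<in> {a..b}" for x'
      by (rule integral_unique[symmetric], rule fundamental_theorem_of_calculus)
         (use that xy in \<open>auto intro!: has_field_derivative_subset[OF R] simp flip: has_real_derivative_iff_has_vector_derivative\<close>)
    have 2: "((\<lambda>x. integral (cbox c y) (R x)) has_field_derivative integral (cbox c y) (S x)) (at x within {a..b})"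
      by (rule leibniz_rule_field_derivative)
         (use xy S Rc in \<open>auto intro!: integrable_continuous_real continuous_on_subset[OF S_cont]\<close>)
    have 3: "((\<lambda>x. integral (cbox c y) (R x)) has_field_derivative P x y - P x c) (at x within {a..b})"
      by (rule has_real_derivative_cong_on[where f="\<lambda>x. F x y - F x c"])
         (use xy 1 ab P in \<open>auto intro!: DERIV_diff\<close>)
    show ?thesis
      using vector_derivative_unique_within[of x "{a..b}"] 2 3 xy ab
      by (auto simp: has_real_derivative_iff_has_vector_derivative trivial_limit_within)
  qed
  have 1: "((\<lambda>y. integral {c..y} (\<lambda>s. S x s)) has_vector_derivative S x y) (at y within {c..d})"
    by (rule integral_has_vector_derivative) (use Scx m in auto)
  have 2: "((\<lambda>y. P x c + integral {c..y} (\<lambda>s. S x s)) has_real_derivative S x y) (at y within {c..d})"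
    using DERIV_add[OF DERIV_const[of "P x c"] 1[folded has_real_derivative_iff_has_vector_derivative]] by simp
  have "P x y' = P x c + integral {c..y'} (\<lambda>s. S x s)" if "y' \<in> {c..d}" for y'
    using P_eq[OF m(1) that] by linarith
  from has_real_derivative_cong_on[OF m(2) this 2]
  have "((\<lambda>y. P x y) has_real_derivative S x y) (at y within {c..d})" .
  moreover have "at y within {c..d} \<noteq> bot" using m ab by (simp add: trivial_limit_within)
  ultimately show ?thesis
    using vector_derivative_unique_within Q[OF m]
    unfolding has_real_derivative_iff_has_vector_derivative by metis
qed

lemma smooth_field_continuous_compose:
  assumes "smooth_field T f" "continuous_on A a" "continuous_on A b" "continuous_on A c"
    and "\<And>x. x \<in> A \<Longrightarrow> (a x, b x, c x) \<in> spacetime T"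
  shows "continuous_on A (\<lambda>x. f (a x) (b x) (c x))"
  using continuous_on_compose2[OF smooth_field_continuous[OF assms(1)], of A "\<lambda>x. (a x, b x, c x)"] assms
  by (simp add: image_subset_iff continuous_on_Pair del: spacetime_iff)

lemma mixed_partials_commute:
  assumes f: "smooth_field T f" and m: "(r, z, t) \<in> spacetime T"
  shows "d_z (d_r f) r z t = d_r (d_z f) r z t"
    and "d_t (d_r f) r z t = d_r (d_t f) r z t"
    and "d_t (d_z f) r z t = d_z (d_t f) r z t"
proof -
  obtain c where c: "t < c" "ereal c < T"
  proof -
    have "ereal t < T" using m by simp
    then obtain e where "ereal t < e" "e < T" using dense by blast
    then show ?thesis using that[of "real_of_ereal e"] by (cases e) auto
  qed
  have T: "ereal s < T" if "s \<le> c" for s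
    using that c(2) by (meson ereal_less_eq(3) order_le_less_trans)
  note smooth = f smooth_field_d_r[OF f] smooth_field_d_z[OF f] smooth_field_d_t[OF f]
  have pi2: "pi < 2*pi" using pi_gt_zero by linarith
  have z1: "z - 1 < z + 1" by simp
  have c0: "0 < c" using m c by auto
  have mem: "r \<in> {pi..2*pi}" "z \<in> {z-1..z+1}" "t \<in> {0..c}" using m c by auto
  have drz: "continuous_on ({pi..2*pi} \<times> {z-1..z+1}) (\<lambda>(x, y). g x y t)" if "smooth_field T g" for g
    unfolding split_def
    by (rule smooth_field_continuous_compose[OF that]) (use m in \<open>auto intro!: continuous_intros\<close>)
  have drt: "continuous_on ({pi..2*pi} \<times> {0..c}) (\<lambda>(x, y). g x z y)" if "smooth_field T g" for g
    unfolding split_def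
    by (rule smooth_field_continuous_compose[OF that]) (use T in \<open>auto intro!: continuous_intros\<close>)
  have dzt: "continuous_on ({z-1..z+1} \<times> {0..c}) (\<lambda>(x, y). g r x y)" if "smooth_field T g" for g
    unfolding split_def
    by (rule smooth_field_continuous_compose[OF that]) (use T m in \<open>auto intro!: continuous_intros\<close>)
  have dr: "((\<lambda>s. g s z t) has_real_derivative d_r g r z t) (at r within {pi..2*pi})"
    if "smooth_field T g" "r \<in> {pi..2*pi}" "t \<in> {0..c}" for g r z t
    by (rule has_d_r[OF that(1)]) (use that T in auto)
  have dt: "((\<lambda>s. g r z s) has_real_derivative d_t g r z t) (at t within {0..c})"
    if "smooth_field T g" "r \<in> {pi..2*pi}" "t \<in> {0..c}" for g r z t
    by (rule has_field_derivative_subset[OF has_d_t[OF that(1)]]) (use that T in auto)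
  have dz: "((\<lambda>s. g r s t) has_real_derivative d_z g r z t) (at z within A)"
    if "smooth_field T g" "r \<in> {pi..2*pi}" "t \<in> {0..c}" for g r z t A
    by (rule has_field_derivative_at_within[OF has_d_z[OF that(1)]]) (use that T in auto)
  show "d_z (d_r f) r z t = d_r (d_z f) r z t"
    by (rule mixed_partials_commute_rectangle[OF pi2 z1 mem(1,2)
          dr[OF f _ mem(3)] dz[OF smooth(2) _ mem(3)] dz[OF f _ mem(3)] dr[OF smooth(3) _ mem(3)]
          drz[OF smooth(3)] drz[OF smooth_field_d_r[OF smooth(3)]]])
  show "d_t (d_r f) r z t = d_r (d_t f) r z t"
    by (rule mixed_partials_commute_rectangle[OF pi2 c0 mem(1,3)
          dr[OF f] dt[OF smooth(2)] dt[OF f] dr[OF smooth(4)]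
          drt[OF smooth(4)] drt[OF smooth_field_d_r[OF smooth(4)]]])
  show "d_t (d_z f) r z t = d_z (d_t f) r z t"
    by (rule mixed_partials_commute_rectangle[OF z1 c0 mem(2,3)
          dz[OF f mem(1)] dt[OF smooth(3) mem(1)] dt[OF f mem(1)] dz[OF smooth(4) mem(1)]
          dzt[OF smooth(4)] dzt[OF smooth_field_d_z[OF smooth(4)]]])
qed

section \<open>Integration over meridional rectangles\<close>

text \<open>The meridional measure is \<open>dr dz\<close>, without the weight \<open>r\<close>: the velocity satisfies
\<open>\<partial>\<^sub>r (r u\<^sup>r) + \<partial>\<^sub>z (r u\<^sup>z) = 0\<close>, and the factors \<open>r\<close> are kept in the integrands.\<close>

definition rz_integral :: "real \<Rightarrow> real \<Rightarrow> (real \<Rightarrow> real \<Rightarrow> real) \<Rightarrow> real" where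
  "rz_integral a b F = integral (cbox (pi, a) (2*pi, b)) (\<lambda>(r, z). F r z)"

abbreviation rz_continuous :: "real \<Rightarrow> real \<Rightarrow> (real \<Rightarrow> real \<Rightarrow> real) \<Rightarrow> bool" where
  "rz_continuous a b F \<equiv> continuous_on (cbox (pi, a) (2*pi, b)) (\<lambda>(r, z). F r z)"

lemma rz_continuous_smooth:
  "smooth_field T f \<Longrightarrow> 0 \<le> t \<Longrightarrow> ereal t < T \<Longrightarrow> rz_continuous a b (\<lambda>r z. f r z t)"
  unfolding split_def
  by (rule smooth_field_continuous_compose) (auto intro!: continuous_intros simp: cbox_Pair_eq)

lemma rz_continuousI:
  "continuous_on {pi..2*pi} f \<Longrightarrow> rz_continuous a b (\<lambda>r z. f r)"
  "continuous_on {a..b} g \<Longrightarrow> rz_continuous a b (\<lambda>r z. g z)"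
  using continuous_on_compose2[of "{pi..2*pi}" f "cbox (pi, a) (2*pi, b)" fst]
    continuous_on_compose2[of "{a..b}" g "cbox (pi, a) (2*pi, b)" snd]
  by (auto simp: split_def cbox_Pair_eq continuous_on_fst continuous_on_snd)

lemma rz_continuous_arith:
  assumes "rz_continuous a b F" "rz_continuous a b H"
  shows "rz_continuous a b (\<lambda>r z. F r z + H r z)" "rz_continuous a b (\<lambda>r z. F r z - H r z)"
    "rz_continuous a b (\<lambda>r z. F r z * H r z)"
  using assms unfolding split_def by (auto intro!: continuous_intros)

lemma rz_continuous_abs: "rz_continuous a b F \<Longrightarrow> rz_continuous a b (\<lambda>r z. \<bar>F r z\<bar>)"
  unfolding split_def by (rule continuous_on_rabs)

lemma rz_continuous_compose:
  assumes "rz_continuous a b F" "continuous_on A p" "continuous_on A q"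
    and "\<And>x. x \<in> A \<Longrightarrow> pi \<le> p x \<and> p x \<le> 2*pi \<and> a \<le> q x \<and> q x \<le> b"
  shows "continuous_on A (\<lambda>x. F (p x) (q x))"
proof -
  have "(\<lambda>x. (p x, q x)) ` A \<subseteq> cbox (pi, a) (2*pi, b)" using assms(4) by (auto simp: cbox_Pair_eq)
  from continuous_on_compose2[OF assms(1) continuous_on_Pair[OF assms(2,3)] this] show ?thesis by simp
qed

lemma rz_integrable: "rz_continuous a b F \<Longrightarrow> (\<lambda>(r, z). F r z) integrable_on cbox (pi, a) (2*pi, b)"
  by (rule integrable_continuous)

lemma rz_integral_add:
  "rz_continuous a b F \<Longrightarrow> rz_continuous a b G \<Longrightarrow>
   rz_integral a b (\<lambda>r z. F r z + G r z) = rz_integral a b F + rz_integral a b G"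
  unfolding rz_integral_def
  using integral_add[OF rz_integrable[of a b F] rz_integrable[of a b G]] by (simp add: split_def)

lemma rz_integral_diff:
  "rz_continuous a b F \<Longrightarrow> rz_continuous a b G \<Longrightarrow>
   rz_integral a b (\<lambda>r z. F r z - G r z) = rz_integral a b F - rz_integral a b G"
  unfolding rz_integral_def
  using integral_diff[OF rz_integrable[of a b F] rz_integrable[of a b G]] by (simp add: split_def)

lemma rz_integral_cmult: "rz_integral a b (\<lambda>r z. c * F r z) = c * rz_integral a b F"
  unfolding rz_integral_def using integral_mult_right[of "cbox (pi, a) (2*pi, b)" c "\<lambda>(r, z). F r z"]
  by (simp add: split_def)

lemma rz_integral_mono:
  assumes "rz_continuous a b F" "rz_continuous a b G"
    and "\<And>r z. pi \<le> r \<Longrightarrow> r \<le> 2*pi \<Longrightarrow> a \<le> z \<Longrightarrow> z \<le> b \<Longrightarrow> F r z \<le> G r z"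
  shows "rz_integral a b F \<le> rz_integral a b G"
  unfolding rz_integral_def
  by (rule integral_le[OF rz_integrable[OF assms(1)] rz_integrable[OF assms(2)]])
     (use assms(3) in \<open>auto simp: cbox_Pair_eq\<close>)

lemma rz_integral_cong:
  assumes "\<And>r z. pi \<le> r \<Longrightarrow> r \<le> 2*pi \<Longrightarrow> a \<le> z \<Longrightarrow> z \<le> b \<Longrightarrow> F r z = G r z"
  shows "rz_integral a b F = rz_integral a b G"
  unfolding rz_integral_def
  by (rule integral_cong) (use assms in \<open>auto simp: cbox_Pair_eq\<close>)

lemma rz_integral_iterated:
  assumes "rz_continuous a b F"
  shows "rz_integral a b F = integral {pi..2*pi} (\<lambda>r. integral {a..b} (\<lambda>z. F r z))"
    and "rz_integral a b F = integral {a..b} (\<lambda>z. integral {pi..2*pi} (\<lambda>r. F r z))"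
proof -
  show 1: "rz_integral a b F = integral {pi..2*pi} (\<lambda>r. integral {a..b} (\<lambda>z. F r z))"
    using integral_prod_continuous[OF assms] by (simp add: rz_integral_def)
  show "rz_integral a b F = integral {a..b} (\<lambda>z. integral {pi..2*pi} (\<lambda>r. F r z))"
    using integral_swap_continuous[OF assms] 1 by simp
qed

lemma rz_integral_separated:
  assumes "continuous_on {pi..2*pi} f" "continuous_on {a..b} g"
  shows "rz_integral a b (\<lambda>r z. f r * g z) = integral {pi..2*pi} f * integral {a..b} g"
proof -
  have "rz_continuous a b (\<lambda>r z. f r * g z)"
    unfolding split_def
    by (intro continuous_on_mult continuous_on_compose2[OF assms(1)] continuous_on_compose2[OF assms(2)]
        continuous_on_fst continuous_on_snd continuous_on_id) (auto simp: cbox_Pair_eq)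
  from rz_integral_iterated(1)[OF this] show ?thesis by simp
qed

lemma rz_integral_nonneg_eq_0:
  assumes "rz_continuous a b F" "a < b" "\<And>r z. pi \<le> r \<Longrightarrow> r \<le> 2*pi \<Longrightarrow> a \<le> z \<Longrightarrow> z \<le> b \<Longrightarrow> F r z \<ge> 0"
    and "rz_integral a b F = 0" "pi \<le> r" "r \<le> 2*pi" "a \<le> z" "z \<le> b"
  shows "F r z = 0"
proof -
  have "((\<lambda>(r, z). F r z) has_integral 0) (cbox (pi, a) (2*pi, b))"
    using integrable_integral[OF rz_integrable[OF assms(1)]] assms(4) by (simp add: rz_integral_def)
  moreover have "box (pi, a) (2*pi, b) \<noteq> {}"
    using assms(2) pi_gt_zero by (simp add: box_ne_empty Basis_prod_def ball_Un)
  moreover have "0 \<le> (\<lambda>(r, z). F r z) x" if "x \<in> box (pi, a) (2*pi, b)" for x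
    using subsetD[OF box_subset_cbox that] assms(3) by (auto simp: cbox_Pair_eq)
  ultimately show ?thesis
    using has_integral_0_cbox_imp_0[OF assms(1), of "(r, z)"] assms(5-8) by (simp add: cbox_Pair_eq)
qed

lemma rz_integral_radial:
  assumes "a \<le> b" "continuous_on {pi..2*pi} f"
  shows "rz_integral a b (\<lambda>r z. f r) = (b - a) * integral {pi..2*pi} f"
  using rz_integral_separated[OF assms(2), of a b "\<lambda>_. 1"] assms(1) by (simp add: mult.commute)

lemma rz_integral_axial:
  assumes "continuous_on {a..b} g"
  shows "rz_integral a b (\<lambda>r z. g z) = pi * integral {a..b} g"
  using rz_integral_separated[OF _ assms, of "\<lambda>_. 1"] by simp

lemma rz_integral_r_derivative:
  assumes "rz_continuous a b F'"
    and F: "\<And>r z. pi \<le> r \<Longrightarrow> r \<le> 2*pi \<Longrightarrow> a \<le> z \<Longrightarrow> z \<le> b \<Longrightarrow>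
      ((\<lambda>s. F s z) has_real_derivative F' r z) (at r within {pi..2*pi})"
  shows "rz_integral a b F' = integral {a..b} (\<lambda>z. F (2*pi) z - F pi z)"
proof -
  have "integral {pi..2*pi} (\<lambda>r. F' r z) = F (2*pi) z - F pi z" if "a \<le> z" "z \<le> b" for z
    by (rule integral_unique, rule fundamental_theorem_of_calculus)
       (use F that in \<open>auto simp flip: has_real_derivative_iff_has_vector_derivative\<close>)
  then have "integral {a..b} (\<lambda>z. integral {pi..2*pi} (\<lambda>r. F' r z)) = integral {a..b} (\<lambda>z. F (2*pi) z - F pi z)"
    by (intro integral_cong) auto
  then show ?thesis using rz_integral_iterated(2)[OF assms(1)] by simp
qed

lemma rz_integral_z_derivative:
  assumes "rz_continuous a b F'" "a \<le> b"
    and F: "\<And>r z. pi \<le> r \<Longrightarrow> r \<le> 2*pi \<Longrightarrow> a \<le> z \<Longrightarrow> z \<le> b \<Longrightarrow>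
      ((\<lambda>s. F r s) has_real_derivative F' r z) (at z within {a..b})"
  shows "rz_integral a b F' = integral {pi..2*pi} (\<lambda>r. F r b - F r a)"
proof -
  have "integral {a..b} (\<lambda>z. F' r z) = F r b - F r a" if "pi \<le> r" "r \<le> 2*pi" for r
    by (rule integral_unique, rule fundamental_theorem_of_calculus)
       (use F that assms(2) in \<open>auto simp flip: has_real_derivative_iff_has_vector_derivative\<close>)
  then have "integral {pi..2*pi} (\<lambda>r. integral {a..b} (\<lambda>z. F' r z)) = integral {pi..2*pi} (\<lambda>r. F r b - F r a)"
    by (intro integral_cong) auto
  then show ?thesis using rz_integral_iterated(1)[OF assms(1)] by simp
qed

lemma rz_integral_d_r:
  assumes f: "smooth_field T f" and t: "0 \<le> t" "ereal t < T"
  shows "rz_integral a b (\<lambda>r z. d_r f r z t) = integral {a..b} (\<lambda>z. f (2*pi) z t - f pi z t)"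
  by (rule rz_integral_r_derivative[OF rz_continuous_smooth[OF smooth_field_d_r[OF f] t]])
     (use has_d_r[OF f] t in simp)

lemma rz_integral_d_z:
  assumes f: "smooth_field T f" and t: "0 \<le> t" "ereal t < T" and ab: "a \<le> b"
  shows "rz_integral a b (\<lambda>r z. d_z f r z t) = integral {pi..2*pi} (\<lambda>r. f r b t - f r a t)"
  by (rule rz_integral_z_derivative[OF rz_continuous_smooth[OF smooth_field_d_z[OF f] t] ab])
     (use has_field_derivative_at_within[OF has_d_z[OF f]] t in simp)

text \<open>The form in which all integrations by parts are done: the integrand is written as a divergence
\<open>\<partial>\<^sub>r P + \<partial>\<^sub>z Q\<close> plus what remains.\<close>

lemma rz_integral_divergence:
  assumes "smooth_field T P" "smooth_field T Q" and t: "0 \<le> t" "ereal t < T" and ab: "a \<le> b"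
    and "\<And>z. a \<le> z \<Longrightarrow> z \<le> b \<Longrightarrow> P pi z t = 0" "\<And>z. a \<le> z \<Longrightarrow> z \<le> b \<Longrightarrow> P (2*pi) z t = 0"
    and "\<And>r. pi \<le> r \<Longrightarrow> r \<le> 2*pi \<Longrightarrow> Q r a t = Q r b t"
  shows "rz_integral a b (\<lambda>r z. d_r P r z t + d_z Q r z t) = 0"
proof -
  have "integral {a..b} (\<lambda>z. P (2*pi) z t - P pi z t) = integral {a..b} (\<lambda>z. 0)"
    "integral {pi..2*pi} (\<lambda>r. Q r b t - Q r a t) = integral {pi..2*pi} (\<lambda>r. 0)"
    by (rule integral_cong; use assms in simp)+
  then show ?thesis
    using rz_integral_add[OF rz_continuous_smooth[OF smooth_field_d_r[OF assms(1)] t]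
        rz_continuous_smooth[OF smooth_field_d_z[OF assms(2)] t]]
      rz_integral_d_r[OF assms(1) t] rz_integral_d_z[OF assms(2) t ab] by simp
qed

lemma rz_integral_d_t:
  assumes f: "smooth_field T f" and t: "0 \<le> t" "ereal t < T"
  shows "((\<lambda>t. rz_integral a b (\<lambda>r z. f r z t)) has_real_derivative rz_integral a b (\<lambda>r z. d_t f r z t))
    (at t within {0..})"
proof -
  let ?U = "{t. 0 \<le> t \<and> ereal t < T}"
  have cv: "convex ?U"
    unfolding is_interval_convex_1[symmetric] is_interval_1
    by (auto intro: order_le_less_trans[of "ereal _" "ereal _"])
  have "((\<lambda>t. integral (cbox (pi, a) (2*pi, b)) (\<lambda>x. f (fst x) (snd x) t)) has_field_derivative
     integral (cbox (pi, a) (2*pi, b)) (\<lambda>x. d_t f (fst x) (snd x) t)) (at t within ?U)"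
  proof (rule leibniz_rule_field_derivative)
    show "((\<lambda>t. f (fst x) (snd x) t) has_real_derivative d_t f (fst x) (snd x) t) (at t within ?U)"
      if "t \<in> ?U" "x \<in> cbox (pi, a) (2*pi, b)" for t x
      using has_d_t[OF f, of "fst x" "snd x" t] that at_within_lifespan[of t T] by (auto simp: cbox_Pair_eq)
    show "(\<lambda>x. f (fst x) (snd x) t) integrable_on cbox (pi, a) (2*pi, b)" if "t \<in> ?U" for t
      using rz_integrable[OF rz_continuous_smooth[OF f, of t]] that by (simp add: split_def)
    show "continuous_on (?U \<times> cbox (pi, a) (2*pi, b)) (\<lambda>(t, x). d_t f (fst x) (snd x) t)"
      unfolding split_def
      by (rule smooth_field_continuous_compose[OF smooth_field_d_t[OF f]])
         (auto intro!: continuous_intros simp: cbox_Pair_eq)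
  qed (use t cv in auto)
  then show ?thesis
    using at_within_lifespan[of t T] t by (simp add: rz_integral_def split_def)
qed

lemma smooth_field_bounded:
  assumes "smooth_field T f" "ereal c < T"
  obtains M where "M \<ge> 0" "\<And>r z t. pi \<le> r \<Longrightarrow> r \<le> 2*pi \<Longrightarrow> a \<le> z \<Longrightarrow> z \<le> b \<Longrightarrow> 0 \<le> t \<Longrightarrow> t \<le> c \<Longrightarrow> \<bar>f r z t\<bar> \<le> M"
proof -
  have "ereal t < T" if "t \<le> c" for t using that assms(2) by (meson ereal_less_eq(3) order_le_less_trans)
  then have "compact ((\<lambda>(r, z, t). f r z t) ` ({pi..2*pi} \<times> {a..b} \<times> {0..c}))"
    by (intro compact_continuous_image continuous_on_subset[OF smooth_field_continuous[OF assms(1)]] compact_Times)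
      auto
  then have "bounded ((\<lambda>(r, z, t). f r z t) ` ({pi..2*pi} \<times> {a..b} \<times> {0..c}))" by (rule compact_imp_bounded)
  then obtain M where "M > 0" "\<And>x. x \<in> (\<lambda>(r, z, t). f r z t) ` ({pi..2*pi} \<times> {a..b} \<times> {0..c}) \<Longrightarrow> norm x \<le> M"
    unfolding bounded_pos by blast
  then show thesis using that[of M] by force
qed

section \<open>Growth from differential inequalities\<close>

lemma growth_from_derivative:
  fixes E :: "real \<Rightarrow> real"
  assumes "\<And>s. 0 \<le> s \<Longrightarrow> s \<le> t \<Longrightarrow> (E has_real_derivative E' s) (at s within {0..})"
    and "\<And>s. 0 \<le> s \<Longrightarrow> s \<le> t \<Longrightarrow> E' s \<ge> k" and "0 \<le> t"
  shows "E t \<ge> E 0 + k * t"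
proof (cases "t = 0")
  case False
  then have "0 < t" using assms by simp
  have "(E has_derivative (\<lambda>h. E' s * h)) (at s within {0..t})" if "0 \<le> s" "s \<le> t" for s
    using has_field_derivative_subset[OF assms(1)[OF that], of "{0..t}"] by (auto simp: has_field_derivative_def)
  from mvt_simple[OF \<open>0 < t\<close> this]
  obtain x where "0 < x" "x < t" "E t - E 0 = E' x * t" by auto
  moreover have "k * t \<le> E' x * t" using assms(2)[of x] \<open>0 < x\<close> \<open>x < t\<close> \<open>0 < t\<close> by (intro mult_right_mono) auto
  ultimately show ?thesis by linarith
qed simp

text \<open>Multiply by the integrating factor \<open>exp (- C t)\<close>.\<close>

lemma gronwall_zero:
  fixes E :: "real \<Rightarrow> real"
  assumes "\<And>s. 0 \<le> s \<Longrightarrow> s \<le> t \<Longrightarrow> (E has_real_derivative E' s) (at s within {0..})"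
    and "\<And>s. 0 \<le> s \<Longrightarrow> s \<le> t \<Longrightarrow> E' s \<le> C * E s" and "0 \<le> t" "E 0 = 0"
  shows "E t \<le> 0"
proof -
  have "- (exp (- C * t) * E t) \<ge> - (exp (- C * 0) * E 0) + 0 * t"
  proof (rule growth_from_derivative[where E'="\<lambda>s. exp (- C * s) * (C * E s - E' s)"])
    show "((\<lambda>s. - (exp (- C * s) * E s)) has_real_derivative exp (- C * s) * (C * E s - E' s)) (at s within {0..})"
      if "0 \<le> s" "s \<le> t" for s
      using assms(1)[OF that] by (auto intro!: derivative_eq_intros simp: algebra_simps)
  qed (use assms in auto)
  then show ?thesis using assms(4) by (simp add: mult_le_0_iff)
qed

section \<open>Axisymmetric flows and their energy\<close>

definition periodic_field :: "ereal \<Rightarrow> field \<Rightarrow> bool" where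
  "periodic_field T f \<longleftrightarrow> (\<forall>r z t. (r, z, t) \<in> spacetime T \<longrightarrow> f r (z + 2*pi) t = f r z t)"

text \<open>The Euler equations in the unknowns \<open>G = r u\<^sup>\<theta>\<close>, \<open>X = \<omega>\<^sup>\<theta> / r\<close> and \<open>\<psi>\<close>, multiplied by \<open>r\<close> so that
the velocity enters only through derivatives of \<open>\<psi>\<close>. The elliptic equation is in divergence form.\<close>

definition axisymmetric_flow :: "ereal \<Rightarrow> field \<Rightarrow> field \<Rightarrow> field \<Rightarrow> bool" where
  "axisymmetric_flow T G X \<psi> \<longleftrightarrow>
     (\<forall>f\<in>{G, X, \<psi>}. smooth_field T f \<and> periodic_field T f) \<and>
     (\<forall>(r, z, t)\<in>spacetime T.
        r * d_t G r z t = d_z \<psi> r z t * d_r G r z t - d_r \<psi> r z t * d_z G r z t \<and>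
        r * d_t X r z t = d_z \<psi> r z t * d_r X r z t - d_r \<psi> r z t * d_z X r z t
          + 2 * G r z t * d_z G r z t * inverse r ^ 3 \<and>
        d_r (\<lambda>r z t. inverse r * d_r \<psi> r z t) r z t + d_z (\<lambda>r z t. inverse r * d_z \<psi> r z t) r z t
          = - r * X r z t \<and>
        \<psi> pi z t = 0 \<and> \<psi> (2*pi) z t = 0)"

lemma axisymmetric_flowD:
  assumes "axisymmetric_flow T G X \<psi>"
  shows "smooth_field T G" "smooth_field T X" "smooth_field T \<psi>"
    "periodic_field T G" "periodic_field T X" "periodic_field T \<psi>"
    "\<And>r z t. (r, z, t) \<in> spacetime T \<Longrightarrow>
       r * d_t G r z t = d_z \<psi> r z t * d_r G r z t - d_r \<psi> r z t * d_z G r z t"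
    "\<And>r z t. (r, z, t) \<in> spacetime T \<Longrightarrow>
       r * d_t X r z t = d_z \<psi> r z t * d_r X r z t - d_r \<psi> r z t * d_z X r z t
          + 2 * G r z t * d_z G r z t * inverse r ^ 3"
    "\<And>r z t. (r, z, t) \<in> spacetime T \<Longrightarrow>
        d_r (\<lambda>r z t. inverse r * d_r \<psi> r z t) r z t + d_z (\<lambda>r z t. inverse r * d_z \<psi> r z t) r z t
          = - r * X r z t"
    "\<And>z t. 0 \<le> t \<Longrightarrow> ereal t < T \<Longrightarrow> \<psi> pi z t = 0"
    "\<And>z t. 0 \<le> t \<Longrightarrow> ereal t < T \<Longrightarrow> \<psi> (2*pi) z t = 0"
proof -
  have "(pi, z, t) \<in> spacetime T" if "0 \<le> t" "ereal t < T" for z t using that by simp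
  then show "\<And>z t. 0 \<le> t \<Longrightarrow> ereal t < T \<Longrightarrow> \<psi> pi z t = 0"
    "\<And>z t. 0 \<le> t \<Longrightarrow> ereal t < T \<Longrightarrow> \<psi> (2*pi) z t = 0"
    using assms unfolding axisymmetric_flow_def by fast+
qed (use assms in \<open>unfold axisymmetric_flow_def, fast+\<close>)

lemma periodic_field_ends:
  "periodic_field T f \<Longrightarrow> pi \<le> r \<Longrightarrow> r \<le> 2*pi \<Longrightarrow> 0 \<le> t \<Longrightarrow> ereal t < T \<Longrightarrow> f r pi t = f r (- pi) t"
  unfolding periodic_field_def by (drule spec[of _ r], drule spec[of _ "- pi"], drule spec[of _ t]) simp

lemma periodic_field_partials:
  assumes f: "smooth_field T f" and p: "periodic_field T f"
  shows "periodic_field T (d_r f)" "periodic_field T (d_z f)" "periodic_field T (d_t f)"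
proof -
  let ?g = "\<lambda>r z t. f r (z + 2*pi) t"
  have eq: "f r z t = ?g r z t" if "(r, z, t) \<in> spacetime T" for r z t
    using p that unfolding periodic_field_def by (simp del: spacetime_iff)
  note * = partials_cong[OF f eq]
  have z: "d_z ?g r z t = d_z f r (z + 2*pi) t" if "(r, z, t) \<in> spacetime T" for r z t
    using DERIV_shift[of "\<lambda>s. f r s t" "d_z f r (z + 2*pi) t" z "2*pi"] has_d_z[OF f, of r "z + 2*pi" t] that
    by (intro d_z_eqI) auto
  show "periodic_field T (d_r f)" "periodic_field T (d_t f)"
    unfolding periodic_field_def using *(1,3) by (auto simp: d_r_def d_t_def simp del: spacetime_iff)
  show "periodic_field T (d_z f)"
    unfolding periodic_field_def using *(2) z by (auto simp del: spacetime_iff)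
qed

lemma periodic_field_diff:
  "periodic_field T f \<Longrightarrow> periodic_field T g \<Longrightarrow> periodic_field T (\<lambda>r z t. f r z t - g r z t)"
  unfolding periodic_field_def by (simp del: spacetime_iff)

lemma periodic_field_inverse_radius:
  "periodic_field T f \<Longrightarrow> periodic_field T (\<lambda>r z t. inverse r * f r z t)"
  unfolding periodic_field_def by (simp del: spacetime_iff)

lemma partials_divide:
  assumes "smooth_field T f" "(r, z, t) \<in> spacetime T"
  shows "d_r (\<lambda>r z t. f r z t / c) r z t = d_r f r z t / c" "d_z (\<lambda>r z t. f r z t / c) r z t = d_z f r z t / c"
    "d_t (\<lambda>r z t. f r z t / c) r z t = d_t f r z t / c"
  using partials_mult[OF assms(1) smooth_field_const[of T "inverse c"] assms(2)] assms(2)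
  by (simp_all add: partials_const divide_inverse)

lemma d_z_wall: "(\<And>z. f r z t = 0) \<Longrightarrow> d_z f r z t = 0"
  by (rule d_z_eqI) simp

text \<open>Half the sum of the squares of the velocity components, times \<open>r\<close>; here \<open>\<phi>\<close> is the stream function and \<open>g\<close>
is \<open>r\<close> times the angular velocity component. The products \<open>inverse r * d_r \<phi>\<close> and
\<open>inverse r * d_z \<phi>\<close> are left together because the elliptic equation involves their derivatives.\<close>

definition energy_density :: "field \<Rightarrow> field \<Rightarrow> field" where
  "energy_density g \<phi> = (\<lambda>r z t.
     (r * ((inverse r * d_r \<phi> r z t) * (inverse r * d_r \<phi> r z t)
         + (inverse r * d_z \<phi> r z t) * (inverse r * d_z \<phi> r z t))
      + inverse r * (g r z t * g r z t)) / 2)"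

text \<open>Over a full period in \<open>z\<close> the boundary terms cancel for every flow, symmetric or not; symmetry
is only known after uniqueness has been proved.\<close>

definition energy :: "field \<Rightarrow> field \<Rightarrow> real \<Rightarrow> real" where
  "energy g \<phi> t = rz_integral (- pi) pi (\<lambda>r z. energy_density g \<phi> r z t)"

lemma energy_density_nonneg: "0 \<le> r \<Longrightarrow> 0 \<le> energy_density g \<phi> r z t"
  unfolding energy_density_def by (simp add: add_nonneg_nonneg)

lemma smooth_energy_density: "smooth_field T g \<Longrightarrow> smooth_field T \<phi> \<Longrightarrow> smooth_field T (energy_density g \<phi>)"
  unfolding energy_density_def by simp

lemma axisymmetric_flow_of_euler_solution:
  assumes "euler_solution u0 w0 T u w \<psi>"
  shows "axisymmetric_flow T (\<lambda>r z t. r * u r z t) (\<lambda>r z t. w r z t / r) \<psi>"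
proof -
  have sm: "smooth_field T u" "smooth_field T w" "smooth_field T \<psi>"
    using assms by (auto simp: euler_solution_def smooth_field_def)
  have per: "periodic_field T u" "periodic_field T w" "periodic_field T \<psi>"
    using assms unfolding euler_solution_def periodic_field_def by fast+
  have smG: "smooth_field T (\<lambda>r z t. r * u r z t)" and smX: "smooth_field T (\<lambda>r z t. w r z t / r)"
    using sm by simp_all
  have eqs: "material_deriv \<psi> (\<lambda>r z t. r * u r z t) r z t = 0"
    "material_deriv \<psi> (\<lambda>r z t. w r z t / r) r z t = d_z (\<lambda>r z t. (r * u r z t)^2) r z t / r^4"
    "- (1 / r) * d_r (\<lambda>r z t. (1 / r) * d_r \<psi> r z t) r z t - (1 / r^2) * d_z (d_z \<psi>) r z t = w r z t / r"
    if "(r, z, t) \<in> spacetime T" for r z t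
    using assms that unfolding euler_solution_def by blast+
  have wall: "\<psi> pi z t = 0" "\<psi> (2*pi) z t = 0" if "0 \<le> t" "ereal t < T" for z t
    using assms that unfolding euler_solution_def by blast+
  have main: "r * d_t (\<lambda>r z t. r * u r z t) r z t
        = d_z \<psi> r z t * d_r (\<lambda>r z t. r * u r z t) r z t - d_r \<psi> r z t * d_z (\<lambda>r z t. r * u r z t) r z t"
    "r * d_t (\<lambda>r z t. w r z t / r) r z t
        = d_z \<psi> r z t * d_r (\<lambda>r z t. w r z t / r) r z t - d_r \<psi> r z t * d_z (\<lambda>r z t. w r z t / r) r z t
          + 2 * (r * u r z t) * d_z (\<lambda>r z t. r * u r z t) r z t * inverse r ^ 3"
    "d_r (\<lambda>r z t. inverse r * d_r \<psi> r z t) r z t + d_z (\<lambda>r z t. inverse r * d_z \<psi> r z t) r z t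
        = - r * (w r z t / r)"
    if m: "(r, z, t) \<in> spacetime T" for r z t
  proof -
    have "pi \<le> r" using m by simp
    then have "r > 0" using pi_gt_zero by linarith
    have clear: "r * (a + - p / r * b + q / r * c) = r * a - p * b + q * c" for a b c p q
      using \<open>r > 0\<close> by (simp add: field_simps)
    show "r * d_t (\<lambda>r z t. r * u r z t) r z t
        = d_z \<psi> r z t * d_r (\<lambda>r z t. r * u r z t) r z t - d_r \<psi> r z t * d_z (\<lambda>r z t. r * u r z t) r z t"
      using arg_cong[OF eqs(1)[OF m], of "\<lambda>x. r * x"]
      unfolding material_deriv_def vel_r_def vel_z_def clear by simp
    have sq: "d_z (\<lambda>r z t. (r * u r z t)^2) r z t = 2 * (r * u r z t) * d_z (\<lambda>r z t. r * u r z t) r z t"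
      using partials_mult(2)[OF smG smG m] by (simp add: power2_eq_square)
    have r4: "r * (x / r ^ 4) = x * inverse r ^ 3" for x
      using \<open>r > 0\<close> by (simp add: field_simps eval_nat_numeral)
    show "r * d_t (\<lambda>r z t. w r z t / r) r z t
        = d_z \<psi> r z t * d_r (\<lambda>r z t. w r z t / r) r z t - d_r \<psi> r z t * d_z (\<lambda>r z t. w r z t / r) r z t
          + 2 * (r * u r z t) * d_z (\<lambda>r z t. r * u r z t) r z t * inverse r ^ 3"
      using arg_cong[OF eqs(2)[OF m], of "\<lambda>x. r * x"]
      unfolding material_deriv_def vel_r_def vel_z_def clear sq r4 by simp
    have z2: "d_z (\<lambda>r z t. inverse r * d_z \<psi> r z t) r z t = inverse r * d_z (d_z \<psi>) r z t"
      using partials_mult(2)[OF smooth_field_inverse_radius smooth_field_d_z[OF sm(3)] m] by (simp add: partials_const)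
    have clear2: "- r * (- (1 / r) * a - (1 / r^2) * b) = a + inverse r * b" for a b
      using \<open>r > 0\<close> by (simp add: field_simps power2_eq_square)
    show "d_r (\<lambda>r z t. inverse r * d_r \<psi> r z t) r z t + d_z (\<lambda>r z t. inverse r * d_z \<psi> r z t) r z t
        = - r * (w r z t / r)"
      using arg_cong[OF eqs(3)[OF m], of "\<lambda>x. - r * x"]
      unfolding clear2 z2 by (simp add: inverse_eq_divide)
  qed
  have "periodic_field T (\<lambda>r z t. r * u r z t)" "periodic_field T (\<lambda>r z t. w r z t / r)"
    using per unfolding periodic_field_def by (simp_all del: spacetime_iff)
  note per' = this
  show ?thesis
    unfolding axisymmetric_flow_def
  proof (intro conjI ballI)
    fix x :: "real \<times> real \<times> real" assume "x \<in> spacetime T"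
    then obtain r z t where x: "x = (r, z, t)" and m: "(r, z, t) \<in> spacetime T" by (cases x) auto
    then have "0 \<le> t" "ereal t < T" by auto
    then show "case x of (r, z, t) \<Rightarrow>
        r * d_t (\<lambda>r z t. r * u r z t) r z t
          = d_z \<psi> r z t * d_r (\<lambda>r z t. r * u r z t) r z t - d_r \<psi> r z t * d_z (\<lambda>r z t. r * u r z t) r z t \<and>
        r * d_t (\<lambda>r z t. w r z t / r) r z t
          = d_z \<psi> r z t * d_r (\<lambda>r z t. w r z t / r) r z t - d_r \<psi> r z t * d_z (\<lambda>r z t. w r z t / r) r z t
            + 2 * (r * u r z t) * d_z (\<lambda>r z t. r * u r z t) r z t * inverse r ^ 3 \<and>
        d_r (\<lambda>r z t. inverse r * d_r \<psi> r z t) r z t + d_z (\<lambda>r z t. inverse r * d_z \<psi> r z t) r z t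
          = - r * (w r z t / r) \<and>
        \<psi> pi z t = 0 \<and> \<psi> (2*pi) z t = 0"
      unfolding x split using main[OF m] wall by blast
  qed (use smG smX sm per per' in auto)
qed

section \<open>Evolution of the energy of a difference of two flows\<close>

text \<open>Two flows on the same lifespan. Below, \<open>g\<close>, \<open>\<zeta>\<close>, \<open>\<phi>\<close> are the differences of the three unknowns, and
\<open>A\<close>, \<open>B\<close> are (up to sign) the components of the velocity difference in the meridional plane.\<close>

locale flow_pair =
  fixes T :: ereal and G1 X1 \<psi>1 G2 X2 \<psi>2 :: field
  assumes flow1: "axisymmetric_flow T G1 X1 \<psi>1" and flow2: "axisymmetric_flow T G2 X2 \<psi>2"
begin

definition "g = (\<lambda>r z t. G1 r z t - G2 r z t)"
definition "\<zeta> = (\<lambda>r z t. X1 r z t - X2 r z t)"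
definition "\<phi> = (\<lambda>r z t. \<psi>1 r z t - \<psi>2 r z t)"
definition "A = (\<lambda>r z t. inverse r * d_r \<phi> r z t)"
definition "B = (\<lambda>r z t. inverse r * d_z \<phi> r z t)"

lemmas smooth1 = axisymmetric_flowD(1-3)[OF flow1]
lemmas smooth2 = axisymmetric_flowD(1-3)[OF flow2]

lemma smooth_diff: "smooth_field T g" "smooth_field T \<zeta>" "smooth_field T \<phi>" "smooth_field T A" "smooth_field T B"
proof -
  show *: "smooth_field T g" "smooth_field T \<zeta>" "smooth_field T \<phi>"
    unfolding g_def \<zeta>_def \<phi>_def using smooth1 smooth2 by simp_all
  show "smooth_field T A" "smooth_field T B" unfolding A_def B_def using * by simp_all
qed

lemmas smooth = smooth1 smooth2 smooth_diff

lemma periodic: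
  "periodic_field T G1" "periodic_field T X1" "periodic_field T \<psi>1"
  "periodic_field T G2" "periodic_field T X2" "periodic_field T \<psi>2"
  "periodic_field T g" "periodic_field T \<zeta>" "periodic_field T \<phi>" "periodic_field T A" "periodic_field T B"
proof -
  show 1: "periodic_field T G1" "periodic_field T X1" "periodic_field T \<psi>1"
    "periodic_field T G2" "periodic_field T X2" "periodic_field T \<psi>2"
    using axisymmetric_flowD[OF flow1] axisymmetric_flowD[OF flow2] by auto
  show 2: "periodic_field T g" "periodic_field T \<zeta>" "periodic_field T \<phi>"
    unfolding g_def \<zeta>_def \<phi>_def using 1 by (intro periodic_field_diff; simp)+
  show "periodic_field T A" "periodic_field T B"
    unfolding A_def B_def using periodic_field_partials[OF smooth_diff(3) 2(3)]
    by (intro periodic_field_inverse_radius; simp)+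
qed

lemma partials_difference:
  assumes m: "(r, z, t) \<in> spacetime T"
  shows "d_r \<phi> r z t = d_r \<psi>1 r z t - d_r \<psi>2 r z t" "d_z \<phi> r z t = d_z \<psi>1 r z t - d_z \<psi>2 r z t"
    "d_r g r z t = d_r G1 r z t - d_r G2 r z t" "d_z g r z t = d_z G1 r z t - d_z G2 r z t"
    "d_t g r z t = d_t G1 r z t - d_t G2 r z t"
    "d_r \<zeta> r z t = d_r X1 r z t - d_r X2 r z t" "d_z \<zeta> r z t = d_z X1 r z t - d_z X2 r z t"
    "d_t \<zeta> r z t = d_t X1 r z t - d_t X2 r z t"
  unfolding \<phi>_def g_def \<zeta>_def by (simp_all add: partials_diff[OF _ _ m] smooth del: spacetime_iff)

lemma elliptic_difference:
  assumes m: "(r, z, t) \<in> spacetime T"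
  shows "d_r A r z t + d_z B r z t = - r * \<zeta> r z t"
proof -
  have "d_r A r z t = d_r (\<lambda>r z t. inverse r * d_r \<psi>1 r z t - inverse r * d_r \<psi>2 r z t) r z t"
    by (rule partials_cong(1)[OF _ _ m, symmetric, OF smooth(10)])
       (simp add: A_def partials_difference algebra_simps del: spacetime_iff)
  moreover have "d_z B r z t = d_z (\<lambda>r z t. inverse r * d_z \<psi>1 r z t - inverse r * d_z \<psi>2 r z t) r z t"
    by (rule partials_cong(2)[OF _ _ m, symmetric, OF smooth(11)])
       (simp add: B_def partials_difference algebra_simps del: spacetime_iff)
  ultimately show ?thesis
    using axisymmetric_flowD(9)[OF flow1 m] axisymmetric_flowD(9)[OF flow2 m]
      partials_diff[of T "\<lambda>r z t. inverse r * d_r \<psi>1 r z t" "\<lambda>r z t. inverse r * d_r \<psi>2 r z t", OF _ _ m]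
      partials_diff[of T "\<lambda>r z t. inverse r * d_z \<psi>1 r z t" "\<lambda>r z t. inverse r * d_z \<psi>2 r z t", OF _ _ m]
    by (simp add: smooth \<zeta>_def algebra_simps del: spacetime_iff)
qed

text \<open>This is where time derivatives are exchanged with derivatives in space; it lets
\<open>\<partial>\<^sub>t\<close> of the kinetic energy be paired with \<open>\<partial>\<^sub>t \<zeta>\<close>.\<close>

lemma elliptic_difference_d_t:
  assumes m: "(r, z, t) \<in> spacetime T"
  shows "d_r (d_t A) r z t + d_z (d_t B) r z t = - r * d_t \<zeta> r z t"
proof -
  have "d_t (\<lambda>r z t. - r * \<zeta> r z t) r z t = d_t (\<lambda>r z t. d_r A r z t + d_z B r z t) r z t"
    by (rule partials_cong(3)[OF _ _ m]) (simp_all add: smooth elliptic_difference del: spacetime_iff)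
  also have "\<dots> = d_r (d_t A) r z t + d_z (d_t B) r z t"
    using m by (simp add: partials_add[OF _ _ m] mixed_partials_commute[OF _ m] smooth del: spacetime_iff)
  also have "d_t (\<lambda>r z t. - r * \<zeta> r z t) r z t = - r * d_t \<zeta> r z t"
    using partials_mult(3)[OF _ smooth(8) m, of "\<lambda>r z t. - r"] m partials_const(3)[of t "\<lambda>r z. - r" r z] by simp
  finally show ?thesis by simp
qed

definition "flux_r = (\<lambda>r z t. \<phi> r z t * d_t A r z t + \<phi> r z t * d_z \<phi> r z t * X2 r z t
   + \<phi> r z t * d_z \<psi>1 r z t * \<zeta> r z t + d_z \<psi>1 r z t * g r z t * g r z t * inverse r * inverse r / 2)"

definition "flux_z = (\<lambda>r z t. \<phi> r z t * d_t B r z t - \<phi> r z t * d_r \<phi> r z t * X2 r z t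
   - \<phi> r z t * d_r \<psi>1 r z t * \<zeta> r z t
   + \<phi> r z t * g r z t * (G1 r z t + G2 r z t) * inverse r * inverse r * inverse r
   - d_r \<psi>1 r z t * g r z t * g r z t * inverse r * inverse r / 2)"

text \<open>What remains of the energy balance after all divergences have been split off. With the second flow at
rest, \<open>\<phi> = \<psi>1\<close> and \<open>g = G1\<close>, and all terms cancel or vanish.\<close>

definition "source = (\<lambda>r z t. \<zeta> r z t * (d_z \<phi> r z t * d_r \<psi>1 r z t - d_r \<phi> r z t * d_z \<psi>1 r z t)
   - d_z \<phi> r z t * g r z t * (G1 r z t + G2 r z t) * inverse r ^ 3
   + d_z \<psi>1 r z t * g r z t * g r z t * inverse r ^ 3
   + g r z t * (d_z \<phi> r z t * d_r G2 r z t - d_r \<phi> r z t * d_z G2 r z t) * inverse r ^ 2)"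

text \<open>From \<open>\<partial>\<^sub>r A + \<partial>\<^sub>z B = - r \<zeta>\<close>, the meridional part of the energy density has time derivative \<open>\<phi> r \<partial>\<^sub>t \<zeta>\<close>
up to a divergence. Now insert the evolution equations. The term \<open>\<phi> (\<partial>\<^sub>z \<phi> \<partial>\<^sub>r X2 - \<partial>\<^sub>r \<phi> \<partial>\<^sub>z X2)\<close> is a
divergence by itself; in the transport of \<open>\<zeta>\<close>, of \<open>g\<^sup>2\<close>, and in the swirl source, the
derivatives are moved away from \<open>\<zeta>\<close>, \<open>g\<^sup>2\<close> and \<open>g (G1 + G2)\<close>.\<close>

lemma energy_density_evolution:
  assumes m: "(r, z, t) \<in> spacetime T"
  shows "d_t (energy_density g \<phi>) r z t = d_r flux_r r z t + d_z flux_z r z t + source r z t"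
proof -
  have rr: "pi \<le> r" "r \<le> 2*pi" "0 \<le> t" using m by auto
  then have r0: "r \<noteq> 0" using pi_gt_zero by linarith
  define i where "i = inverse r"
  note D = partials_add[OF _ _ m] partials_diff[OF _ _ m] partials_mult[OF _ _ m] partials_minus[OF _ m]
    partials_divide[OF _ m] partials_const rr d_r_radius[OF rr(1,2)] smooth
  have e: "energy_density g \<phi> = (\<lambda>r z t. (r * (A r z t * A r z t + B r z t * B r z t)
      + inverse r * (g r z t * g r z t)) / 2)"
    by (simp add: energy_density_def A_def B_def)
  have hA: "r * A r z t = d_r \<phi> r z t" "r * B r z t = d_z \<phi> r z t"
    unfolding A_def B_def using r0 by simp_all
  have et: "d_t (energy_density g \<phi>) r z t
     = (r * A r z t) * d_t A r z t + (r * B r z t) * d_t B r z t + i * i * g r z t * (r * d_t g r z t)"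
    unfolding e using r0 by (simp add: D i_def del: spacetime_iff) (simp add: algebra_simps)
  have hg: "r * d_t g r z t = d_z \<psi>1 r z t * d_r g r z t - d_r \<psi>1 r z t * d_z g r z t
     + d_z \<phi> r z t * d_r G2 r z t - d_r \<phi> r z t * d_z G2 r z t"
    using axisymmetric_flowD(7)[OF flow1 m] axisymmetric_flowD(7)[OF flow2 m]
    by (simp add: partials_difference[OF m] algebra_simps)
  have gv: "g r z t = G1 r z t - G2 r z t" by (simp add: g_def)
  \<comment> \<open>\<open>G1\<^sup>2 - G2\<^sup>2 = g (G1 + G2)\<close> is used here in differentiated form.\<close>
  have hz: "r * d_t \<zeta> r z t = d_z \<psi>1 r z t * d_r \<zeta> r z t - d_r \<psi>1 r z t * d_z \<zeta> r z t
     + d_z \<phi> r z t * d_r X2 r z t - d_r \<phi> r z t * d_z X2 r z t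
     + (d_z g r z t * (G1 r z t + G2 r z t) + g r z t * (d_z G1 r z t + d_z G2 r z t)) * i ^ 3"
    using axisymmetric_flowD(8)[OF flow1 m] axisymmetric_flowD(8)[OF flow2 m]
    by (simp add: partials_difference[OF m] gv i_def algebra_simps)
  have fr: "d_r flux_r r z t = d_r \<phi> r z t * d_t A r z t + \<phi> r z t * d_r (d_t A) r z t
     + d_r \<phi> r z t * d_z \<phi> r z t * X2 r z t + \<phi> r z t * d_r (d_z \<phi>) r z t * X2 r z t
     + \<phi> r z t * d_z \<phi> r z t * d_r X2 r z t
     + d_r \<phi> r z t * d_z \<psi>1 r z t * \<zeta> r z t + \<phi> r z t * d_r (d_z \<psi>1) r z t * \<zeta> r z t
     + \<phi> r z t * d_z \<psi>1 r z t * d_r \<zeta> r z t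
     + d_r (d_z \<psi>1) r z t * g r z t * g r z t * i * i / 2 + d_z \<psi>1 r z t * g r z t * d_r g r z t * i * i
     - d_z \<psi>1 r z t * g r z t * g r z t * i * i * i"
    unfolding flux_r_def
    by (simp add: D i_def del: spacetime_iff) (simp add: algebra_simps add_divide_distrib diff_divide_distrib)
  have fz: "d_z flux_z r z t = d_z \<phi> r z t * d_t B r z t + \<phi> r z t * d_z (d_t B) r z t
     - d_z \<phi> r z t * d_r \<phi> r z t * X2 r z t - \<phi> r z t * d_r (d_z \<phi>) r z t * X2 r z t
     - \<phi> r z t * d_r \<phi> r z t * d_z X2 r z t
     - d_z \<phi> r z t * d_r \<psi>1 r z t * \<zeta> r z t - \<phi> r z t * d_r (d_z \<psi>1) r z t * \<zeta> r z t
     - \<phi> r z t * d_r \<psi>1 r z t * d_z \<zeta> r z t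
     + d_z \<phi> r z t * g r z t * (G1 r z t + G2 r z t) * i * i * i
     + \<phi> r z t * (d_z g r z t * (G1 r z t + G2 r z t) + g r z t * (d_z G1 r z t + d_z G2 r z t)) * i * i * i
     - d_r (d_z \<psi>1) r z t * g r z t * g r z t * i * i / 2 - d_r \<psi>1 r z t * g r z t * d_z g r z t * i * i"
    unfolding flux_z_def
    by (simp add: D i_def mixed_partials_commute(1)[OF _ m] del: spacetime_iff) (simp add: algebra_simps)
  have AB: "\<phi> r z t * d_r (d_t A) r z t + \<phi> r z t * d_z (d_t B) r z t = - \<phi> r z t * (r * d_t \<zeta> r z t)"
    using elliptic_difference_d_t[OF m] by (simp add: algebra_simps flip: distrib_left)
  have "d_r flux_r r z t + d_z flux_z r z t + source r z t
     = (\<phi> r z t * d_r (d_t A) r z t + \<phi> r z t * d_z (d_t B) r z t) + \<phi> r z t * (r * d_t \<zeta> r z t)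
       + d_r \<phi> r z t * d_t A r z t + d_z \<phi> r z t * d_t B r z t + i * i * g r z t * (r * d_t g r z t)"
    unfolding fr fz hg hz source_def i_def[symmetric]
    by (simp add: algebra_simps power2_eq_square power3_eq_cube)
  also have "\<dots> = d_t (energy_density g \<phi>) r z t"
    unfolding AB et hA by simp
  finally show ?thesis by simp
qed

text \<open>Both stream functions vanish on the walls, and with them their tangential derivatives.\<close>

lemma wall:
  assumes "0 \<le> t" "ereal t < T"
  shows "\<psi>1 pi z t = 0" "\<psi>1 (2*pi) z t = 0" "d_z \<psi>1 pi z t = 0" "d_z \<psi>1 (2*pi) z t = 0"
    "\<phi> pi z t = 0" "\<phi> (2*pi) z t = 0" "d_z \<phi> pi z t = 0" "d_z \<phi> (2*pi) z t = 0"
proof -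
  show *: "\<psi>1 pi z t = 0" "\<psi>1 (2*pi) z t = 0" "\<phi> pi z t = 0" "\<phi> (2*pi) z t = 0" for z
    using assms axisymmetric_flowD(10,11)[OF flow1] axisymmetric_flowD(10,11)[OF flow2] by (simp_all add: \<phi>_def)
  show "d_z \<psi>1 pi z t = 0" "d_z \<psi>1 (2*pi) z t = 0" "d_z \<phi> pi z t = 0" "d_z \<phi> (2*pi) z t = 0"
    by (rule d_z_wall, rule *)+
qed

lemma ends:
  assumes "pi \<le> r" "r \<le> 2*pi" "0 \<le> t" "ereal t < T"
  shows "G1 r pi t = G1 r (-pi) t" "G2 r pi t = G2 r (-pi) t" "X2 r pi t = X2 r (-pi) t"
    "\<phi> r pi t = \<phi> r (-pi) t" "g r pi t = g r (-pi) t" "\<zeta> r pi t = \<zeta> r (-pi) t"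
    "A r pi t = A r (-pi) t" "B r pi t = B r (-pi) t"
    "d_t A r pi t = d_t A r (-pi) t" "d_t B r pi t = d_t B r (-pi) t"
    "d_r \<phi> r pi t = d_r \<phi> r (-pi) t" "d_z \<phi> r pi t = d_z \<phi> r (-pi) t"
    "d_r \<psi>1 r pi t = d_r \<psi>1 r (-pi) t" "d_z \<psi>1 r pi t = d_z \<psi>1 r (-pi) t"
  by (rule periodic_field_ends[OF _ assms]; rule periodic periodic_field_partials smooth; (rule smooth periodic)?)+

lemma smooth_fluxes: "smooth_field T flux_r" "smooth_field T flux_z" "smooth_field T source"
  unfolding flux_r_def flux_z_def source_def by (simp_all add: smooth)

lemma has_derivative_energy:
  assumes t: "0 \<le> t" "ereal t < T"
  shows "(energy g \<phi> has_real_derivative rz_integral (- pi) pi (\<lambda>r z. source r z t)) (at t within {0..})"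
proof -
  note c = rz_continuous_smooth[OF _ t]
  have "rz_integral (- pi) pi (\<lambda>r z. d_r flux_r r z t + d_z flux_z r z t) = 0"
  proof (rule rz_integral_divergence[OF smooth_fluxes(1,2) t])
    show "flux_r pi z t = 0" "flux_r (2*pi) z t = 0" for z
      by (simp_all add: flux_r_def wall[OF t])
    show "flux_z r (- pi) t = flux_z r pi t" if "pi \<le> r" "r \<le> 2*pi" for r
      by (simp add: flux_z_def ends[OF that t])
  qed simp
  moreover have "rz_integral (- pi) pi (\<lambda>r z. d_t (energy_density g \<phi>) r z t)
      = rz_integral (- pi) pi (\<lambda>r z. (d_r flux_r r z t + d_z flux_z r z t) + source r z t)"
    by (rule rz_integral_cong) (use energy_density_evolution t in auto)
  moreover have "\<dots> = rz_integral (- pi) pi (\<lambda>r z. d_r flux_r r z t + d_z flux_z r z t)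
      + rz_integral (- pi) pi (\<lambda>r z. source r z t)"
    by (rule rz_integral_add) (auto intro!: c[of "\<lambda>r z t. d_r flux_r r z t + d_z flux_z r z t"] c
        smooth_field_add smooth_field_d smooth_fluxes)
  ultimately show ?thesis
    using rz_integral_d_t[OF smooth_energy_density[OF smooth_diff(1,3)] t, of "- pi" pi]
    by (simp add: energy_def[abs_def])
qed

definition "a = (\<lambda>r z t. inverse r * d_z \<psi>1 r z t)"
definition "b = (\<lambda>r z t. - (inverse r * d_r \<psi>1 r z t))"
definition "q = (\<lambda>r z t. (d_r \<phi> r z t * d_r \<phi> r z t + d_z \<phi> r z t * d_z \<phi> r z t) / 2)"
text \<open>Minus the velocity of the first flow, with components \<open>a\<close> and \<open>b\<close>, applied as a derivation to \<open>\<phi>\<close>.\<close>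

definition "Y = (\<lambda>r z t. a r z t * d_r \<phi> r z t + b r z t * d_z \<phi> r z t)"
definition "stress_r = (\<lambda>r z t. A r z t * Y r z t - inverse r * a r z t * q r z t)"
definition "stress_z = (\<lambda>r z t. B r z t * Y r z t - inverse r * b r z t * q r z t)"
text \<open>A quadratic form in \<open>\<partial>\<^sub>r \<phi>\<close>, \<open>\<partial>\<^sub>z \<phi>\<close> and \<open>g\<close> whose coefficients are smooth fields of the two flows:
no derivative falls on the differences any more.\<close>

definition "quadratic_source = (\<lambda>r z t.
   - (inverse r * d_r a r z t) * (d_r \<phi> r z t * d_r \<phi> r z t)
   - (inverse r * (d_r b r z t + d_z a r z t)) * (d_r \<phi> r z t * d_z \<phi> r z t)
   - (inverse r * d_z b r z t) * (d_z \<phi> r z t * d_z \<phi> r z t)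
   + (d_r (\<lambda>r z t. inverse r * a r z t) r z t + inverse r * d_z b r z t) * q r z t
   - ((G1 r z t + G2 r z t) * inverse r ^ 3) * (d_z \<phi> r z t * g r z t)
   + (d_z \<psi>1 r z t * inverse r ^ 3) * (g r z t * g r z t)
   + (d_r G2 r z t * inverse r ^ 2) * (d_z \<phi> r z t * g r z t)
   - (d_z G2 r z t * inverse r ^ 2) * (d_r \<phi> r z t * g r z t))"

lemma smooth_stress:
  "smooth_field T a" "smooth_field T b" "smooth_field T q" "smooth_field T Y"
  "smooth_field T stress_r" "smooth_field T stress_z"
proof -
  show 1: "smooth_field T a" "smooth_field T b" "smooth_field T q"
    unfolding a_def b_def q_def by (simp_all add: smooth)
  then show 2: "smooth_field T Y" unfolding Y_def by (simp add: smooth)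
  show "smooth_field T stress_r" "smooth_field T stress_z"
    unfolding stress_r_def stress_z_def by (simp_all add: smooth 1 2)
qed

text \<open>The difference \<open>\<zeta>\<close> of the vorticities is not controlled by the energy. But
\<open>- r \<zeta> = \<partial>\<^sub>r A + \<partial>\<^sub>z B\<close>, so its product with \<open>Y\<close> is a divergence minus \<open>A \<partial>\<^sub>r Y + B \<partial>\<^sub>z Y\<close>. There the second
derivatives of \<open>\<phi>\<close> combine to \<open>(a \<partial>\<^sub>r q + b \<partial>\<^sub>z q) / r\<close>, which is again a divergence up to a multiple of
\<open>q\<close>. (In Cartesian coordinates this is the stress tensor form of the Euler nonlinearity.)\<close>

lemma source_stress_form:
  assumes m: "(r, z, t) \<in> spacetime T"
  shows "source r z t = d_r stress_r r z t + d_z stress_z r z t + quadratic_source r z t"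
proof -
  have rr: "pi \<le> r" "r \<le> 2*pi" "0 \<le> t" using m by auto
  then have r0: "r \<noteq> 0" using pi_gt_zero by linarith
  note D = partials_add[OF _ _ m] partials_diff[OF _ _ m] partials_mult[OF _ _ m] partials_minus[OF _ m]
    partials_divide[OF _ m] partials_const rr d_r_radius[OF rr(1,2)] smooth smooth_stress
  define i where "i = inverse r"
  have Av: "A r z t = i * d_r \<phi> r z t" "B r z t = i * d_z \<phi> r z t" by (simp_all add: A_def B_def i_def)
  have \<psi>v: "d_z \<psi>1 r z t = r * a r z t" "d_r \<psi>1 r z t = - (r * b r z t)"
    using r0 by (simp_all add: a_def b_def)
  have ia: "d_r (\<lambda>r z t. inverse r * a r z t) r z t = i * d_r a r z t - i * i * a r z t"
    by (simp add: D i_def del: spacetime_iff) 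
  have Yr: "d_r Y r z t = d_r a r z t * d_r \<phi> r z t + a r z t * d_r (d_r \<phi>) r z t
      + d_r b r z t * d_z \<phi> r z t + b r z t * d_r (d_z \<phi>) r z t"
    unfolding Y_def by (simp add: D del: spacetime_iff)
  have Yz: "d_z Y r z t = d_z a r z t * d_r \<phi> r z t + a r z t * d_r (d_z \<phi>) r z t
      + d_z b r z t * d_z \<phi> r z t + b r z t * d_z (d_z \<phi>) r z t"
    unfolding Y_def by (simp add: D mixed_partials_commute(1)[OF _ m] del: spacetime_iff)
  have qr: "d_r q r z t = d_r \<phi> r z t * d_r (d_r \<phi>) r z t + d_z \<phi> r z t * d_r (d_z \<phi>) r z t"
    unfolding q_def by (simp add: D del: spacetime_iff)
  have qz: "d_z q r z t = d_r \<phi> r z t * d_r (d_z \<phi>) r z t + d_z \<phi> r z t * d_z (d_z \<phi>) r z t"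
    unfolding q_def by (simp add: D mixed_partials_commute(1)[OF _ m] del: spacetime_iff)
  have sr: "d_r stress_r r z t = d_r A r z t * Y r z t + A r z t * d_r Y r z t
     - (i * d_r a r z t - i * i * a r z t) * q r z t - i * a r z t * d_r q r z t"
    unfolding stress_r_def by (simp add: D ia[unfolded i_def] i_def del: spacetime_iff)
  have sz: "d_z stress_z r z t = d_z B r z t * Y r z t + B r z t * d_z Y r z t
     - i * d_z b r z t * q r z t - i * b r z t * d_z q r z t"
    unfolding stress_z_def by (simp add: D i_def del: spacetime_iff)
  have J: "\<zeta> r z t * (d_z \<phi> r z t * d_r \<psi>1 r z t - d_r \<phi> r z t * d_z \<psi>1 r z t)
     = d_r A r z t * Y r z t + d_z B r z t * Y r z t"
  proof -
    have "\<zeta> r z t * (d_z \<phi> r z t * d_r \<psi>1 r z t - d_r \<phi> r z t * d_z \<psi>1 r z t) = (- r * \<zeta> r z t) * Y r z t"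
      unfolding \<psi>v Y_def by (simp add: algebra_simps)
    then show ?thesis unfolding elliptic_difference[OF m, symmetric] by (simp add: algebra_simps)
  qed
  show ?thesis
    unfolding source_def J quadratic_source_def ia sr sz qr qz Yr Yz Av i_def[symmetric]
    by (simp add: algebra_simps)
qed

text \<open>The coefficients are bounded on compact time intervals, and the square of each of \<open>\<partial>\<^sub>r \<phi>\<close>, \<open>\<partial>\<^sub>z \<phi>\<close>,
\<open>g\<close> is at most \<open>2 r\<close> times the energy density.\<close>

lemma quadratic_source_bound:
  assumes c: "ereal c < T"
  obtains K where "\<And>r z t. pi \<le> r \<Longrightarrow> r \<le> 2*pi \<Longrightarrow> -pi \<le> z \<Longrightarrow> z \<le> pi \<Longrightarrow> 0 \<le> t \<Longrightarrow> t \<le> c \<Longrightarrow>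
     quadratic_source r z t \<le> K * energy_density g \<phi> r z t"
proof -
  \<comment> \<open>The coefficients of \<open>quadratic_source\<close> in order of appearance, with their signs.\<close>
  define C where "C = [\<lambda>r z t. - (inverse r * d_r a r z t),
     \<lambda>r z t. - (inverse r * (d_r b r z t + d_z a r z t)),
     \<lambda>r z t. - (inverse r * d_z b r z t),
     \<lambda>r z t. d_r (\<lambda>r z t. inverse r * a r z t) r z t + inverse r * d_z b r z t,
     \<lambda>r z t. - ((G1 r z t + G2 r z t) * inverse r ^ 3),
     \<lambda>r z t. d_z \<psi>1 r z t * inverse r ^ 3,
     \<lambda>r z t. d_r G2 r z t * inverse r ^ 2,
     \<lambda>r z t. - (d_z G2 r z t * inverse r ^ 2)]"
  have C_smooth: "smooth_field T f" if "f \<in> set C" for f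
    using that unfolding C_def
    by (auto intro!: smooth_field_minus smooth_field_mult smooth_field_add smooth_field_inverse_radius
        smooth_field_d smooth smooth_stress smooth_field_power)
  have "\<exists>M\<ge>0. \<forall>f\<in>set C'. \<forall>r z t. pi \<le> r \<longrightarrow> r \<le> 2*pi \<longrightarrow> -pi \<le> z \<longrightarrow> z \<le> pi \<longrightarrow> 0 \<le> t \<longrightarrow> t \<le> c \<longrightarrow> \<bar>f r z t\<bar> \<le> M"
    if "set C' \<subseteq> set C" for C'
    using that
  proof (induction C')
    case (Cons f C')
    then obtain M where M: "M \<ge> 0" "\<forall>f\<in>set C'. \<forall>r z t. pi \<le> r \<longrightarrow> r \<le> 2*pi \<longrightarrow> -pi \<le> z \<longrightarrow> z \<le> pi \<longrightarrow> 0 \<le> t \<longrightarrow> t \<le> c \<longrightarrow> \<bar>f r z t\<bar> \<le> M"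
      by auto
    obtain M' where "M' \<ge> 0" "\<And>r z t. pi \<le> r \<Longrightarrow> r \<le> 2*pi \<Longrightarrow> -pi \<le> z \<Longrightarrow> z \<le> pi \<Longrightarrow> 0 \<le> t \<Longrightarrow> t \<le> c \<Longrightarrow> \<bar>f r z t\<bar> \<le> M'"
      using smooth_field_bounded[OF C_smooth c, of f "-pi" pi] Cons.prems by auto
    then show ?case using M by (intro exI[of _ "max M M'"]) (auto simp: le_max_iff_disj)
  qed auto
  then obtain M where M: "M \<ge> 0" "\<And>f r z t. f \<in> set C \<Longrightarrow> pi \<le> r \<Longrightarrow> r \<le> 2*pi \<Longrightarrow> -pi \<le> z \<Longrightarrow> z \<le> pi \<Longrightarrow> 0 \<le> t \<Longrightarrow> t \<le> c \<Longrightarrow> \<bar>f r z t\<bar> \<le> M"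
    by (meson order_refl)
  have product: "k * (x * y) \<le> M * (x\<^sup>2 + y\<^sup>2) / 2" if "\<bar>k\<bar> \<le> M" for k x y :: real
  proof -
    have "k * (x * y) \<le> \<bar>k\<bar> * \<bar>x * y\<bar>" by (metis abs_ge_self abs_mult)
    also have "\<dots> \<le> M * ((x\<^sup>2 + y\<^sup>2) / 2)"
      using that M(1) sum_squares_bound[of "\<bar>x\<bar>" "\<bar>y\<bar>"] by (intro mult_mono) (auto simp: abs_mult)
    finally show ?thesis by simp
  qed
  have weights: "5 / 2 * x + 3 * y + 5 / 2 * w \<le> 3 * (x + y + w)" if "0 \<le> x" "0 \<le> y" "0 \<le> w" for x y w :: real
    using that by simp
  show thesis
  proof (rule that)
    fix r z t :: real
    assume m: "pi \<le> r" "r \<le> 2*pi" "-pi \<le> z" "z \<le> pi" "0 \<le> t" "t \<le> c"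
    then have "r > 0" using pi_gt_zero by linarith
    let ?p = "d_r \<phi> r z t" and ?s = "d_z \<phi> r z t" and ?g = "g r z t"
    have bnd: "\<bar>f r z t\<bar> \<le> M" if "f \<in> set C" for f using M(2)[OF that m] .
    have q': "q r z t = (?p\<^sup>2 + ?s\<^sup>2) / 2" by (simp add: q_def power2_eq_square)
    have "(d_r (\<lambda>r z t. inverse r * a r z t) r z t + inverse r * d_z b r z t) * q r z t \<le> M * q r z t"
      using bnd[of "C ! 3"] by (intro mult_right_mono) (auto simp: C_def q')
    moreover have "\<And>k x y. k \<in> set C \<Longrightarrow> k r z t * (x * y) \<le> M * (x\<^sup>2 + y\<^sup>2) / 2"
      using bnd product by blast
    note this[of "C ! 0" ?p ?p] this[of "C ! 1" ?p ?s] this[of "C ! 2" ?s ?s] this[of "C ! 4" ?s ?g]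
      this[of "C ! 5" ?g ?g] this[of "C ! 6" ?s ?g] this[of "C ! 7" ?p ?g]
    ultimately have "quadratic_source r z t \<le> M * ((?p\<^sup>2 + ?s\<^sup>2) / 2) + M * (?p\<^sup>2 + ?p\<^sup>2) / 2 + M * (?p\<^sup>2 + ?s\<^sup>2) / 2
        + M * (?s\<^sup>2 + ?s\<^sup>2) / 2 + M * (?s\<^sup>2 + ?g\<^sup>2) / 2 + M * (?g\<^sup>2 + ?g\<^sup>2) / 2 + M * (?s\<^sup>2 + ?g\<^sup>2) / 2 + M * (?p\<^sup>2 + ?g\<^sup>2) / 2"
      unfolding quadratic_source_def q' by (simp add: C_def)
    also have "\<dots> = M * (5 / 2 * ?p\<^sup>2 + 3 * ?s\<^sup>2 + 5 / 2 * ?g\<^sup>2)" by (simp add: field_simps)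
    also have "\<dots> \<le> M * (3 * (?p\<^sup>2 + ?s\<^sup>2 + ?g\<^sup>2))" using M(1) by (intro mult_left_mono weights) auto
    also have "?p\<^sup>2 + ?s\<^sup>2 + ?g\<^sup>2 = 2 * r * energy_density g \<phi> r z t"
      using \<open>r > 0\<close> by (simp add: energy_density_def field_simps power2_eq_square)
    also have "M * (3 * (2 * r * energy_density g \<phi> r z t)) \<le> M * (3 * (2 * (2 * pi) * energy_density g \<phi> r z t))"
      using M(1) m energy_density_nonneg[of r] pi_gt_zero by (intro mult_left_mono mult_right_mono) auto
    finally show "quadratic_source r z t \<le> (M * 12 * pi) * energy_density g \<phi> r z t" by simp
  qed
qed

text \<open>Test the elliptic equation \<open>\<partial>\<^sub>r A + \<partial>\<^sub>z B = 0\<close> with \<open>\<phi>\<close>, which vanishes on the walls: equal vorticities have equal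
stream functions.\<close>

lemma energy_eq_0:
  assumes t: "0 \<le> t" "ereal t < T"
    and G: "\<And>r z. pi \<le> r \<Longrightarrow> r \<le> 2*pi \<Longrightarrow> G1 r z t = G2 r z t"
    and X: "\<And>r z. pi \<le> r \<Longrightarrow> r \<le> 2*pi \<Longrightarrow> X1 r z t = X2 r z t"
  shows "energy g \<phi> t = 0"
proof -
  define P where "P = (\<lambda>r z t. \<phi> r z t * A r z t / 2)"
  define Q where "Q = (\<lambda>r z t. \<phi> r z t * B r z t / 2)"
  have PQ: "smooth_field T P" "smooth_field T Q" unfolding P_def Q_def by (simp_all add: smooth)
  have "energy_density g \<phi> r z t = d_r P r z t + d_z Q r z t" if "pi \<le> r" "r \<le> 2*pi" for r z
  proof -
    have m: "(r, z, t) \<in> spacetime T" using t that by simp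
    have "r \<noteq> 0" using that pi_gt_zero by linarith
    note D = partials_mult[OF _ _ m] partials_divide[OF _ m] smooth
    have "d_r P r z t + d_z Q r z t = (d_r \<phi> r z t * A r z t + d_z \<phi> r z t * B r z t
        + \<phi> r z t * (d_r A r z t + d_z B r z t)) / 2"
      unfolding P_def Q_def by (simp add: D del: spacetime_iff) (simp add: field_simps)
    also have "d_r A r z t + d_z B r z t = 0"
      using elliptic_difference[OF m] X[OF that] by (simp add: \<zeta>_def)
    finally show ?thesis
      using G[OF that] \<open>r \<noteq> 0\<close> by (simp add: energy_density_def A_def B_def g_def field_simps)
  qed
  then have "energy g \<phi> t = rz_integral (- pi) pi (\<lambda>r z. d_r P r z t + d_z Q r z t)"
    unfolding energy_def by (intro rz_integral_cong) auto
  also have "\<dots> = 0"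
    by (rule rz_integral_divergence[OF PQ t])
       (simp_all add: P_def Q_def wall[OF t] ends[OF _ _ t])
  finally show ?thesis .
qed

lemma energy_density_eq_0:
  assumes t: "0 \<le> t" "ereal t < T"
    and G: "\<And>r z. pi \<le> r \<Longrightarrow> r \<le> 2*pi \<Longrightarrow> G1 r z 0 = G2 r z 0"
    and X: "\<And>r z. pi \<le> r \<Longrightarrow> r \<le> 2*pi \<Longrightarrow> X1 r z 0 = X2 r z 0"
    and rz: "pi \<le> r" "r \<le> 2*pi" "- pi \<le> z" "z \<le> pi"
  shows "energy_density g \<phi> r z t = 0"
proof -
  have lt: "ereal s < T" if "s \<le> t" for s using that t(2) by (meson ereal_less_eq(3) order_le_less_trans)
  note sm = smooth_energy_density[OF smooth_diff(1,3)]
  obtain K where K: "\<And>r z s. pi \<le> r \<Longrightarrow> r \<le> 2*pi \<Longrightarrow> -pi \<le> z \<Longrightarrow> z \<le> pi \<Longrightarrow> 0 \<le> s \<Longrightarrow> s \<le> t \<Longrightarrow>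
     quadratic_source r z s \<le> K * energy_density g \<phi> r z s"
    using quadratic_source_bound[OF t(2)] by blast
  have "energy g \<phi> t \<le> 0"
  proof (rule gronwall_zero[where E="energy g \<phi>" and t=t and E'="\<lambda>s. rz_integral (- pi) pi (\<lambda>r z. source r z s)" and C=K])
    show "(energy g \<phi> has_real_derivative rz_integral (- pi) pi (\<lambda>r z. source r z s)) (at s within {0..})"
      if "0 \<le> s" "s \<le> t" for s using has_derivative_energy that lt by blast
    show "rz_integral (- pi) pi (\<lambda>r z. source r z s) \<le> K * energy g \<phi> s" if s: "0 \<le> s" "s \<le> t" for s
    proof -
      note s' = s(1) lt[OF s(2)]
      note c = rz_continuous_smooth[OF _ s']
      have d: "smooth_field T (\<lambda>r z t. d_r stress_r r z t + d_z stress_z r z t)"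
        by (simp add: smooth_stress)
      have 1: "rz_integral (- pi) pi (\<lambda>r z. source r z s - (d_r stress_r r z s + d_z stress_z r z s))
          = rz_integral (- pi) pi (\<lambda>r z. source r z s)"
      proof -
        have "rz_integral (- pi) pi (\<lambda>r z. d_r stress_r r z s + d_z stress_z r z s) = 0"
        proof (rule rz_integral_divergence[OF smooth_stress(5,6) s'])
          show "stress_r pi z s = 0" "stress_r (2*pi) z s = 0" for z
            by (simp_all add: stress_r_def Y_def a_def wall[OF s'])
          show "stress_z r (- pi) s = stress_z r pi s" if "pi \<le> r" "r \<le> 2*pi" for r
            by (simp add: stress_z_def Y_def a_def b_def q_def ends[OF that s'])
        qed simp
        then show ?thesis using rz_integral_diff[OF c[OF smooth_fluxes(3)] c[OF d]] by simp
      qed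
      have 2: "rz_integral (- pi) pi (\<lambda>r z. source r z s - (d_r stress_r r z s + d_z stress_z r z s))
          \<le> rz_integral (- pi) pi (\<lambda>r z. K * energy_density g \<phi> r z s)"
        by (rule rz_integral_mono[OF c[OF smooth_field_diff[OF smooth_fluxes(3) d]]
              c[OF smooth_field_mult[OF smooth_field_const sm]]])
           (use K[OF _ _ _ _ s] s' source_stress_form in auto)
      show ?thesis using 2 unfolding 1 rz_integral_cmult energy_def .
    qed
    \<comment> \<open>The initial stream functions are not part of the data; they agree by the elliptic equation.\<close>
    show "energy g \<phi> 0 = 0" by (rule energy_eq_0[OF order_refl lt[OF t(1)] G X])
  qed (fact t)
  moreover have nonneg: "0 \<le> energy_density g \<phi> r z t" if "pi \<le> r" for r z
    by (rule energy_density_nonneg) (use that pi_gt_zero in linarith)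
  have "energy g \<phi> t \<ge> rz_integral (- pi) pi (\<lambda>r z. 0)"
    unfolding energy_def
    by (rule rz_integral_mono[OF rz_continuous_smooth[OF smooth_field_const t] rz_continuous_smooth[OF sm t] nonneg])
  moreover have "rz_integral (- pi) pi (\<lambda>r z. 0) = 0" by (simp add: rz_integral_def split_def)
  ultimately have "rz_integral (- pi) pi (\<lambda>r z. energy_density g \<phi> r z t) = 0"
    by (simp add: energy_def)
  then show ?thesis
    using rz_integral_nonneg_eq_0[OF rz_continuous_smooth[OF sm t] _ nonneg _ rz] pi_gt_zero by simp
qed

text \<open>Uniqueness of smooth solutions: by Gronwall's inequality the energy of the difference stays zero, so
\<open>\<phi>\<close> has no gradient, and it vanishes on the walls.\<close>

theorem stream_functions_agree:
  assumes t: "0 \<le> t" "ereal t < T"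
    and G: "\<And>r z. pi \<le> r \<Longrightarrow> r \<le> 2*pi \<Longrightarrow> G1 r z 0 = G2 r z 0"
    and X: "\<And>r z. pi \<le> r \<Longrightarrow> r \<le> 2*pi \<Longrightarrow> X1 r z 0 = X2 r z 0"
    and rz: "pi \<le> r" "r \<le> 2*pi" "- pi \<le> z" "z \<le> pi"
  shows "\<psi>1 r z t = \<psi>2 r z t" "d_r \<psi>1 r z t = d_r \<psi>2 r z t" "d_z \<psi>1 r z t = d_z \<psi>2 r z t"
proof -
  have d0: "d_r \<phi> s z t = 0 \<and> d_z \<phi> s z t = 0" if "pi \<le> s" "s \<le> 2*pi" for s
  proof -
    have "s > 0" using that pi_gt_zero by linarith
    moreover have "energy_density g \<phi> s z t = ((d_r \<phi> s z t)\<^sup>2 + (d_z \<phi> s z t)\<^sup>2 + (g s z t)\<^sup>2) / (2 * s)"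
      using \<open>s > 0\<close> by (simp add: energy_density_def field_simps power2_eq_square)
    ultimately have "(d_r \<phi> s z t)\<^sup>2 + (d_z \<phi> s z t)\<^sup>2 + (g s z t)\<^sup>2 = 0"
      using energy_density_eq_0[OF t G X that rz(3,4)] by simp
    then show ?thesis by (smt (verit) zero_le_power2 power2_eq_iff_nonneg power_zero_numeral zero_eq_power2)
  qed
  have "\<phi> r z t = \<phi> pi z t"
  proof (rule has_field_derivative_zero_constant[of "{pi..2*pi}" "\<lambda>s. \<phi> s z t", THEN exE])
    show "((\<lambda>s. \<phi> s z t) has_real_derivative 0) (at s within {pi..2*pi})" if "s \<in> {pi..2*pi}" for s
      using has_d_r[OF smooth_diff(3), of s z t] d0[of s] that t by auto
  qed (use rz in auto)
  then show "\<psi>1 r z t = \<psi>2 r z t" using wall(5)[OF t] by (simp add: \<phi>_def)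
  show "d_r \<psi>1 r z t = d_r \<psi>2 r z t" "d_z \<psi>1 r z t = d_z \<psi>2 r z t"
    using d0[OF rz(1,2)] partials_difference(1,2)[of r z t] rz t by auto
qed

end

section \<open>Conservation of energy, uniqueness and symmetry\<close>

text \<open>The flow at rest, against which the energy of a single flow is measured.\<close>

lemma axisymmetric_flow_zero: "axisymmetric_flow T (\<lambda>r z t. 0) (\<lambda>r z t. 0) (\<lambda>r z t. 0)"
proof -
  have "d_r (\<lambda>r z t. inverse r * d_r (\<lambda>r z t. 0) r z t) r z t = 0" if "(r, z, t) \<in> spacetime T" for r z t
    using partials_cong(1)[OF smooth_field_const[of T 0] _ that, of "\<lambda>r z t. inverse r * d_r (\<lambda>r z t. 0) r z t"] that
    by (simp add: partials_const)
  moreover have "d_z (\<lambda>r z t. 0) = (\<lambda>r z t. 0)" by (simp add: fun_eq_iff partials_const)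
  ultimately show ?thesis
    by (auto simp: axisymmetric_flow_def periodic_field_def partials_const)
qed

text \<open>Apply the energy identity to the pair of the given flow and the flow at rest.\<close>

theorem energy_conserved:
  assumes flow: "axisymmetric_flow T G X \<psi>" and t: "0 \<le> t" "ereal t < T"
  shows "energy G \<psi> t = energy G \<psi> 0"
proof -
  interpret P: flow_pair T G X \<psi> "\<lambda>r z t. 0" "\<lambda>r z t. 0" "\<lambda>r z t. 0"
    using flow axisymmetric_flow_zero by unfold_locales
  have lt: "ereal s < T" if "s \<le> t" for s using that t(2) by (meson ereal_less_eq(3) order_le_less_trans)
  have [simp]: "P.g = G" "P.\<phi> = \<psi>" "P.\<zeta> = X" by (simp_all add: P.g_def P.\<phi>_def P.\<zeta>_def)
  have "rz_integral (- pi) pi (\<lambda>r z. P.source r z s) = 0" if "0 \<le> s" for s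
  proof -
    have "rz_integral (- pi) pi (\<lambda>r z. P.source r z s) = rz_integral (- pi) pi (\<lambda>r z. 0)"
      by (rule rz_integral_cong) (simp add: P.source_def partials_const)
    then show ?thesis by (simp add: rz_integral_def split_def)
  qed
  then have d: "(energy G \<psi> has_real_derivative 0) (at s within {0..})" if "0 \<le> s" "s \<le> t" for s
    using P.has_derivative_energy[of s] that lt by simp
  have "energy G \<psi> t \<ge> energy G \<psi> 0 + 0 * t"
    by (rule growth_from_derivative[where E'="\<lambda>_. 0"]) (use d t in auto)
  moreover have "- energy G \<psi> t \<ge> - energy G \<psi> 0 + 0 * t"
    by (rule growth_from_derivative[where E'="\<lambda>_. 0"]) (use d DERIV_minus[OF d] t in auto)
  ultimately show ?thesis by simp
qed

lemma d_z_reflect: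
  assumes "smooth_field T f" "(r, z, t) \<in> spacetime T"
  shows "d_z (\<lambda>r z t. f r (- z) t) r z t = - d_z f r (- z) t"
  using has_d_z[of T f r "- z" t] assms DERIV_mirror[of "\<lambda>s. f r s t" "d_z f r (- z) t" z]
  by (intro d_z_eqI) auto

lemma axisymmetric_flow_reflect:
  assumes "axisymmetric_flow T G X \<psi>"
  shows "axisymmetric_flow T (\<lambda>r z t. G r (- z) t) (\<lambda>r z t. - X r (- z) t) (\<lambda>r z t. - \<psi> r (- z) t)"
proof -
  note F = axisymmetric_flowD[OF assms]
  have per: "periodic_field T (\<lambda>r z t. f r (- z) t)" if "periodic_field T f" for f
    unfolding periodic_field_def
  proof (intro allI impI)
    fix r z t assume "(r, z, t) \<in> spacetime T"
    then have "(r, - z - 2*pi, t) \<in> spacetime T" by simp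
    then have "f r (- z - 2*pi + 2*pi) t = f r (- z - 2*pi) t"
      using that unfolding periodic_field_def by blast
    then show "f r (- (z + 2*pi)) t = f r (- z) t" by simp
  qed
  have per_minus: "periodic_field T (\<lambda>r z t. - f r z t)" if "periodic_field T f" for f
    using that unfolding periodic_field_def by (simp del: spacetime_iff)
  have dr: "d_r (\<lambda>r z t. - f r (- z) t) r z t = - d_r f r (- z) t"
    "d_t (\<lambda>r z t. - f r (- z) t) r z t = - d_t f r (- z) t"
    "d_z (\<lambda>r z t. - f r (- z) t) r z t = d_z f r (- z) t"
    "d_r (\<lambda>r z t. f r (- z) t) r z t = d_r f r (- z) t"
    "d_t (\<lambda>r z t. f r (- z) t) r z t = d_t f r (- z) t"
    if "smooth_field T f" "(r, z, t) \<in> spacetime T" for f r z t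
    using partials_minus[OF smooth_field_reflect[OF that(1)] that(2)] d_z_reflect[OF that]
    by (simp_all add: d_r_def d_t_def)
  show ?thesis
    unfolding axisymmetric_flow_def
  proof (intro conjI ballI)
    fix f assume "f \<in> {\<lambda>r z t. G r (- z) t, \<lambda>r z t. - X r (- z) t, \<lambda>r z t. - \<psi> r (- z) t}"
    then show "smooth_field T f" "periodic_field T f"
      using F per per_minus by (auto intro: smooth_field_reflect smooth_field_minus)
  next
    fix x :: "real \<times> real \<times> real" assume "x \<in> spacetime T"
    then obtain r z t where x: "x = (r, z, t)" and m: "(r, z, t) \<in> spacetime T" by (cases x) auto
    then have m': "(r, - z, t) \<in> spacetime T" by simp
    have "d_r (\<lambda>r z t. inverse r * d_r (\<lambda>r z t. - \<psi> r (- z) t) r z t) r z t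
        = d_r (\<lambda>r z t. - (\<lambda>r z t. inverse r * d_r \<psi> r z t) r (- z) t) r z t"
      by (rule partials_cong(1)[OF _ _ m])
         (simp_all add: dr[OF F(3)] F(3) smooth_field_reflect del: spacetime_iff)
    also have "\<dots> = - d_r (\<lambda>r z t. inverse r * d_r \<psi> r z t) r (- z) t"
      by (rule dr(1)[OF _ m]) (simp add: F(3))
    finally have 1: "d_r (\<lambda>r z t. inverse r * d_r (\<lambda>r z t. - \<psi> r (- z) t) r z t) r z t
        = - d_r (\<lambda>r z t. inverse r * d_r \<psi> r z t) r (- z) t" .
    have "d_z (\<lambda>r z t. inverse r * d_z (\<lambda>r z t. - \<psi> r (- z) t) r z t) r z t
        = d_z (\<lambda>r z t. (\<lambda>r z t. inverse r * d_z \<psi> r z t) r (- z) t) r z t"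
      by (rule partials_cong(2)[OF _ _ m])
         (simp_all add: dr[OF F(3)] F(3) smooth_field_reflect del: spacetime_iff)
    also have "\<dots> = - d_z (\<lambda>r z t. inverse r * d_z \<psi> r z t) r (- z) t"
      by (rule d_z_reflect[OF _ m]) (simp add: F(3))
    finally have 2: "d_z (\<lambda>r z t. inverse r * d_z (\<lambda>r z t. - \<psi> r (- z) t) r z t) r z t
        = - d_z (\<lambda>r z t. inverse r * d_z \<psi> r z t) r (- z) t" .
    show "case x of (r, z, t) \<Rightarrow>
        r * d_t (\<lambda>r z t. G r (- z) t) r z t = d_z (\<lambda>r z t. - \<psi> r (- z) t) r z t * d_r (\<lambda>r z t. G r (- z) t) r z t
          - d_r (\<lambda>r z t. - \<psi> r (- z) t) r z t * d_z (\<lambda>r z t. G r (- z) t) r z t \<and>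
        r * d_t (\<lambda>r z t. - X r (- z) t) r z t = d_z (\<lambda>r z t. - \<psi> r (- z) t) r z t * d_r (\<lambda>r z t. - X r (- z) t) r z t
          - d_r (\<lambda>r z t. - \<psi> r (- z) t) r z t * d_z (\<lambda>r z t. - X r (- z) t) r z t
          + 2 * G r (- z) t * d_z (\<lambda>r z t. G r (- z) t) r z t * inverse r ^ 3 \<and>
        d_r (\<lambda>r z t. inverse r * d_r (\<lambda>r z t. - \<psi> r (- z) t) r z t) r z t
          + d_z (\<lambda>r z t. inverse r * d_z (\<lambda>r z t. - \<psi> r (- z) t) r z t) r z t = - r * - X r (- z) t \<and>
        - \<psi> pi (- z) t = 0 \<and> - \<psi> (2*pi) (- z) t = 0"
      unfolding x split
      using F(7)[OF m'] F(8)[OF m'] F(9)[OF m'] F(10,11)[of t "- z"] m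
      by (simp add: 1 2 dr[OF F(1) m] dr[OF F(2) m] dr[OF F(3) m] d_z_reflect[OF F(1) m] algebra_simps)
  qed
qed

text \<open>The flow coincides with its reflection, which starts from the same data; hence \<open>\<psi>\<close> is odd in \<open>z\<close>.
At \<open>z = pi\<close> this is combined with periodicity.\<close>

theorem stream_function_vanishes_on_cuts:
  assumes flow: "axisymmetric_flow T G X \<psi>" and t: "0 \<le> t" "ereal t < T"
    and G: "\<And>r z. pi \<le> r \<Longrightarrow> r \<le> 2*pi \<Longrightarrow> G r (- z) 0 = G r z 0"
    and X: "\<And>r z. pi \<le> r \<Longrightarrow> r \<le> 2*pi \<Longrightarrow> X r (- z) 0 = - X r z 0"
    and r: "pi \<le> r" "r \<le> 2*pi"
  shows "\<psi> r 0 t = 0" "\<psi> r pi t = 0"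
proof -
  interpret P: flow_pair T G X \<psi> "\<lambda>r z t. G r (- z) t" "\<lambda>r z t. - X r (- z) t" "\<lambda>r z t. - \<psi> r (- z) t"
    using flow axisymmetric_flow_reflect by unfold_locales
  have odd: "\<psi> r z t = - \<psi> r (- z) t" if "- pi \<le> z" "z \<le> pi" for z
    by (rule P.stream_functions_agree(1)[OF t]) (use G X r that in auto)
  show "\<psi> r 0 t = 0" using odd[of 0] pi_ge_zero by simp
  show "\<psi> r pi t = 0"
    using odd[of pi] periodic_field_ends[OF axisymmetric_flowD(6)[OF flow] r t] pi_ge_zero by simp
qed

lemma axisymmetric_flow_shorter:
  assumes "axisymmetric_flow T G X \<psi>" "T' \<le> T"
  shows "axisymmetric_flow T' G X \<psi>"
proof -
  have sub: "spacetime T' \<subseteq> spacetime T" using assms(2) by (auto simp: spacetime_def intro: order_less_le_trans)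
  then show ?thesis
    using assms(1) Ck_on_subset[OF _ sub]
    unfolding axisymmetric_flow_def smooth_field_def smooth_on_def periodic_field_def by blast
qed

text \<open>The initial stream function is determined by the initial vorticity, so all solutions with the same data
have the same energy. This is what makes the constants of the main theorem independent of the solution.\<close>

lemma initial_energy_unique:
  assumes flows: "axisymmetric_flow T1 G1 X1 \<psi>1" "axisymmetric_flow T2 G2 X2 \<psi>2" and T: "0 < T1" "0 < T2"
    and G: "\<And>r z. pi \<le> r \<Longrightarrow> r \<le> 2*pi \<Longrightarrow> G1 r z 0 = G2 r z 0"
    and X: "\<And>r z. pi \<le> r \<Longrightarrow> r \<le> 2*pi \<Longrightarrow> X1 r z 0 = X2 r z 0"
  shows "energy G1 \<psi>1 0 = energy G2 \<psi>2 0"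
proof -
  \<comment> \<open>The two solutions may have different lifespans; only time zero matters.\<close>
  interpret P: flow_pair "min T1 T2" G1 X1 \<psi>1 G2 X2 \<psi>2
    using flows by unfold_locales (auto intro: axisymmetric_flow_shorter)
  have T0: "ereal 0 < min T1 T2" using T by (simp add: zero_ereal_def)
  note agree = P.stream_functions_agree(2,3)[OF order_refl T0 G X]
  show ?thesis
    unfolding energy_def by (rule rz_integral_cong) (simp add: energy_density_def agree G)
qed

section \<open>Growth of the circulation around the half domain\<close>

text \<open>Transport along a line \<open>z = const\<close> that the flow preserves, with the speed \<open>v / r\<close> in place of \<open>- u\<^sup>r\<close>. A proof
without trajectories: \<open>f + \<epsilon> t\<close> attains its minimum over the compact set \<open>{pi..2*pi} \<times> {0..t}\<close>. At a minimum
with positive time the radial term of the equation vanishes, so \<open>\<partial>\<^sub>t f = 0\<close> and \<open>f + \<epsilon> t\<close> was smaller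
shortly before. So the minimum is attained at time zero.\<close>

lemma transport_minimum_principle:
  assumes f: "smooth_field T f" and t: "0 \<le> t" "ereal t < T" and r: "pi \<le> r" "r \<le> 2*pi"
    and transport: "\<And>r t. (r, z, t) \<in> spacetime T \<Longrightarrow> r * d_t f r z t = v r t * d_r f r z t"
    and wall: "\<And>t. 0 \<le> t \<Longrightarrow> ereal t < T \<Longrightarrow> v pi t = 0" "\<And>t. 0 \<le> t \<Longrightarrow> ereal t < T \<Longrightarrow> v (2*pi) t = 0"
    and init: "\<And>r. pi \<le> r \<Longrightarrow> r \<le> 2*pi \<Longrightarrow> f r z 0 \<ge> m"
  shows "f r z t \<ge> m"
proof -
  have lt: "ereal s < T" if "s \<le> t" for s using that t(2) by (meson ereal_less_eq(3) order_le_less_trans)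
  have "m \<le> f r z t + e" if "e > 0" for e
  proof -
    \<comment> \<open>The slope is small enough for the perturbation to stay below \<open>e\<close> up to time \<open>t\<close>.\<close>
    define \<epsilon> where "\<epsilon> = e / (t + 1)"
    have eps: "\<epsilon> > 0" "\<epsilon> * t \<le> e"
      using that t(1) by (simp_all add: \<epsilon>_def field_simps)
    let ?F = "\<lambda>x. f (fst x) z (snd x) + \<epsilon> * snd x"
    have "continuous_on ({pi..2*pi} \<times> {0..t}) (\<lambda>x. f (fst x) z (snd x))"
      by (rule smooth_field_continuous_compose[OF f]) (use lt in \<open>auto intro!: continuous_intros\<close>)
    then have "continuous_on ({pi..2*pi} \<times> {0..t}) ?F" by (intro continuous_intros)
    moreover have "compact ({pi..2*pi} \<times> {0..t})" "({pi..2*pi} \<times> {0..t}) \<noteq> {}"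
      using t r by (auto intro: compact_Times)
    ultimately obtain x where x: "x \<in> {pi..2*pi} \<times> {0..t}" "\<And>y. y \<in> {pi..2*pi} \<times> {0..t} \<Longrightarrow> ?F x \<le> ?F y"
      using continuous_attains_inf[of "{pi..2*pi} \<times> {0..t}" ?F] by blast
    obtain \<rho> \<tau> where \<rho>\<tau>: "x = (\<rho>, \<tau>)" by (cases x)
    have mem: "pi \<le> \<rho>" "\<rho> \<le> 2*pi" "0 \<le> \<tau>" "\<tau> \<le> t" using x(1) \<rho>\<tau> by auto
    have min: "f \<rho> z \<tau> + \<epsilon> * \<tau> \<le> f \<rho>' z \<tau>' + \<epsilon> * \<tau>'" if "pi \<le> \<rho>'" "\<rho>' \<le> 2*pi" "0 \<le> \<tau>'" "\<tau>' \<le> t" for \<rho>' \<tau>'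
      using x(2)[of "(\<rho>', \<tau>')"] that \<rho>\<tau> by auto
    have "\<rho> > 0" using mem pi_gt_zero by linarith
    have ms: "(\<rho>, z, \<tau>) \<in> spacetime T" using mem lt by simp
    have "\<tau> = 0"
    proof (rule ccontr)
      assume "\<tau> \<noteq> 0"
      have "v \<rho> \<tau> * d_r f \<rho> z \<tau> = 0"
      proof (cases "\<rho> = pi \<or> \<rho> = 2*pi")
        case True
        then show ?thesis using wall[of \<tau>] mem lt by auto
      next
        case False
        then have in': "pi < \<rho>" "\<rho> < 2*pi" using mem by auto
        have "((\<lambda>s. f s z \<tau>) has_real_derivative d_r f \<rho> z \<tau>) (at \<rho>)"
          using has_d_r[OF f ms] at_within_Icc_at[OF in'] by simp
        then have "d_r f \<rho> z \<tau> = 0"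
          by (rule DERIV_local_min[where d="min (\<rho> - pi) (2*pi - \<rho>)"])
             (use in' mem min[of _ \<tau>] in auto)
        then show ?thesis by simp
      qed
      then have "d_t f \<rho> z \<tau> = 0" using transport[OF ms] \<open>\<rho> > 0\<close> by auto
      then have "((\<lambda>s. f \<rho> z s + \<epsilon> * s) has_real_derivative \<epsilon>) (at \<tau> within {0..})"
        using has_d_t[OF f ms] by (auto intro!: derivative_eq_intros)
      from has_real_derivative_pos_inc_left[OF this eps(1)]
      obtain d where d: "d > 0" "\<And>h. h > 0 \<Longrightarrow> \<tau> - h \<in> {0..} \<Longrightarrow> h < d \<Longrightarrow> f \<rho> z (\<tau> - h) + \<epsilon> * (\<tau> - h) < f \<rho> z \<tau> + \<epsilon> * \<tau>"
        by blast
      define h where "h = min (d / 2) \<tau>"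
      have "h > 0" "h < d" "h \<le> \<tau>" using d(1) mem \<open>\<tau> \<noteq> 0\<close> by (auto simp: h_def min_def)
      then show False using d(2)[of h] min[of \<rho> "\<tau> - h"] mem by auto
    qed
    then have "m \<le> f \<rho> z \<tau> + \<epsilon> * \<tau>" using init[OF mem(1,2)] by simp
    also have "\<dots> \<le> f r z t + \<epsilon> * t" using min r t by simp
    finally show ?thesis using eps by simp
  qed
  then show ?thesis by (rule field_le_epsilon)
qed

text \<open>The swirl conditions are those of the main theorem for \<open>G = r u\<^sup>\<theta>\<close>, weakened to constants by means of
\<open>pi \<le> r \<le> 2 pi\<close>.\<close>

locale symmetric_flow =
  fixes T :: ereal and G X \<psi> :: field and k0 :: real
  assumes flow: "axisymmetric_flow T G X \<psi>"
    and even: "\<And>r z. pi \<le> r \<Longrightarrow> r \<le> 2*pi \<Longrightarrow> G r (- z) 0 = G r z 0"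
    and odd: "\<And>r z. pi \<le> r \<Longrightarrow> r \<le> 2*pi \<Longrightarrow> X r (- z) 0 = - X r z 0"
    and k0: "k0 > 0"
    and swirl_end: "\<And>r. pi \<le> r \<Longrightarrow> r \<le> 2*pi \<Longrightarrow> pi * k0 \<le> G r pi 0"
    and swirl_mid: "\<And>r. pi \<le> r \<Longrightarrow> r \<le> 2*pi \<Longrightarrow> \<bar>G r 0 0\<bar> \<le> pi * k0 / 4"
begin

lemmas flowD = axisymmetric_flowD[OF flow]

lemma psi_cut:
  assumes "0 \<le> t" "ereal t < T" "pi \<le> r" "r \<le> 2*pi"
  shows "\<psi> r 0 t = 0" "\<psi> r pi t = 0"
  using stream_function_vanishes_on_cuts[OF flow _ _ even odd] assms by auto

lemma d_r_psi_cut: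
  assumes t: "0 \<le> t" "ereal t < T" and r: "pi \<le> r" "r \<le> 2*pi"
  shows "d_r \<psi> r 0 t = 0" "d_r \<psi> r pi t = 0"
  by (rule d_r_eqI[OF _ r], rule has_real_derivative_cong_on[where f="\<lambda>_. 0"];
      use psi_cut t r in simp)+

lemma d_z_psi_wall:
  assumes t: "0 \<le> t" "ereal t < T"
  shows "d_z \<psi> pi z t = 0" "d_z \<psi> (2*pi) z t = 0"
  by (rule d_z_wall, use flowD(10,11) t in simp)+

lemma transport_on_cut:
  assumes z: "z = 0 \<or> z = pi" and m: "(r, z, t) \<in> spacetime T"
  shows "r * d_t G r z t = d_z \<psi> r z t * d_r G r z t"
  using flowD(7)[OF m] d_r_psi_cut[of t r] z m by auto

lemma swirl_end_persists:
  assumes t: "0 \<le> t" "ereal t < T" and r: "pi \<le> r" "r \<le> 2*pi"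
  shows "pi * k0 \<le> G r pi t"
  by (rule transport_minimum_principle[OF flowD(1) t r, where v="\<lambda>r t. d_z \<psi> r pi t"])
     (use transport_on_cut d_z_psi_wall swirl_end in auto)

lemma swirl_mid_persists:
  assumes t: "0 \<le> t" "ereal t < T" and r: "pi \<le> r" "r \<le> 2*pi"
  shows "\<bar>G r 0 t\<bar> \<le> pi * k0 / 4"
proof -
  have init: "- (pi * k0 / 4) \<le> G r 0 0" "- (pi * k0 / 4) \<le> - G r 0 0" if "pi \<le> r" "r \<le> 2*pi" for r
    using swirl_mid[OF that] by linarith+
  have "- (pi * k0 / 4) \<le> G r 0 t"
    by (rule transport_minimum_principle[OF flowD(1) t r, where v="\<lambda>r t. d_z \<psi> r 0 t"])
       (use transport_on_cut d_z_psi_wall init in auto)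
  moreover have "- (pi * k0 / 4) \<le> (\<lambda>r z t. - G r z t) r 0 t"
    by (rule transport_minimum_principle[OF smooth_field_minus[OF flowD(1)] t r, where v="\<lambda>r t. d_z \<psi> r 0 t"])
       (use transport_on_cut d_z_psi_wall init partials_minus[OF flowD(1)] in auto)
  ultimately show ?thesis by simp
qed

text \<open>By Stokes' theorem, the circulation along the boundary of the half domain.\<close>

definition circulation :: "real \<Rightarrow> real" where
  "circulation t = rz_integral 0 pi (\<lambda>r z. r * X r z t)"

text \<open>The transport terms are a divergence with vanishing flux through the boundary of the half domain. What
remains is the integral of \<open>\<partial>\<^sub>z (G\<^sup>2) / r\<^sup>3\<close>, at least
\<open>pi (pi\<^sup>2 k0\<^sup>2 - pi\<^sup>2 k0\<^sup>2 / 16) / (2 pi)\<^sup>3 = 15 k0\<^sup>2 / 128\<close>.\<close>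

theorem circulation_growth:
  assumes t: "0 \<le> t" "ereal t < T"
  shows "circulation t \<ge> circulation 0 + 15 * k0\<^sup>2 / 128 * t"
  unfolding circulation_def
proof (rule growth_from_derivative[OF _ _ t(1)])
  fix s assume s: "0 \<le> s" "s \<le> t"
  then have s': "0 \<le> s" "ereal s < T" using t(2) by (auto intro: order_le_less_trans[of "ereal s" "ereal t"])
  have sm: "smooth_field T (\<lambda>r z t. r * X r z t)" by (simp add: flowD(2))
  show "((\<lambda>t. rz_integral 0 pi (\<lambda>r z. r * X r z t)) has_real_derivative
      rz_integral 0 pi (\<lambda>r z. d_t (\<lambda>r z t. r * X r z t) r z s)) (at s within {0..})"
    by (rule rz_integral_d_t[OF sm s'])
  define P where "P = (\<lambda>r z t. d_z \<psi> r z t * X r z t)"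
  define Q where "Q = (\<lambda>r z t. - (d_r \<psi> r z t * X r z t))"
  define S where "S = (\<lambda>r z t. G r z t * G r z t * inverse r ^ 3)"
  have PQS: "smooth_field T P" "smooth_field T Q" "smooth_field T S"
    unfolding P_def Q_def S_def by (simp_all add: flowD(1-3))
  have "d_t (\<lambda>r z t. r * X r z t) r z s = (d_r P r z s + d_z Q r z s) + d_z S r z s"
    if "pi \<le> r" "r \<le> 2*pi" for r z
  proof -
    have m: "(r, z, s) \<in> spacetime T" using that s' by simp
    note D = partials_mult[OF _ _ m] partials_minus[OF _ m] partials_const mixed_partials_commute[OF _ m] flowD(1-3)
    have i: "d_z (\<lambda>r z t. inverse r ^ 3) r z s = 0" by (rule partials_const(2))
    show ?thesis
      unfolding P_def Q_def S_def using flowD(8)[OF m] s'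
      by (simp add: D i algebra_simps del: spacetime_iff)
  qed
  then have "rz_integral 0 pi (\<lambda>r z. d_t (\<lambda>r z t. r * X r z t) r z s)
      = rz_integral 0 pi (\<lambda>r z. (d_r P r z s + d_z Q r z s) + d_z S r z s)"
    by (intro rz_integral_cong) auto
  also have "\<dots> = rz_integral 0 pi (\<lambda>r z. d_r P r z s + d_z Q r z s) + rz_integral 0 pi (\<lambda>r z. d_z S r z s)"
    by (rule rz_integral_add[OF rz_continuous_smooth[OF smooth_field_add[OF smooth_field_d_r[OF PQS(1)] smooth_field_d_z[OF PQS(2)]] s']
          rz_continuous_smooth[OF smooth_field_d_z[OF PQS(3)] s']])
  also have "rz_integral 0 pi (\<lambda>r z. d_r P r z s + d_z Q r z s) = 0"
    by (rule rz_integral_divergence[OF PQS(1,2) s'])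
       (simp_all add: P_def Q_def d_z_psi_wall[OF s'] d_r_psi_cut[OF s'])
  also have "rz_integral 0 pi (\<lambda>r z. d_z S r z s) = integral {pi..2*pi} (\<lambda>r. S r pi s - S r 0 s)"
    by (rule rz_integral_d_z[OF PQS(3) s']) simp
  finally have eq: "rz_integral 0 pi (\<lambda>r z. d_t (\<lambda>r z t. r * X r z t) r z s) = integral {pi..2*pi} (\<lambda>r. S r pi s - S r 0 s)"
    by simp
  have "15 * k0\<^sup>2 / 128 = integral {pi..2*pi} (\<lambda>r. 15 * k0\<^sup>2 / (128 * pi))"
    by simp
  also have "\<dots> \<le> integral {pi..2*pi} (\<lambda>r. S r pi s - S r 0 s)"
  proof (rule integral_le)
    have "continuous_on {pi..2*pi} (\<lambda>r. S r z s)" for z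
      by (rule smooth_field_continuous_compose[OF PQS(3)]) (use s' in \<open>auto intro!: continuous_intros\<close>)
    then show "(\<lambda>r. S r pi s - S r 0 s) integrable_on {pi..2*pi}"
      by (intro integrable_continuous_real continuous_intros)
    fix r assume "r \<in> {pi..2*pi}"
    then have r: "pi \<le> r" "r \<le> 2*pi" by auto
    then have "r > 0" using pi_gt_zero by linarith
    have 1: "(pi * k0)\<^sup>2 \<le> (G r pi s)\<^sup>2"
      using swirl_end_persists[OF s' r] k0 by (intro power_mono) auto
    have 2: "(G r 0 s)\<^sup>2 \<le> (pi * k0 / 4)\<^sup>2"
      using swirl_mid_persists[OF s' r] power_mono[of "\<bar>G r 0 s\<bar>" "pi * k0 / 4" 2] by simp
    have 3: "(pi * k0 / 4)\<^sup>2 \<le> (pi * k0)\<^sup>2"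
      using k0 by (intro power_mono) auto
    have "15 * k0\<^sup>2 / (128 * pi) = ((pi * k0)\<^sup>2 - (pi * k0 / 4)\<^sup>2) * inverse (2 * pi) ^ 3"
      by (simp add: field_simps power2_eq_square power3_eq_cube)
    also have "\<dots> \<le> ((G r pi s)\<^sup>2 - (G r 0 s)\<^sup>2) * inverse r ^ 3"
      using 1 2 3 r \<open>r > 0\<close> by (intro mult_mono power_mono le_imp_inverse_le) auto
    also have "\<dots> = S r pi s - S r 0 s" by (simp add: S_def power2_eq_square algebra_simps)
    finally show "15 * k0\<^sup>2 / (128 * pi) \<le> S r pi s - S r 0 s" .
  qed auto
  finally show "15 * k0\<^sup>2 / 128 \<le> rz_integral 0 pi (\<lambda>r z. d_t (\<lambda>r z t. r * X r z t) r z s)"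
    by (simp add: eq)
qed

end

section \<open>Boundary layers\<close>

text \<open>A smooth cutoff on \<open>{a..b}\<close> that vanishes at both ends and is close to one at distances from them much greater than
\<open>\<delta>\<close>. The exponential form makes the estimates below hold for every \<open>\<delta> > 0\<close>, without comparing
\<open>\<delta>\<close> to the length of the interval.\<close>

definition cutoff :: "real \<Rightarrow> real \<Rightarrow> real \<Rightarrow> real \<Rightarrow> real" where
  "cutoff a b \<delta> x = (1 - exp (- (x - a) / \<delta>)) * (1 - exp (- (b - x) / \<delta>))"

definition cutoff' :: "real \<Rightarrow> real \<Rightarrow> real \<Rightarrow> real \<Rightarrow> real" where
  "cutoff' a b \<delta> x = (exp (- (x - a) / \<delta>) * (1 - exp (- (b - x) / \<delta>))
     - (1 - exp (- (x - a) / \<delta>)) * exp (- (b - x) / \<delta>)) / \<delta>"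

definition layer :: "real \<Rightarrow> real \<Rightarrow> real \<Rightarrow> real \<Rightarrow> real" where
  "layer a b \<delta> x = exp (- (x - a) / \<delta>) + exp (- (b - x) / \<delta>)"

lemma exponential_profile_derivatives:
  assumes "\<delta> > 0"
  shows "((\<lambda>x. exp (- (x - a) / \<delta>)) has_real_derivative - (exp (- (x - a) / \<delta>) / \<delta>)) (at x within A)"
    and "((\<lambda>x. exp (- (b - x) / \<delta>)) has_real_derivative exp (- (b - x) / \<delta>) / \<delta>) (at x within A)"
  using assms by (auto intro!: derivative_eq_intros)

lemma cutoff_has_derivative:
  assumes "\<delta> > 0"
  shows "(cutoff a b \<delta> has_real_derivative cutoff' a b \<delta> x) (at x within A)"
  using DERIV_mult[OF DERIV_diff[OF DERIV_const[of 1] exponential_profile_derivatives(1)[OF assms, of a x A]]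
      DERIV_diff[OF DERIV_const[of 1] exponential_profile_derivatives(2)[OF assms, of b x A]]]
  unfolding cutoff_def[abs_def] cutoff'_def
  by (rule DERIV_cong) (simp add: diff_divide_distrib mult.commute)

lemma cutoff_ends [simp]: "cutoff a b \<delta> a = 0" "cutoff a b \<delta> b = 0"
  by (simp_all add: cutoff_def)

lemma continuous_on_cutoff:
  "\<delta> > 0 \<Longrightarrow> continuous_on A (cutoff a b \<delta>)" "\<delta> > 0 \<Longrightarrow> continuous_on A (cutoff' a b \<delta>)"
  "\<delta> > 0 \<Longrightarrow> continuous_on A (layer a b \<delta>)"
  unfolding cutoff_def[abs_def] cutoff'_def[abs_def] layer_def[abs_def]
  by (auto intro!: continuous_intros)

text \<open>In the derivative the contributions of the two ends have opposite signs, so its square is at most the sum of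
their squares. Squaring an exponential halves its length scale.\<close>

lemma cutoff_bounds:
  assumes "\<delta> > 0" "a \<le> x" "x \<le> b"
  shows "0 \<le> cutoff a b \<delta> x" "cutoff a b \<delta> x \<le> 1" "1 - cutoff a b \<delta> x \<le> layer a b \<delta> x"
    "(cutoff' a b \<delta> x)\<^sup>2 \<le> layer a b (\<delta> / 2) x / \<delta>\<^sup>2"
proof -
  define e f where "e = exp (- (x - a) / \<delta>)" and "f = exp (- (b - x) / \<delta>)"
  have ef: "0 \<le> e" "e \<le> 1" "0 \<le> f" "f \<le> 1" using assms by (auto simp: e_def f_def divide_le_0_iff)
  have c: "cutoff a b \<delta> x = (1 - e) * (1 - f)" "layer a b \<delta> x = e + f"
    by (simp_all add: cutoff_def layer_def e_def f_def)
  show "0 \<le> cutoff a b \<delta> x" "cutoff a b \<delta> x \<le> 1" unfolding c using ef by (auto intro: mult_le_one)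
  show "1 - cutoff a b \<delta> x \<le> layer a b \<delta> x" unfolding c using ef by (simp add: algebra_simps)
  have e2: "exp (- y / (\<delta> / 2)) = (exp (- y / \<delta>))\<^sup>2" for y
    by (simp add: power2_eq_square flip: exp_add)
  have l2: "layer a b (\<delta> / 2) x = e\<^sup>2 + f\<^sup>2"
    unfolding layer_def e_def f_def e2 ..
  have "(e * (1 - f) - (1 - e) * f)\<^sup>2 = (e - f)\<^sup>2" by (simp add: algebra_simps)
  also have "\<dots> \<le> e\<^sup>2 + f\<^sup>2" using ef by (simp add: power2_diff)
  finally show "(cutoff' a b \<delta> x)\<^sup>2 \<le> layer a b (\<delta> / 2) x / \<delta>\<^sup>2"
    unfolding l2 using assms(1)
    unfolding cutoff'_def e_def[symmetric] f_def[symmetric] power_divide by (intro divide_right_mono) auto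
qed

lemma integral_layer_le:
  assumes "\<delta> > 0" "a \<le> b"
  shows "integral {a..b} (layer a b \<delta>) \<le> 2 * \<delta>"
proof -
  have "((\<lambda>x. \<delta> * (exp (- (b - x) / \<delta>) - exp (- (x - a) / \<delta>))) has_real_derivative layer a b \<delta> x) (at x within {a..b})" for x
    using DERIV_cmult[where c=\<delta>, OF DERIV_diff[OF exponential_profile_derivatives(2)[OF assms(1), of b x "{a..b}"]
          exponential_profile_derivatives(1)[OF assms(1), of a x "{a..b}"]]]
    unfolding layer_def by (rule DERIV_cong) (use assms(1) in \<open>simp add: distrib_left\<close>)
  then have "integral {a..b} (layer a b \<delta>) = \<delta> * (exp (- (b - b) / \<delta>) - exp (- (b - a) / \<delta>))
      - \<delta> * (exp (- (b - a) / \<delta>) - exp (- (a - a) / \<delta>))"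
    using assms(2) by (intro integral_unique fundamental_theorem_of_calculus)
      (auto simp flip: has_real_derivative_iff_has_vector_derivative)
  also have "\<dots> \<le> 2 * \<delta>" using assms by (simp add: algebra_simps)
  finally show ?thesis .
qed

lemma integral_cutoff_le:
  assumes "\<delta> > 0" "a \<le> b"
  shows "integral {a..b} (\<lambda>x. 1 - cutoff a b \<delta> x) \<le> 2 * \<delta>"
    and "integral {a..b} (\<lambda>x. (cutoff' a b \<delta> x)\<^sup>2) \<le> 1 / \<delta>"
proof -
  have "integral {a..b} (\<lambda>x. 1 - cutoff a b \<delta> x) \<le> integral {a..b} (layer a b \<delta>)"
    by (intro integral_le integrable_continuous_real continuous_intros continuous_on_cutoff assms)
       (use cutoff_bounds(3) assms in auto)
  with integral_layer_le[OF assms] show "integral {a..b} (\<lambda>x. 1 - cutoff a b \<delta> x) \<le> 2 * \<delta>" by linarith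
  have "integral {a..b} (\<lambda>x. (cutoff' a b \<delta> x)\<^sup>2) \<le> integral {a..b} (\<lambda>x. layer a b (\<delta> / 2) x / \<delta>\<^sup>2)"
    by (intro integral_le integrable_continuous_real continuous_intros continuous_on_cutoff)
       (use cutoff_bounds(4) assms in auto)
  also have "\<dots> = integral {a..b} (layer a b (\<delta> / 2)) / \<delta>\<^sup>2" by simp
  also have "\<dots> \<le> (2 * (\<delta> / 2)) / \<delta>\<^sup>2"
    using integral_layer_le[of "\<delta> / 2"] assms by (intro divide_right_mono) auto
  also have "\<dots> = 1 / \<delta>" using assms by (simp add: power2_eq_square)
  finally show "integral {a..b} (\<lambda>x. (cutoff' a b \<delta> x)\<^sup>2) \<le> 1 / \<delta>" .
qed

lemma weighted_square_bound:
  fixes x y \<kappa> :: real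
  assumes "\<kappa> > 0"
  shows "x * y \<le> \<kappa> * x\<^sup>2 + y\<^sup>2 / (4 * \<kappa>)"
proof -
  have "0 \<le> (2 * \<kappa> * x - y)\<^sup>2 / (4 * \<kappa>)" using assms by simp
  also have "\<dots> = \<kappa> * x\<^sup>2 + y\<^sup>2 / (4 * \<kappa>) - x * y"
    using assms by (simp add: power2_diff field_simps power2_eq_square)
  finally show ?thesis by simp
qed

text \<open>Since \<open>r \<ge> 2\<close>, the density \<open>r / 2\<close> times the squared speed dominates the squared speed.\<close>

lemma half_energy_bound:
  assumes flow: "axisymmetric_flow T G X \<psi>" and t: "0 \<le> t" "ereal t < T"
  shows "rz_integral 0 pi (\<lambda>r z. (d_r \<psi> r z t / r)\<^sup>2 + (d_z \<psi> r z t / r)\<^sup>2) \<le> energy G \<psi> 0"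
proof -
  note F = axisymmetric_flowD[OF flow]
  have se: "smooth_field T (energy_density G \<psi>)" by (rule smooth_energy_density[OF F(1,3)])
  have sv: "smooth_field T (\<lambda>r z t. (d_r \<psi> r z t / r)\<^sup>2 + (d_z \<psi> r z t / r)\<^sup>2)"
    using F(3) by (intro smooth_field_add smooth_field_power smooth_field_divide smooth_field_d)
  note c = rz_continuous_smooth[OF _ t]
  have "rz_integral 0 pi (\<lambda>r z. (d_r \<psi> r z t / r)\<^sup>2 + (d_z \<psi> r z t / r)\<^sup>2) \<le> rz_integral 0 pi (\<lambda>r z. energy_density G \<psi> r z t)"
  proof (rule rz_integral_mono[OF c[OF sv] c[OF se]])
    fix r z :: real assume r: "pi \<le> r" "r \<le> 2*pi"
    then have "r \<ge> 2" "r > 0" using pi_ge_two by linarith+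
    let ?q = "(d_r \<psi> r z t / r)\<^sup>2 + (d_z \<psi> r z t / r)\<^sup>2"
    have "?q = 2 * ?q / 2" by simp
    also have "\<dots> \<le> r * ?q / 2" using \<open>r \<ge> 2\<close> by (intro divide_right_mono mult_right_mono) auto
    also have "\<dots> \<le> r * ?q / 2 + inverse r * (G r z t)\<^sup>2 / 2" using \<open>r > 0\<close> by simp
    also have "\<dots> = energy_density G \<psi> r z t"
      by (simp add: energy_density_def divide_inverse[of _ r] power2_eq_square mult.commute add_divide_distrib)
    finally show "?q \<le> energy_density G \<psi> r z t" .
  qed
  also have "\<dots> \<le> energy G \<psi> t"
    unfolding energy_def rz_integral_def
  proof (rule integral_subset_le[OF _ rz_integrable[OF c[OF se]] rz_integrable[OF c[OF se]]])
    show "cbox (pi, 0) (2*pi, pi) \<subseteq> cbox (pi, - pi) (2*pi, pi :: real)"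
      using pi_ge_zero by (auto simp: cbox_Pair_eq)
    show "\<forall>x \<in> cbox (pi, - pi) (2*pi, pi). 0 \<le> (case x of (r, z) \<Rightarrow> energy_density G \<psi> r z t)"
      using pi_ge_zero by (auto simp: cbox_Pair_eq intro!: energy_density_nonneg)
  qed
  also have "\<dots> = energy G \<psi> 0" by (rule energy_conserved[OF flow t])
  finally show ?thesis .
qed

text \<open>Integrate by parts; the cutoff vanishes on the boundary of the half domain. It remains to bound the
integral of the velocity times the gradient of the cutoff, by the weighted inequality
\<open>x y \<le> \<kappa> x\<^sup>2 + y\<^sup>2 / (4 \<kappa>)\<close>: the first term is controlled by the energy, and the squared gradient has integral
at most \<open>2 pi / \<delta>\<close>.\<close>

lemma vorticity_cutoff_bound:
  assumes flow: "axisymmetric_flow T G X \<psi>" and t: "0 \<le> t" "ereal t < T" and "\<delta> > 0" "\<kappa> > 0"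
  shows "rz_integral 0 pi (\<lambda>r z. r * X r z t * (cutoff pi (2*pi) \<delta> r * cutoff 0 pi \<delta> z))
    \<le> \<kappa> * energy G \<psi> 0 + pi / (2 * \<kappa> * \<delta>)"
proof -
  note F = axisymmetric_flowD[OF flow]
  define A where "A = (\<lambda>r z t. inverse r * d_r \<psi> r z t)"
  define B where "B = (\<lambda>r z t. inverse r * d_z \<psi> r z t)"
  define \<rho> where "\<rho> = cutoff pi (2*pi) \<delta>"
  define \<sigma> where "\<sigma> = cutoff 0 pi \<delta>"
  define \<rho>' where "\<rho>' = cutoff' pi (2*pi) \<delta>"
  define \<sigma>' where "\<sigma>' = cutoff' 0 pi \<delta>"
  have sm: "smooth_field T A" "smooth_field T B" unfolding A_def B_def by (simp_all add: F(3))
  note cc = rz_continuousI(1)[OF continuous_on_cutoff(1)[OF \<open>\<delta> > 0\<close>]] rz_continuousI(2)[OF continuous_on_cutoff(1)[OF \<open>\<delta> > 0\<close>]]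
    rz_continuousI(1)[OF continuous_on_cutoff(2)[OF \<open>\<delta> > 0\<close>]] rz_continuousI(2)[OF continuous_on_cutoff(2)[OF \<open>\<delta> > 0\<close>]]
  note cs = rz_continuous_smooth[OF sm(1) t] rz_continuous_smooth[OF sm(2) t]
    rz_continuous_smooth[OF smooth_field_d_r[OF sm(1)] t] rz_continuous_smooth[OF smooth_field_d_z[OF sm(2)] t]
    rz_continuous_smooth[OF F(2) t] rz_continuous_smooth[OF smooth_field_radius[of T] t]
  define H where "H = (\<lambda>r z. d_r A r z t * (\<rho> r * \<sigma> z) + A r z t * (\<rho>' r * \<sigma> z))"
  define K where "K = (\<lambda>r z. d_z B r z t * (\<rho> r * \<sigma> z) + B r z t * (\<rho> r * \<sigma>' z))"
  have cH: "rz_continuous 0 pi H" "rz_continuous 0 pi K"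
    unfolding H_def K_def \<rho>_def \<sigma>_def \<rho>'_def \<sigma>'_def
    by (intro rz_continuous_arith(1,3) cc cs)+
  have "rz_integral 0 pi H = integral {0..pi} (\<lambda>z. A (2*pi) z t * (\<rho> (2*pi) * \<sigma> z) - A pi z t * (\<rho> pi * \<sigma> z))"
  proof (rule rz_integral_r_derivative[OF cH(1)])
    fix r z :: real assume "pi \<le> r" "r \<le> 2*pi"
    then have "((\<lambda>s. A s z t) has_real_derivative d_r A r z t) (at r within {pi..2*pi})"
      using has_d_r[OF sm(1)] t by simp
    then show "((\<lambda>s. A s z t * (\<rho> s * \<sigma> z)) has_real_derivative H r z) (at r within {pi..2*pi})"
      using cutoff_has_derivative[OF \<open>\<delta> > 0\<close>, of pi "2*pi" r "{pi..2*pi}"]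
      unfolding H_def \<rho>_def \<rho>'_def by (auto intro!: derivative_eq_intros)
  qed
  then have H0: "rz_integral 0 pi H = 0" by (simp add: \<rho>_def)
  have "rz_integral 0 pi K = integral {pi..2*pi} (\<lambda>r. B r pi t * (\<rho> r * \<sigma> pi) - B r 0 t * (\<rho> r * \<sigma> 0))"
  proof (rule rz_integral_z_derivative[OF cH(2)])
    fix r z :: real assume "pi \<le> r" "r \<le> 2*pi"
    then have "((\<lambda>s. B r s t) has_real_derivative d_z B r z t) (at z within {0..pi})"
      using has_field_derivative_at_within[OF has_d_z[OF sm(2)]] t by simp
    then show "((\<lambda>s. B r s t * (\<rho> r * \<sigma> s)) has_real_derivative K r z) (at z within {0..pi})"
      using cutoff_has_derivative[OF \<open>\<delta> > 0\<close>, of 0 pi z "{0..pi}"]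
      unfolding K_def \<sigma>_def \<sigma>'_def by (auto intro!: derivative_eq_intros)
  qed simp
  then have K0: "rz_integral 0 pi K = 0" by (simp add: \<sigma>_def)
  let ?V = "\<lambda>r z. (d_r \<psi> r z t / r)\<^sup>2 + (d_z \<psi> r z t / r)\<^sup>2"
  let ?R = "\<lambda>r z. ((\<rho>' r)\<^sup>2 + (\<sigma>' z)\<^sup>2) / (4 * \<kappa>)"
  have cV: "rz_continuous 0 pi ?V"
    by (rule rz_continuous_smooth[of T "\<lambda>r z t. (d_r \<psi> r z t / r)\<^sup>2 + (d_z \<psi> r z t / r)\<^sup>2", OF _ t])
       (use F(3) in \<open>intro smooth_field_add smooth_field_power smooth_field_divide smooth_field_d\<close>)
  have c': "continuous_on {pi..2*pi} (\<lambda>r. (\<rho>' r)\<^sup>2)" "continuous_on {0..pi} (\<lambda>z. (\<sigma>' z)\<^sup>2)"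
    unfolding \<rho>'_def \<sigma>'_def by (intro continuous_intros continuous_on_cutoff \<open>\<delta> > 0\<close>)+
  have cR: "rz_continuous 0 pi (\<lambda>r z. (\<rho>' r)\<^sup>2 + (\<sigma>' z)\<^sup>2)"
    by (intro rz_continuous_arith(1) rz_continuousI c')
  have const: "rz_continuous 0 pi (\<lambda>r z. c)" for c by (simp add: split_def)
  have "rz_integral 0 pi (\<lambda>r z. r * X r z t * (\<rho> r * \<sigma> z))
      \<le> rz_integral 0 pi (\<lambda>r z. \<kappa> * ?V r z + inverse (4 * \<kappa>) * ((\<rho>' r)\<^sup>2 + (\<sigma>' z)\<^sup>2) - (H r z + K r z))"
  proof (rule rz_integral_mono)
    show "rz_continuous 0 pi (\<lambda>r z. r * X r z t * (\<rho> r * \<sigma> z))"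
      unfolding \<rho>_def \<sigma>_def by (intro rz_continuous_arith(3) cs cc)
    show "rz_continuous 0 pi (\<lambda>r z. \<kappa> * ?V r z + inverse (4 * \<kappa>) * ((\<rho>' r)\<^sup>2 + (\<sigma>' z)\<^sup>2) - (H r z + K r z))"
      by (intro rz_continuous_arith cH cR const cV)
    fix r z :: real assume m: "pi \<le> r" "r \<le> 2*pi" "0 \<le> z" "z \<le> pi"
    have AB: "A r z t = d_r \<psi> r z t / r" "B r z t = d_z \<psi> r z t / r"
      by (simp_all add: A_def B_def divide_inverse)
    have e: "d_r A r z t + d_z B r z t = - r * X r z t"
      using F(9)[of r z t] m t by (simp add: A_def B_def)
    note b = cutoff_bounds[OF \<open>\<delta> > 0\<close> m(1,2), folded \<rho>_def] cutoff_bounds[OF \<open>\<delta> > 0\<close> m(3,4), folded \<sigma>_def]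
    have sq: "s\<^sup>2 \<le> 1" if "0 \<le> s" "s \<le> 1" for s :: real using that by (simp add: power_le_one)
    have "A r z t * (\<rho>' r * \<sigma> z) \<le> \<kappa> * (A r z t)\<^sup>2 + (\<rho>' r * \<sigma> z)\<^sup>2 / (4 * \<kappa>)"
      by (rule weighted_square_bound[OF \<open>\<kappa> > 0\<close>])
    also have "(\<rho>' r * \<sigma> z)\<^sup>2 \<le> (\<rho>' r)\<^sup>2"
      using sq[OF b(5,6)] by (simp add: power_mult_distrib mult_left_le)
    finally have 1: "A r z t * (\<rho>' r * \<sigma> z) \<le> \<kappa> * (A r z t)\<^sup>2 + (\<rho>' r)\<^sup>2 / (4 * \<kappa>)"
      using \<open>\<kappa> > 0\<close> by (simp add: divide_right_mono)
    have "B r z t * (\<rho> r * \<sigma>' z) \<le> \<kappa> * (B r z t)\<^sup>2 + (\<rho> r * \<sigma>' z)\<^sup>2 / (4 * \<kappa>)"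
      by (rule weighted_square_bound[OF \<open>\<kappa> > 0\<close>])
    also have "(\<rho> r * \<sigma>' z)\<^sup>2 \<le> (\<sigma>' z)\<^sup>2"
      using sq[OF b(1,2)] by (simp add: power_mult_distrib mult_left_le_one_le)
    finally have 2: "B r z t * (\<rho> r * \<sigma>' z) \<le> \<kappa> * (B r z t)\<^sup>2 + (\<sigma>' z)\<^sup>2 / (4 * \<kappa>)"
      using \<open>\<kappa> > 0\<close> by (simp add: divide_right_mono)
    have "r * X r z t * (\<rho> r * \<sigma> z) = - (d_r A r z t + d_z B r z t) * (\<rho> r * \<sigma> z)" unfolding e by simp
    also have "\<dots> = A r z t * (\<rho>' r * \<sigma> z) + B r z t * (\<rho> r * \<sigma>' z) - (H r z + K r z)"
      by (simp add: H_def K_def algebra_simps)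
    also have "\<dots> \<le> \<kappa> * ((A r z t)\<^sup>2 + (B r z t)\<^sup>2) + inverse (4 * \<kappa>) * ((\<rho>' r)\<^sup>2 + (\<sigma>' z)\<^sup>2) - (H r z + K r z)"
    proof -
      have "inverse (4 * \<kappa>) * ((\<rho>' r)\<^sup>2 + (\<sigma>' z)\<^sup>2) = (\<rho>' r)\<^sup>2 / (4 * \<kappa>) + (\<sigma>' z)\<^sup>2 / (4 * \<kappa>)"
        by (simp only: divide_inverse distrib_left mult.commute)
      moreover have "\<kappa> * ((A r z t)\<^sup>2 + (B r z t)\<^sup>2) = \<kappa> * (A r z t)\<^sup>2 + \<kappa> * (B r z t)\<^sup>2"
        by (rule distrib_left)
      ultimately show ?thesis using 1 2 by linarith
    qed
    finally show "r * X r z t * (\<rho> r * \<sigma> z)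
        \<le> \<kappa> * ?V r z + inverse (4 * \<kappa>) * ((\<rho>' r)\<^sup>2 + (\<sigma>' z)\<^sup>2) - (H r z + K r z)"
      unfolding AB .
  qed
  also have "\<dots> = \<kappa> * rz_integral 0 pi ?V + inverse (4 * \<kappa>) * rz_integral 0 pi (\<lambda>r z. (\<rho>' r)\<^sup>2 + (\<sigma>' z)\<^sup>2)"
    using H0 K0
    by (simp only: rz_integral_diff[OF rz_continuous_arith(1)[OF rz_continuous_arith(3)[OF const cV] rz_continuous_arith(3)[OF const cR]] rz_continuous_arith(1)[OF cH]]
        rz_integral_add[OF rz_continuous_arith(3)[OF const cV] rz_continuous_arith(3)[OF const cR]]
        rz_integral_add[OF cH] rz_integral_cmult)
  also have "rz_integral 0 pi (\<lambda>r z. (\<rho>' r)\<^sup>2 + (\<sigma>' z)\<^sup>2)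
      = pi * integral {pi..2*pi} (\<lambda>r. (\<rho>' r)\<^sup>2) + pi * integral {0..pi} (\<lambda>z. (\<sigma>' z)\<^sup>2)"
    using rz_integral_add[OF rz_continuousI(1)[OF c'(1)] rz_continuousI(2)[OF c'(2)]]
      rz_integral_radial[OF _ c'(1), of 0 pi] rz_integral_axial[OF c'(2)] by simp
  also have "\<kappa> * rz_integral 0 pi ?V + inverse (4 * \<kappa>) * \<dots> \<le> \<kappa> * energy G \<psi> 0 + inverse (4 * \<kappa>) * (pi * (1 / \<delta>) + pi * (1 / \<delta>))"
    using half_energy_bound[OF flow t] integral_cutoff_le(2)[OF \<open>\<delta> > 0\<close>, of pi "2*pi"]
      integral_cutoff_le(2)[OF \<open>\<delta> > 0\<close>, of 0 pi] \<open>\<kappa> > 0\<close>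
    unfolding \<rho>'_def \<sigma>'_def by (intro add_mono mult_left_mono) auto
  also have "\<dots> = \<kappa> * energy G \<psi> 0 + pi / (2 * \<kappa> * \<delta>)" using \<open>\<kappa> > 0\<close> \<open>\<delta> > 0\<close> by (simp add: field_simps)
  finally show ?thesis by (simp add: \<rho>_def \<sigma>_def)
qed

lemma integral_complement_cutoff_le:
  assumes "\<delta> > 0"
  shows "rz_integral 0 pi (\<lambda>r z. 1 - cutoff pi (2*pi) \<delta> r * cutoff 0 pi \<delta> z) \<le> 4 * pi * \<delta>"
proof -
  have c: "continuous_on {pi..2*pi} (\<lambda>r. 1 - cutoff pi (2*pi) \<delta> r)" "continuous_on {0..pi} (\<lambda>z. 1 - cutoff 0 pi \<delta> z)"
    by (rule continuous_on_diff continuous_on_const continuous_on_cutoff assms)+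
  have "rz_integral 0 pi (\<lambda>r z. 1 - cutoff pi (2*pi) \<delta> r * cutoff 0 pi \<delta> z)
      \<le> rz_integral 0 pi (\<lambda>r z. (1 - cutoff pi (2*pi) \<delta> r) + (1 - cutoff 0 pi \<delta> z))"
  proof (rule rz_integral_mono)
    show "rz_continuous 0 pi (\<lambda>r z. 1 - cutoff pi (2*pi) \<delta> r * cutoff 0 pi \<delta> z)"
      by (intro rz_continuous_arith(2)[OF rz_continuousI(1)[OF continuous_on_const]] rz_continuous_arith(3)
          rz_continuousI(1)[OF continuous_on_cutoff(1)] rz_continuousI(2)[OF continuous_on_cutoff(1)] assms)
    show "rz_continuous 0 pi (\<lambda>r z. (1 - cutoff pi (2*pi) \<delta> r) + (1 - cutoff 0 pi \<delta> z))"
      by (rule rz_continuous_arith(1)[OF rz_continuousI(1)[OF c(1)] rz_continuousI(2)[OF c(2)]])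
    fix r z :: real assume m: "pi \<le> r" "r \<le> 2*pi" "0 \<le> z" "z \<le> pi"
    have "0 \<le> (1 - cutoff pi (2*pi) \<delta> r) * (1 - cutoff 0 pi \<delta> z)"
      using cutoff_bounds[OF assms m(1,2)] cutoff_bounds[OF assms m(3,4)] by (intro mult_nonneg_nonneg) auto
    then show "1 - cutoff pi (2*pi) \<delta> r * cutoff 0 pi \<delta> z \<le> (1 - cutoff pi (2*pi) \<delta> r) + (1 - cutoff 0 pi \<delta> z)"
      by (simp add: algebra_simps)
  qed
  also have "\<dots> = pi * integral {pi..2*pi} (\<lambda>r. 1 - cutoff pi (2*pi) \<delta> r) + pi * integral {0..pi} (\<lambda>z. 1 - cutoff 0 pi \<delta> z)"
    using rz_integral_add[OF rz_continuousI(1)[OF c(1)] rz_continuousI(2)[OF c(2)]]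
      rz_integral_radial[OF _ c(1), of 0 pi] rz_integral_axial[OF c(2)] by simp
  also have "\<dots> \<le> pi * (2 * \<delta>) + pi * (2 * \<delta>)"
    using integral_cutoff_le(1)[OF assms, of pi "2*pi"] integral_cutoff_le(1)[OF assms, of 0 pi]
    by (intro add_mono mult_left_mono) auto
  finally show ?thesis by simp
qed

text \<open>The graph of the convex function \<open>x powr p\<close> lies above its tangent at \<open>a\<close>; an instance of Young's
inequality.\<close>

lemma powr_tangent_le:
  fixes a x p :: real
  assumes "p \<ge> 1" "a > 0" "x \<ge> 0"
  shows "p * a powr (p - 1) * x - (p - 1) * a powr p \<le> x powr p"
proof (cases "x = 0")
  case True
  moreover have "0 \<le> (p - 1) * a powr p" using assms by (intro mult_nonneg_nonneg) auto
  ultimately show ?thesis by simp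
next
  case False
  have "(x powr p) powr (1 / p) * (a powr p) powr (1 - 1 / p) \<le> (1 / p) * (x powr p) + (1 - 1 / p) * (a powr p)"
    by (rule Youngs_inequality_0) (use assms False in simp_all)
  moreover have "p * (1 - 1 / p) = p - 1" using assms by (simp add: field_simps)
  ultimately have "x * a powr (p - 1) \<le> (1 / p) * (x powr p) + (1 - 1 / p) * (a powr p)"
    using assms False by (simp add: powr_powr)
  then have "p * (x * a powr (p - 1)) \<le> p * ((1 / p) * (x powr p) + (1 - 1 / p) * (a powr p))"
    using assms by (intro mult_left_mono) auto
  also have "\<dots> = x powr p + (p - 1) * a powr p" using assms by (simp add: field_simps)
  finally show ?thesis by (simp add: algebra_simps)
qed

text \<open>Hoelder's inequality for the weight \<open>\<eta>\<close>, solved for the \<open>p\<close>-th power: integrate \<open>\<eta>\<close> times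
the tangent inequality at the mean value \<open>a = b / V\<close>.\<close>

lemma concentration_lower_bound:
  fixes p V b :: real
  assumes W: "rz_continuous 0 pi W" "\<And>r z. pi \<le> r \<Longrightarrow> r \<le> 2*pi \<Longrightarrow> 0 \<le> z \<Longrightarrow> z \<le> pi \<Longrightarrow> 0 \<le> W r z"
    and \<eta>: "rz_continuous 0 pi \<eta>" "\<And>r z. pi \<le> r \<Longrightarrow> r \<le> 2*pi \<Longrightarrow> 0 \<le> z \<Longrightarrow> z \<le> pi \<Longrightarrow> 0 \<le> \<eta> r z \<and> \<eta> r z \<le> 1"
    and V: "rz_integral 0 pi \<eta> \<le> V" "V > 0" and b: "b \<le> rz_integral 0 pi (\<lambda>r z. \<eta> r z * W r z)" "b > 0"
    and p: "p \<ge> 1"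
  shows "rz_integral 0 pi (\<lambda>r z. W r z powr p) \<ge> b powr p * V powr (1 - p)"
proof -
  define a where "a = b / V"
  have a: "a > 0" using V b by (simp add: a_def)
  have cp: "rz_continuous 0 pi (\<lambda>r z. W r z powr p)"
    unfolding split_def using W p
    by (intro continuous_on_powr') (auto simp: split_def cbox_Pair_eq)
  have const: "rz_continuous 0 pi (\<lambda>r z. c)" for c by (simp add: split_def)
  note cont = rz_continuous_arith(3)[OF \<eta>(1) W(1)] \<eta>(1)
  have "b powr p * V powr (1 - p) = b powr (p - 1) * b powr 1 * (V powr (1 - p))"
    unfolding powr_add[symmetric] by simp
  also have "\<dots> = a powr (p - 1) * b"
    using V b by (simp add: a_def powr_divide powr_diff field_simps)
  finally have val: "b powr p * V powr (1 - p) = a powr (p - 1) * b" .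
  have aV: "a * V = b" using V by (simp add: a_def)
  have ap: "a powr p = a powr (p - 1) * a" using a by (simp add: powr_diff)
  have "a powr (p - 1) * b = p * a powr (p - 1) * b - (p - 1) * a powr p * V"
    unfolding ap by (simp add: mult.assoc aV) (simp add: algebra_simps)
  also have "\<dots> \<le> p * a powr (p - 1) * rz_integral 0 pi (\<lambda>r z. \<eta> r z * W r z) - (p - 1) * a powr p * rz_integral 0 pi \<eta>"
    using V b p a by (intro diff_mono mult_left_mono) auto
  also have "\<dots> = rz_integral 0 pi (\<lambda>r z. p * a powr (p - 1) * (\<eta> r z * W r z) - (p - 1) * a powr p * \<eta> r z)"
    by (simp only: rz_integral_diff[OF rz_continuous_arith(3)[OF const cont(1)] rz_continuous_arith(3)[OF const cont(2)]] rz_integral_cmult)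
  also have "\<dots> \<le> rz_integral 0 pi (\<lambda>r z. W r z powr p)"
  proof (rule rz_integral_mono[OF _ cp])
    show "rz_continuous 0 pi (\<lambda>r z. p * a powr (p - 1) * (\<eta> r z * W r z) - (p - 1) * a powr p * \<eta> r z)"
      by (intro rz_continuous_arith(2,3) const cont W \<eta>)
    fix r z :: real assume m: "pi \<le> r" "r \<le> 2*pi" "0 \<le> z" "z \<le> pi"
    have "p * a powr (p - 1) * (\<eta> r z * W r z) - (p - 1) * a powr p * \<eta> r z
        = \<eta> r z * (p * a powr (p - 1) * W r z - (p - 1) * a powr p)" by (simp add: algebra_simps)
    also have "\<dots> \<le> \<eta> r z * (W r z powr p)"
      using powr_tangent_le[OF p a W(2)[OF m]] \<eta>(2)[OF m] by (intro mult_left_mono) auto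
    also have "\<dots> \<le> W r z powr p" using \<eta>(2)[OF m] by (simp add: mult_left_le_one_le)
    finally show "p * a powr (p - 1) * (\<eta> r z * W r z) - (p - 1) * a powr p * \<eta> r z \<le> W r z powr p" .
  qed
  finally show ?thesis by (simp add: val)
qed

section \<open>Lebesgue norms on the annular cylinder\<close>

abbreviation Omega_box :: "(real \<times> real \<times> real) set" where
  "Omega_box \<equiv> {pi..2*pi} \<times> {-pi<..pi} \<times> {-pi<..pi}"

lemma Omega_box_measurable [measurable, simp]: "Omega_box \<in> sets borel"
  by (intro borel_Times) auto

lemma Omega_measure_eq:
  "Omega_measure = density (restrict_space lborel Omega_box) (\<lambda>x. ennreal (fst x))"
  by (simp add: Omega_measure_def split_def)

lemma measurable_Omega_measure:
  assumes "continuous_on Omega_box f"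
  shows "f \<in> borel_measurable Omega_measure"
proof -
  have "f \<in> borel_measurable (restrict_space borel Omega_box)"
    by (rule borel_measurable_continuous_on_restrict[OF assms])
  then have "f \<in> borel_measurable (restrict_space lborel Omega_box)"
    by (simp cong: measurable_cong_sets sets_restrict_space_cong)
  then show ?thesis unfolding Omega_measure_eq by simp
qed

text \<open>The density \<open>r\<close> is positive on the domain, so null sets are Lebesgue null sets.\<close>

lemma AE_Omega_measure:
  assumes "AE x in Omega_measure. P x"
  shows "AE x in lborel. x \<in> Omega_box \<longrightarrow> P x"
proof -
  have "(\<lambda>x. ennreal (fst x)) \<in> borel_measurable (restrict_space lborel Omega_box)"
    by (intro measurable_compose[OF _ measurable_ennreal] measurable_restrict_space1)
       (auto intro!: borel_measurable_continuous_onI continuous_on_fst continuous_on_id)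
  then have "AE x in lborel. x \<in> Omega_box \<longrightarrow> 0 < ennreal (fst x) \<longrightarrow> P x"
    using assms unfolding Omega_measure_eq by (simp add: AE_density AE_restrict_space_iff)
  moreover have "0 < fst x" if "x \<in> Omega_box" for x :: "real \<times> real \<times> real"
  proof -
    have "pi \<le> fst x" using that by auto
    then show ?thesis using pi_gt_zero by linarith
  qed
  ultimately show ?thesis by (auto elim: eventually_mono)
qed

text \<open>The box has the angle \<open>\<theta> \<in> {0..pi}\<close>, and the integrand does not depend on \<open>\<theta>\<close>; hence the factor \<open>pi\<close>.\<close>

lemma set_integral_box_eq_rz_integral:
  assumes "rz_continuous 0 pi F"
  shows "set_integrable lborel (cbox (pi, 0, 0) (2*pi, pi, pi)) (\<lambda>x. F (fst x) (snd (snd x)))"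
    and "(LINT x : cbox (pi, 0, 0) (2*pi, pi, pi) | lborel. F (fst x) (snd (snd x))) = pi * rz_integral 0 pi F"
proof -
  let ?Q = "cbox (pi, 0, 0) (2*pi, pi, pi) :: (real \<times> real \<times> real) set"
  have c: "continuous_on ?Q (\<lambda>x. F (fst x) (snd (snd x)))"
    by (rule rz_continuous_compose[OF assms]) (auto simp: cbox_Pair_eq intro!: continuous_intros)
  show int: "set_integrable lborel ?Q (\<lambda>x. F (fst x) (snd (snd x)))"
    unfolding set_integrable_def by (rule borel_integrable_compact[OF compact_cbox c])
  have in1: "integral (cbox (0, 0) (pi, pi)) (\<lambda>y. F r (snd y)) = pi * integral {0..pi} (\<lambda>z. F r z)"
    if "pi \<le> r" "r \<le> 2*pi" for r
  proof -
    have "continuous_on (cbox (0, 0) (pi, pi)) (\<lambda>y. F r (snd y))"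
      by (rule rz_continuous_compose[OF assms]) (use that in \<open>auto simp: cbox_Pair_eq intro!: continuous_intros\<close>)
    from integral_prod_continuous[OF this] show ?thesis by simp
  qed
  have "(LINT x : ?Q | lborel. F (fst x) (snd (snd x))) = integral ?Q (\<lambda>x. F (fst x) (snd (snd x)))"
    by (rule set_borel_integral_eq_integral(2)[OF int])
  also have "\<dots> = integral {pi..2*pi} (\<lambda>r. integral (cbox (0, 0) (pi, pi)) (\<lambda>y. F r (snd y)))"
    using integral_prod_continuous[OF c] by simp
  also have "\<dots> = integral {pi..2*pi} (\<lambda>r. pi * integral {0..pi} (\<lambda>z. F r z))"
    by (intro integral_cong in1) auto
  also have "\<dots> = pi * rz_integral 0 pi F"
    using rz_integral_iterated(1)[OF assms] by simp
  finally show "(LINT x : ?Q | lborel. F (fst x) (snd (snd x))) = pi * rz_integral 0 pi F" .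
qed

lemma cbox_subset_Omega_box: "cbox (pi, 0, 0) (2*pi, pi, pi) \<subseteq> Omega_box"
  by (clarsimp simp: cbox_Pair_eq) (use pi_gt_zero in linarith)

text \<open>Only half of the angles and half of the period are needed for the lower bound; this closed box avoids the
half-open ends of the coordinate intervals. The factors \<open>r \<ge> 1\<close> and \<open>pi \<ge> 1\<close> are dropped.\<close>

lemma rz_integral_le_Omega_integral:
  assumes F: "rz_continuous (- pi) pi F"
    and nonneg: "\<And>r z. pi \<le> r \<Longrightarrow> r \<le> 2*pi \<Longrightarrow> - pi \<le> z \<Longrightarrow> z \<le> pi \<Longrightarrow> 0 \<le> F r z"
  shows "rz_integral 0 pi F \<le> (\<integral>x. F (fst x) (snd (snd x)) \<partial>Omega_measure)"
proof -
  let ?Q = "cbox (pi, 0, 0) (2*pi, pi, pi) :: (real \<times> real \<times> real) set"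
  let ?K = "cbox (pi, - pi, - pi) (2*pi, pi, pi) :: (real \<times> real \<times> real) set"
  let ?f = "\<lambda>x::real \<times> real \<times> real. F (fst x) (snd (snd x))"
  have F0: "rz_continuous 0 pi F"
    by (rule continuous_on_subset[OF F]) (use pi_gt_zero in \<open>auto simp: cbox_Pair_eq\<close>)
  have cK: "continuous_on ?K ?f"
    by (rule rz_continuous_compose[OF F]) (auto simp: cbox_Pair_eq intro!: continuous_intros)
  have sub: "Omega_box \<subseteq> ?K" by (auto simp: cbox_Pair_eq)
  have "set_integrable lborel ?K (\<lambda>x. fst x * ?f x)"
    unfolding set_integrable_def
    by (rule borel_integrable_compact[OF compact_cbox]) (intro continuous_intros cK)
  then have int: "set_integrable lborel Omega_box (\<lambda>x. fst x * ?f x)"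
    by (rule set_integrable_subset) (use sub in auto)
  have m1: "?f \<in> borel_measurable (restrict_space lborel Omega_box)"
    using measurable_Omega_measure[OF continuous_on_subset[OF cK sub]] unfolding Omega_measure_eq by simp
  have m2: "fst \<in> borel_measurable (restrict_space lborel Omega_box)"
    by (intro measurable_restrict_space1) (auto intro!: borel_measurable_continuous_onI continuous_on_fst continuous_on_id)
  have "AE x in restrict_space lborel Omega_box. 0 \<le> fst x"
    by (subst AE_restrict_space_iff) (use pi_gt_zero in auto)
  then have "(\<integral>x. ?f x \<partial>Omega_measure) = (\<integral>x. fst x *\<^sub>R ?f x \<partial>restrict_space lborel Omega_box)"
    unfolding Omega_measure_eq by (intro integral_density m1 m2)
  also have "\<dots> = (LINT x : Omega_box | lborel. fst x * ?f x)"
    by (simp add: integral_restrict_space set_lebesgue_integral_def)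
  finally have eq: "(\<integral>x. ?f x \<partial>Omega_measure) = (LINT x : Omega_box | lborel. fst x * ?f x)" .
  have nn: "0 \<le> rz_integral 0 pi F"
  proof -
    have "rz_integral 0 pi (\<lambda>r z. 0) \<le> rz_integral 0 pi F"
      by (rule rz_integral_mono[OF _ F0]) (use nonneg in \<open>auto simp: split_def\<close>)
    then show ?thesis by (simp add: rz_integral_def split_def)
  qed
  then have "rz_integral 0 pi F \<le> pi * rz_integral 0 pi F"
    using mult_right_mono[of 1 pi "rz_integral 0 pi F"] pi_ge_two by simp
  also have "\<dots> = (LINT x : ?Q | lborel. ?f x)" using set_integral_box_eq_rz_integral(2)[OF F0] by simp
  also have "\<dots> \<le> (LINT x : Omega_box | lborel. fst x * ?f x)"
    unfolding set_lebesgue_integral_def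
  proof (rule integral_mono)
    show "integrable lborel (\<lambda>x. indicator ?Q x *\<^sub>R ?f x)"
      using set_integral_box_eq_rz_integral(1)[OF F0] by (simp add: set_integrable_def)
    show "integrable lborel (\<lambda>x. indicator Omega_box x *\<^sub>R (fst x * ?f x))"
      using int by (simp add: set_integrable_def)
    fix x :: "real \<times> real \<times> real"
    have "?f x \<le> fst x * ?f x" if "x \<in> Omega_box"
    proof -
      have "1 \<le> fst x" "0 \<le> ?f x" using that pi_ge_two nonneg by auto
      then show ?thesis using mult_right_mono[of 1 "fst x" "?f x"] by simp
    qed
    moreover have "0 \<le> ?f x" if "x \<in> Omega_box" using that nonneg by auto
    ultimately show "indicator ?Q x *\<^sub>R ?f x \<le> indicator Omega_box x *\<^sub>R (fst x * ?f x)"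
      using cbox_subset_Omega_box by (fastforce simp: indicator_def)
  qed
  finally show ?thesis unfolding eq .
qed

text \<open>A continuous function that is nonnegative with integral zero vanishes; apply this to the excess of
\<open>F\<close> over \<open>M\<close>.\<close>

lemma AE_Omega_bound_pointwise:
  assumes F: "rz_continuous 0 pi F" and AE: "AE x in Omega_measure. F (fst x) (snd (snd x)) \<le> M"
    and rz: "pi \<le> r" "r \<le> 2*pi" "0 \<le> z" "z \<le> pi"
  shows "F r z \<le> M"
proof -
  define H where "H = (\<lambda>r z. max 0 (F r z - M))"
  have H: "rz_continuous 0 pi H"
    using F unfolding H_def split_def by (intro continuous_intros)
  let ?Q = "cbox (pi, 0, 0) (2*pi, pi, pi) :: (real \<times> real \<times> real) set"
  have "(LINT x : ?Q | lborel. H (fst x) (snd (snd x))) = 0"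
    unfolding set_lebesgue_integral_def
  proof (rule integral_eq_zero_AE)
    show "AE x in lborel. indicator ?Q x *\<^sub>R H (fst x) (snd (snd x)) = 0"
      using AE_Omega_measure[OF AE]
      by eventually_elim (use cbox_subset_Omega_box in \<open>auto simp: H_def indicator_def\<close>)
  qed
  then have "rz_integral 0 pi H = 0" using set_integral_box_eq_rz_integral(2)[OF H] by simp
  then have "H r z = 0"
    by (intro rz_integral_nonneg_eq_0[OF H pi_gt_zero _ _ rz]) (auto simp: H_def)
  then show ?thesis by (simp add: H_def)
qed

text \<open>The essential supremum is converted to a real number by \<open>real_of_ereal\<close>, which sends infinite values
to zero; so the proof has to show first that it is finite.\<close>

lemma pointwise_le_Lp_norm_infinity:
  fixes f :: "real \<times> real \<times> real \<Rightarrow> 'b::real_normed_vector"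
  assumes F: "rz_continuous (- pi) pi F" and f: "\<And>r \<theta> z. norm (f (r, \<theta>, z)) = F r z"
    and rz: "pi \<le> r" "r \<le> 2*pi" "0 \<le> z" "z \<le> pi"
  shows "F r z \<le> Lp_norm \<infinity> f"
proof -
  have fx: "norm (f x) = F (fst x) (snd (snd x))" for x using f[of "fst x" "fst (snd x)" "snd (snd x)"] by simp
  have F0: "rz_continuous 0 pi F"
    by (rule continuous_on_subset[OF F]) (use pi_gt_zero in \<open>auto simp: cbox_Pair_eq\<close>)
  have cO: "continuous_on Omega_box (\<lambda>x. F (fst x) (snd (snd x)))"
    by (rule rz_continuous_compose[OF F]) (auto intro!: continuous_intros)
  have meas: "(\<lambda>x. ereal (norm (f x))) \<in> borel_measurable Omega_measure"
    unfolding fx using measurable_Omega_measure[OF cO] by simp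
  define S where "S = esssup Omega_measure (\<lambda>x. ereal (norm (f x)))"
  have ae: "AE x in Omega_measure. ereal (F (fst x) (snd (snd x))) \<le> S"
    using esssup_AE[of "\<lambda>x. ereal (norm (f x))" Omega_measure] by (simp add: S_def fx)
  have "compact ((\<lambda>(r, z). F r z) ` cbox (pi, - pi) (2*pi, pi))"
    by (rule compact_continuous_image[OF F compact_cbox])
  then obtain M where "\<And>y. y \<in> (\<lambda>(r, z). F r z) ` cbox (pi, - pi) (2*pi, pi) \<Longrightarrow> norm y \<le> M"
    using compact_imp_bounded bounded_pos by metis
  then have M: "F r z \<le> M" if "pi \<le> r" "r \<le> 2*pi" "- pi \<le> z" "z \<le> pi" for r z
    using that by (fastforce simp: cbox_Pair_eq)
  have "AE x in Omega_measure. x \<in> Omega_box"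
    using AE_space[of Omega_measure] by (simp add: Omega_measure_eq space_restrict_space)
  then have "AE x in Omega_measure. ereal (norm (f x)) \<le> ereal M"
    by eventually_elim (use M in \<open>auto simp: fx\<close>)
  then have "S \<le> ereal M" unfolding S_def by (rule esssup_I[OF meas])
  moreover have "S \<noteq> -\<infinity>"
  proof
    assume "S = -\<infinity>"
    then have "AE x in Omega_measure. F (fst x) (snd (snd x)) \<le> -1"
      by (intro eventually_mono[OF ae]) simp
    from AE_Omega_bound_pointwise[OF F0 this rz] have "F r z \<le> - 1" .
    moreover have "0 \<le> F r z" by (metis f norm_ge_zero)
    ultimately show False by simp
  qed
  ultimately obtain s where s: "S = ereal s" by (cases S) auto
  then have "AE x in Omega_measure. F (fst x) (snd (snd x)) \<le> s" using ae by simp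
  from AE_Omega_bound_pointwise[OF F0 this rz] show ?thesis
    using s by (simp add: Lp_norm_def S_def)
qed

section \<open>Growth of the vorticity and of the velocity\<close>

lemma Lp_norm_lower_bound:
  fixes f :: "real \<times> real \<times> real \<Rightarrow> 'b::real_normed_vector"
  assumes F: "rz_continuous (- pi) pi F" and f: "\<And>r \<theta> z. norm (f (r, \<theta>, z)) = F r z"
    and \<eta>: "rz_continuous 0 pi \<eta>" "\<And>r z. pi \<le> r \<Longrightarrow> r \<le> 2*pi \<Longrightarrow> 0 \<le> z \<Longrightarrow> z \<le> pi \<Longrightarrow> 0 \<le> \<eta> r z \<and> \<eta> r z \<le> 1"
    and V: "rz_integral 0 pi \<eta> \<le> V" "V > 0" and b: "b \<le> rz_integral 0 pi (\<lambda>r z. \<eta> r z * F r z)" "b > 0"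
  shows "1 \<le> p \<Longrightarrow> Lp_norm (ereal p) f \<ge> b * V powr ((1 - p) / p)"
    and "Lp_norm \<infinity> f \<ge> b / V"
proof -
  have fx: "norm (f x) = F (fst x) (snd (snd x))" for x using f[of "fst x" "fst (snd x)" "snd (snd x)"] by simp
  have nn: "0 \<le> F r z" for r z by (metis f norm_ge_zero)
  have F0: "rz_continuous 0 pi F"
    by (rule continuous_on_subset[OF F]) (use pi_gt_zero in \<open>auto simp: cbox_Pair_eq\<close>)
  show "Lp_norm (ereal p) f \<ge> b * V powr ((1 - p) / p)" if p: "1 \<le> p"
  proof -
    have cp: "rz_continuous (- pi) pi (\<lambda>r z. F r z powr p)"
      unfolding split_def using F p nn by (intro continuous_on_powr') (auto simp: split_def)
    have "b powr p * V powr (1 - p) \<le> rz_integral 0 pi (\<lambda>r z. F r z powr p)"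
      by (rule concentration_lower_bound[OF F0 nn \<eta> V b p])
    also have "\<dots> \<le> (\<integral>x. norm (f x) powr p \<partial>Omega_measure)"
      unfolding fx by (rule rz_integral_le_Omega_integral[OF cp]) simp
    finally have "(b powr p * V powr (1 - p)) powr (1 / p) \<le> (\<integral>x. norm (f x) powr p \<partial>Omega_measure) powr (1 / p)"
      using p b V by (intro powr_mono2) auto
    also have "(b powr p * V powr (1 - p)) powr (1 / p) = b * V powr ((1 - p) / p)"
      using p b V by (simp add: powr_mult powr_powr)
    finally show ?thesis by (simp add: Lp_norm_def)
  qed
  show "Lp_norm \<infinity> f \<ge> b / V"
  proof -
    let ?N = "Lp_norm \<infinity> f"
    have le: "F r z \<le> ?N" if "pi \<le> r" "r \<le> 2*pi" "0 \<le> z" "z \<le> pi" for r z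
      by (rule pointwise_le_Lp_norm_infinity[OF F f that])
    have "0 \<le> ?N" using le[of pi 0] nn[of pi 0] pi_ge_zero by simp
    have "b \<le> rz_integral 0 pi (\<lambda>r z. \<eta> r z * F r z)" by (rule b)
    also have "\<dots> \<le> rz_integral 0 pi (\<lambda>r z. ?N * \<eta> r z)"
    proof (rule rz_integral_mono)
      show "rz_continuous 0 pi (\<lambda>r z. \<eta> r z * F r z)" by (rule rz_continuous_arith(3)[OF \<eta>(1) F0])
      show "rz_continuous 0 pi (\<lambda>r z. ?N * \<eta> r z)"
        by (rule rz_continuous_arith(3)[OF rz_continuousI(1)[OF continuous_on_const] \<eta>(1)])
      fix r z :: real assume m: "pi \<le> r" "r \<le> 2*pi" "0 \<le> z" "z \<le> pi"
      show "\<eta> r z * F r z \<le> ?N * \<eta> r z"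
        using mult_right_mono[OF le[OF m], of "\<eta> r z"] \<eta>(2)[OF m] by (simp add: mult.commute)
    qed
    also have "\<dots> = ?N * rz_integral 0 pi \<eta>" by (rule rz_integral_cmult)
    also have "\<dots> \<le> ?N * V" by (rule mult_left_mono[OF V(1) \<open>0 \<le> ?N\<close>])
    finally show ?thesis using V by (simp add: field_simps)
  qed
qed

lemma Lp_norm_nonneg:
  fixes f :: "real \<times> real \<times> real \<Rightarrow> 'b::real_normed_vector"
  assumes "rz_continuous (- pi) pi F" "\<And>r \<theta> z. norm (f (r, \<theta>, z)) = F r z"
  shows "0 \<le> Lp_norm p f"
proof (cases "p = \<infinity>")
  case True
  have "0 \<le> F pi 0" by (metis assms(2) norm_ge_zero)
  also have "\<dots> \<le> Lp_norm p f"
    using pointwise_le_Lp_norm_infinity[OF assms, of pi 0] pi_ge_zero True by simp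
  finally show ?thesis .
qed (simp add: Lp_norm_def)

text \<open>A weight of mass \<open>V / t\<^sup>2\<close> and a vorticity integral \<open>k t / 4\<close> give the exponent
\<open>1 - 2 (1 - q) / q = 3 - 2 / q\<close>. Since \<open>V \<ge> 1\<close> and \<open>(1 - q) / q \<ge> - 1\<close>, the constant can be chosen independently
of \<open>q\<close>.\<close>

lemma layer_scaling:
  fixes V t q k :: real
  assumes "V \<ge> 1" "t > 0" "q \<ge> 1" "k > 0"
  shows "k / (4 * V) * t powr (3 - 2 / q) \<le> k * t / 4 * (V / t\<^sup>2) powr ((1 - q) / q)"
proof -
  define e where "e = (1 - q) / q"
  have e: "- 1 \<le> e" "3 - 2 / q = 1 - 2 * e" using assms by (simp_all add: e_def field_simps)
  have "t\<^sup>2 = t powr 2" using assms by simp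
  then have "(V / t\<^sup>2) powr e = V powr e / t powr (2 * e)"
    using assms by (simp only: powr_divide powr_powr)
  moreover have "t powr (1 - 2 * e) = t / t powr (2 * e)" using assms by (simp add: powr_diff)
  moreover have "1 / V = V powr (- 1)" using powr_minus_divide[of V 1] assms by simp
  moreover have "V powr (- 1) \<le> V powr e" using assms e by (intro powr_mono) auto
  ultimately have "1 / V * t powr (1 - 2 * e) \<le> t * (V / t\<^sup>2) powr e"
    using mult_right_mono[of "1 / V" "V powr e" "t / t powr (2 * e)"] assms by (simp add: mult.commute)
  then have "k / 4 * (1 / V * t powr (1 - 2 * e)) \<le> k / 4 * (t * (V / t\<^sup>2) powr e)"
    using assms by (intro mult_left_mono) auto
  then show ?thesis unfolding e(2) e_def by simp
qed

text \<open>The weight is one minus the cutoff. The parameters \<open>\<kappa>\<close> and \<open>\<delta>\<close> are chosen so that both terms in the bound for the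
vorticity away from the boundary equal \<open>c t / 4\<close>.\<close>

lemma (in symmetric_flow) vorticity_concentrates:
  assumes t: "0 < t" "ereal t < T" and E: "energy G \<psi> 0 \<le> E" "E > 0"
    and c: "c > 0" "c * t \<le> circulation t"
  obtains \<eta> where "rz_continuous 0 pi \<eta>"
    "\<And>r z. pi \<le> r \<Longrightarrow> r \<le> 2*pi \<Longrightarrow> 0 \<le> z \<Longrightarrow> z \<le> pi \<Longrightarrow> 0 \<le> \<eta> r z \<and> \<eta> r z \<le> 1"
    "rz_integral 0 pi \<eta> \<le> 32 * pi\<^sup>2 * E / (c * t)\<^sup>2"
    "c * t / 2 \<le> rz_integral 0 pi (\<lambda>r z. \<eta> r z * \<bar>r * X r z t\<bar>)"
proof -
  define \<kappa> where "\<kappa> = c * t / (4 * E)"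
  define \<delta> where "\<delta> = 8 * pi * E / (c * t)\<^sup>2"
  have pos: "\<kappa> > 0" "\<delta> > 0" using t c E pi_gt_zero by (simp_all add: \<kappa>_def \<delta>_def)
  have t0: "0 \<le> t" using t by simp
  define \<xi> where "\<xi> = (\<lambda>r z. cutoff pi (2*pi) \<delta> r * cutoff 0 pi \<delta> z)"
  have c\<xi>: "rz_continuous 0 pi \<xi>"
    unfolding \<xi>_def
    by (rule rz_continuous_arith(3)[OF rz_continuousI(1)[OF continuous_on_cutoff(1)] rz_continuousI(2)[OF continuous_on_cutoff(1)]])
       (use pos in auto)
  have c\<eta>: "rz_continuous 0 pi (\<lambda>r z. 1 - \<xi> r z)"
    by (rule rz_continuous_arith(2)[OF rz_continuousI(1)[OF continuous_on_const] c\<xi>])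
  have smw: "smooth_field T (\<lambda>r z t. r * X r z t)" by (simp add: flowD(2))
  note cw = rz_continuous_smooth[OF smw t0 t(2)]
  have caw: "rz_continuous 0 pi (\<lambda>r z. \<bar>r * X r z t\<bar>)"
    by (rule rz_continuous_abs[OF cw])
  have \<eta>01: "0 \<le> 1 - \<xi> r z \<and> 1 - \<xi> r z \<le> 1" if m: "pi \<le> r" "r \<le> 2*pi" "0 \<le> z" "z \<le> pi" for r z
    using cutoff_bounds[OF pos(2) m(1,2)] cutoff_bounds[OF pos(2) m(3,4)]
    by (auto simp: \<xi>_def intro: mult_le_one)
  have "rz_integral 0 pi (\<lambda>r z. r * X r z t * \<xi> r z) \<le> \<kappa> * energy G \<psi> 0 + pi / (2 * \<kappa> * \<delta>)"
    unfolding \<xi>_def by (rule vorticity_cutoff_bound[OF flow t0 t(2) pos(2,1)])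
  also have "\<dots> \<le> \<kappa> * E + pi / (2 * \<kappa> * \<delta>)" using E pos by simp
  also have "\<dots> = c * t / 2"
    using E t c pi_gt_zero by (simp add: \<kappa>_def \<delta>_def field_simps power2_eq_square)
  finally have inner: "rz_integral 0 pi (\<lambda>r z. r * X r z t * \<xi> r z) \<le> c * t / 2" .
  have "c * t / 2 \<le> circulation t - rz_integral 0 pi (\<lambda>r z. r * X r z t * \<xi> r z)" using inner c by simp
  also have "\<dots> = rz_integral 0 pi (\<lambda>r z. r * X r z t - r * X r z t * \<xi> r z)"
    unfolding circulation_def using rz_integral_diff[OF cw rz_continuous_arith(3)[OF cw c\<xi>]] by simp
  also have "\<dots> \<le> rz_integral 0 pi (\<lambda>r z. (1 - \<xi> r z) * \<bar>r * X r z t\<bar>)"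
  proof (rule rz_integral_mono[OF rz_continuous_arith(2)[OF cw rz_continuous_arith(3)[OF cw c\<xi>]] rz_continuous_arith(3)[OF c\<eta> caw]])
    fix r z :: real assume m: "pi \<le> r" "r \<le> 2*pi" "0 \<le> z" "z \<le> pi"
    have "r * X r z t - r * X r z t * \<xi> r z = (1 - \<xi> r z) * (r * X r z t)" by (simp add: algebra_simps)
    also have "\<dots> \<le> (1 - \<xi> r z) * \<bar>r * X r z t\<bar>" using \<eta>01[OF m] by (intro mult_left_mono) auto
    finally show "r * X r z t - r * X r z t * \<xi> r z \<le> (1 - \<xi> r z) * \<bar>r * X r z t\<bar>" .
  qed
  finally have outer: "c * t / 2 \<le> rz_integral 0 pi (\<lambda>r z. (1 - \<xi> r z) * \<bar>r * X r z t\<bar>)" .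
  have "rz_integral 0 pi (\<lambda>r z. 1 - \<xi> r z) \<le> 4 * pi * \<delta>"
    unfolding \<xi>_def by (rule integral_complement_cutoff_le[OF pos(2)])
  also have "\<dots> = 32 * pi\<^sup>2 * E / (c * t)\<^sup>2" by (simp add: \<delta>_def power2_eq_square)
  finally show thesis using that[OF c\<eta> \<eta>01 _ outer] by blast
qed

text \<open>The circulation is a line integral of the velocity along a curve of length \<open>4 pi\<close>.\<close>

lemma (in symmetric_flow) circulation_le_velocity:
  assumes t: "0 \<le> t" "ereal t < T"
    and N: "\<And>r z. pi \<le> r \<Longrightarrow> r \<le> 2*pi \<Longrightarrow> 0 \<le> z \<Longrightarrow> z \<le> pi \<Longrightarrow> \<bar>vel_r \<psi> r z t\<bar> \<le> N \<and> \<bar>vel_z \<psi> r z t\<bar> \<le> N"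
  shows "circulation t \<le> 4 * pi * N"
proof -
  define A where "A = (\<lambda>r z t. inverse r * d_r \<psi> r z t)"
  define B where "B = (\<lambda>r z t. inverse r * d_z \<psi> r z t)"
  have sm: "smooth_field T A" "smooth_field T B" unfolding A_def B_def by (simp_all add: flowD(3))
  have AB: "\<bar>A r z t\<bar> \<le> N" "\<bar>B r z t\<bar> \<le> N" if "pi \<le> r" "r \<le> 2*pi" "0 \<le> z" "z \<le> pi" for r z
    using N[OF that] by (simp_all add: A_def B_def vel_r_def vel_z_def divide_inverse mult.commute)
  note c = rz_continuous_smooth[OF _ t]
  have pi2: "pi \<le> 2 * pi" using pi_ge_zero by linarith
  have "circulation t = rz_integral 0 pi (\<lambda>r z. (-1) * (d_r A r z t + d_z B r z t))"
    unfolding circulation_def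
    by (rule rz_integral_cong) (use flowD(9)[folded A_def B_def] t in auto)
  also have "\<dots> = - (rz_integral 0 pi (\<lambda>r z. d_r A r z t) + rz_integral 0 pi (\<lambda>r z. d_z B r z t))"
    unfolding rz_integral_cmult
    using rz_integral_add[OF c[OF smooth_field_d_r[OF sm(1)]] c[OF smooth_field_d_z[OF sm(2)]]] by simp
  also have "rz_integral 0 pi (\<lambda>r z. d_r A r z t) = integral {0..pi} (\<lambda>z. A (2*pi) z t - A pi z t)"
    by (rule rz_integral_d_r[OF sm(1) t])
  also have "rz_integral 0 pi (\<lambda>r z. d_z B r z t) = integral {pi..2*pi} (\<lambda>r. B r pi t - B r 0 t)"
    by (rule rz_integral_d_z[OF sm(2) t pi_ge_zero])
  finally have eq: "circulation t = - (integral {0..pi} (\<lambda>z. A (2*pi) z t - A pi z t) + integral {pi..2*pi} (\<lambda>r. B r pi t - B r 0 t))" .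
  have cA: "continuous_on {0..pi} (\<lambda>z. A r z t)" if "pi \<le> r" "r \<le> 2*pi" for r
    by (rule smooth_field_continuous_compose[OF sm(1)]) (use that t in \<open>auto intro!: continuous_intros\<close>)
  have cB: "continuous_on {pi..2*pi} (\<lambda>r. B r z t)" for z
    by (rule smooth_field_continuous_compose[OF sm(2)]) (use t in \<open>auto intro!: continuous_intros\<close>)
  have "integral {0..pi} (\<lambda>z. - (2 * N)) \<le> integral {0..pi} (\<lambda>z. A (2*pi) z t - A pi z t)"
  proof (rule integral_le)
    show "(\<lambda>z. A (2*pi) z t - A pi z t) integrable_on {0..pi}"
      by (intro integrable_continuous_real continuous_on_diff cA) (use pi2 in auto)
    show "- (2 * N) \<le> A (2*pi) z t - A pi z t" if "z \<in> {0..pi}" for z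
      using AB(1)[of "2*pi" z] AB(1)[of pi z] that pi2 by auto
  qed auto
  moreover have "integral {pi..2*pi} (\<lambda>r. - (2 * N)) \<le> integral {pi..2*pi} (\<lambda>r. B r pi t - B r 0 t)"
  proof (rule integral_le)
    show "(\<lambda>r. B r pi t - B r 0 t) integrable_on {pi..2*pi}"
      by (intro integrable_continuous_real continuous_on_diff cB)
    show "- (2 * N) \<le> B r pi t - B r 0 t" if "r \<in> {pi..2*pi}" for r
      using AB(2)[of r pi] AB(2)[of r 0] that pi_ge_zero by auto
  qed auto
  ultimately show ?thesis unfolding eq by simp
qed

theorem theorem1p7:
  fixes u0 w0 :: "real \<Rightarrow> real \<Rightarrow> real" and k0 :: real
  assumes "smooth_on ({pi..2*pi} \<times> UNIV) (\<lambda>(r, z). u0 r z)"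
    and "smooth_on ({pi..2*pi} \<times> UNIV) (\<lambda>(r, z). w0 r z)"
    and "\<forall>r\<in>{pi..2*pi}. \<forall>z. u0 r (z + 2*pi) = u0 r z"
    and "\<forall>r\<in>{pi..2*pi}. \<forall>z. w0 r (z + 2*pi) = w0 r z"
    and "\<forall>r\<in>{pi..2*pi}. \<forall>z. u0 r (- z) = u0 r z"
    and "\<forall>r\<in>{pi..2*pi}. \<forall>z. w0 r (- z) = - w0 r z"
    and "k0 > 0"
    and "\<forall>r\<in>{pi..2*pi}. u0 r pi \<ge> k0"
    and "\<forall>r\<in>{pi..2*pi}. \<bar>u0 r 0\<bar> \<le> k0 / 8"
  shows "\<exists>T0\<ge>0. \<exists>c>0.
    (integral {0..pi} (\<lambda>z. integral {pi..2*pi} (\<lambda>r. w0 r z)) \<ge> 0 \<longrightarrow> T0 = 0) \<and>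
    (\<forall>T u w \<psi>. maximal_euler_solution u0 w0 T u w \<psi> \<longrightarrow>
      (\<forall>p::ereal. \<forall>t::real. 1 \<le> p \<and> T0 \<le> t \<and> ereal t < T \<longrightarrow>
        Lp_norm p (\<lambda>(r, \<theta>, z). w r z t) \<ge> c * t powr (3 - real_of_ereal (2 / p))) \<and>
      (\<forall>t::real. T0 \<le> t \<and> ereal t < T \<longrightarrow> Lp_norm \<infinity> (velocity u \<psi> t) \<ge> c * t))"
proof -
  define M0 where "M0 = integral {0..pi} (\<lambda>z. integral {pi..2*pi} (\<lambda>r. w0 r z))"
  define k where "k = 15 * k0\<^sup>2 / 128"
  have k: "k > 0" using assms(7) by (simp add: k_def)
  \<comment> \<open>From this time on, half of the guaranteed growth makes up for a negative initial circulation.\<close>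
  define T0 where "T0 = (if M0 \<ge> 0 then 0 else - 2 * M0 / k)"
  have T0: "T0 \<ge> 0" using k by (auto simp: T0_def divide_nonpos_pos)
  have growth: "k / 2 * t \<le> M0 + k * t" if "T0 \<le> t" for t
  proof (cases "M0 \<ge> 0")
    case True
    then have "0 \<le> k * t" using that k by (simp add: T0_def)
    then show ?thesis using True by simp
  next
    case False
    then have "- 2 * M0 / k \<le> t" using that by (simp add: T0_def)
    then have "- 2 * M0 \<le> t * k" using k by (simp only: pos_divide_le_eq)
    then show ?thesis by (simp add: mult.commute)
  qed
  define Gf :: "field \<Rightarrow> field" where "Gf = (\<lambda>u r z t. r * u r z t)"
  define Xf :: "field \<Rightarrow> field" where "Xf = (\<lambda>w r z t. w r z t / r)"
  have fl: "axisymmetric_flow T (Gf u) (Xf w) \<psi>" if "euler_solution u0 w0 T u w \<psi>" for T u w \<psi>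
    using axisymmetric_flow_of_euler_solution[OF that] by (simp add: Gf_def Xf_def)
  have T: "0 < T" if "euler_solution u0 w0 T u w \<psi>" for T u w \<psi>
    using that unfolding euler_solution_def by blast
  have init: "u r z 0 = u0 r z" "w r z 0 = w0 r z"
    if "euler_solution u0 w0 T u w \<psi>" "pi \<le> r" "r \<le> 2*pi" for T u w \<psi> r z
    using that unfolding euler_solution_def by auto
  obtain E where E: "E > 0" "\<And>T u w \<psi>. euler_solution u0 w0 T u w \<psi> \<Longrightarrow> energy (Gf u) \<psi> 0 \<le> E"
  proof (cases "\<exists>T u w \<psi>. euler_solution u0 w0 T u w \<psi>")
    case True
    then obtain T1 u1 w1 \<psi>1 where 1: "euler_solution u0 w0 T1 u1 w1 \<psi>1" by blast
    have "energy (Gf u) \<psi> 0 = energy (Gf u1) \<psi>1 0" if 2: "euler_solution u0 w0 T u w \<psi>" for T u w \<psi>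
      by (rule initial_energy_unique[OF fl[OF 2] fl[OF 1]])
         (use init[OF 2] init[OF 1] T[OF 2] T[OF 1] in \<open>auto simp: Gf_def Xf_def\<close>)
    then show thesis
      by (intro that[of "\<bar>energy (Gf u1) \<psi>1 0\<bar> + 1"]) auto
  next
    case False
    then show thesis by (intro that[of 1]) auto
  qed
  \<comment> \<open>The layer has measure at most \<open>V / t\<^sup>2\<close>; the lower bound one is for \<open>layer_scaling\<close>.\<close>
  define V where "V = max 1 (32 * pi\<^sup>2 * E / (k / 2)\<^sup>2)"
  have V: "V \<ge> 1" by (simp add: V_def)
  define c where "c = min (k / (4 * V)) (k / (8 * pi))"
  have c: "c > 0" "c \<le> k / (4 * V)" "c \<le> k / (8 * pi)" using k V pi_gt_zero by (auto simp: c_def)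
  have main: "Lp_norm p (\<lambda>(r, \<theta>, z). w r z t) \<ge> c * t powr (3 - real_of_ereal (2 / p)) \<and>
      Lp_norm \<infinity> (velocity u \<psi> t) \<ge> c * t"
    if sol: "euler_solution u0 w0 T u w \<psi>" and p: "1 \<le> p" and t: "T0 \<le> t" "ereal t < T" for T u w \<psi> p t
  proof -
    interpret S: symmetric_flow T "Gf u" "Xf w" \<psi> k0
    proof
      fix r z :: real assume r: "pi \<le> r" "r \<le> 2*pi"
      then have "r > 0" using pi_gt_zero by linarith
      note i = init(1,2)[OF sol r]
      show "Gf u r (- z) 0 = Gf u r z 0" "Xf w r (- z) 0 = - Xf w r z 0"
        using i assms(5,6) r by (simp_all add: Gf_def Xf_def)
      have "pi * k0 \<le> r * u0 r pi" using assms(7,8) r pi_gt_zero by (intro mult_mono) auto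
      then show "pi * k0 \<le> Gf u r pi 0" using i by (simp add: Gf_def)
      have "r * \<bar>u0 r 0\<bar> \<le> (2 * pi) * (k0 / 8)" using assms(7,9) r \<open>r > 0\<close> by (intro mult_mono) auto
      then show "\<bar>Gf u r 0 0\<bar> \<le> pi * k0 / 4" using i \<open>r > 0\<close> by (simp add: Gf_def abs_mult)
    qed (use fl[OF sol] assms(7) in auto)
    have sm: "smooth_field T u" "smooth_field T w" "smooth_field T \<psi>"
      using sol by (auto simp: euler_solution_def smooth_field_def)
    have t0: "0 \<le> t" using t T0 by simp
    have rX: "r * Xf w r z s = w r z s" if "pi \<le> r" for r z s
    proof -
      have "r \<noteq> 0" using that pi_gt_zero by linarith
      then show ?thesis by (simp add: Xf_def)
    qed
    have cont0: "rz_continuous 0 pi (\<lambda>r z. w r z 0)"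
      by (rule rz_continuous_smooth[OF sm(2)]) (use T[OF sol] in \<open>auto simp: zero_ereal_def\<close>)
    have "S.circulation 0 = rz_integral 0 pi (\<lambda>r z. w r z 0)"
      unfolding S.circulation_def by (rule rz_integral_cong) (rule rX)
    also have "\<dots> = integral {0..pi} (\<lambda>z. integral {pi..2*pi} (\<lambda>r. w r z 0))"
      by (rule rz_integral_iterated(2)[OF cont0])
    also have "\<dots> = M0"
      unfolding M0_def by (intro integral_cong) (use init(2)[OF sol] in auto)
    finally have circ: "k / 2 * t \<le> S.circulation t"
      using S.circulation_growth[OF t0 t(2), folded k_def] growth[OF t(1)] by linarith
    note cont = rz_continuous_smooth[OF _ t0 t(2)]
    have cw: "rz_continuous (- pi) pi (\<lambda>r z. \<bar>w r z t\<bar>)"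
      by (rule rz_continuous_abs[OF cont[OF sm(2)]])
    have nw: "norm ((\<lambda>(r, \<theta>, z). w r z t) (r, \<theta>, z)) = \<bar>w r z t\<bar>" for r \<theta> z by simp
    have vort: "c * t powr (3 - real_of_ereal (2 / p)) \<le> Lp_norm p (\<lambda>(r, \<theta>, z). w r z t)"
    proof (cases "t = 0")
      case True
      \<comment> \<open>At \<open>t = 0\<close> the lower bound is zero, since \<open>0 powr x = 0\<close> for every \<open>x\<close>.\<close>
      then show ?thesis using Lp_norm_nonneg[OF cw nw] by simp
    next
      case False
      then have "t > 0" using t0 by simp
      obtain \<eta> where \<eta>: "rz_continuous 0 pi \<eta>"
        "\<And>r z. pi \<le> r \<Longrightarrow> r \<le> 2*pi \<Longrightarrow> 0 \<le> z \<Longrightarrow> z \<le> pi \<Longrightarrow> 0 \<le> \<eta> r z \<and> \<eta> r z \<le> 1"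
        "rz_integral 0 pi \<eta> \<le> 32 * pi\<^sup>2 * E / (k / 2 * t)\<^sup>2"
        "k / 2 * t / 2 \<le> rz_integral 0 pi (\<lambda>r z. \<eta> r z * \<bar>r * Xf w r z t\<bar>)"
        by (rule S.vorticity_concentrates[OF \<open>t > 0\<close> t(2) E(2)[OF sol] E(1) _ circ]) (use k in auto)
      have \<eta>w: "k * t / 4 \<le> rz_integral 0 pi (\<lambda>r z. \<eta> r z * \<bar>w r z t\<bar>)"
        using \<eta>(4) rz_integral_cong[of 0 pi "\<lambda>r z. \<eta> r z * \<bar>r * Xf w r z t\<bar>" "\<lambda>r z. \<eta> r z * \<bar>w r z t\<bar>"]
        by (simp add: rX)
      have "32 * pi\<^sup>2 * E / (k / 2 * t)\<^sup>2 = 32 * pi\<^sup>2 * E / (k / 2)\<^sup>2 / t\<^sup>2"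
        by (simp only: power_mult_distrib divide_divide_eq_left)
      also have "\<dots> \<le> V / t\<^sup>2" by (intro divide_right_mono) (auto simp: V_def)
      finally have \<eta>V: "rz_integral 0 pi \<eta> \<le> V / t\<^sup>2" using \<eta>(3) by linarith
      have Vt: "V / t\<^sup>2 > 0" and kt: "k * t / 4 > 0" using V \<open>t > 0\<close> k by auto
      have bound: "1 \<le> q \<Longrightarrow> k * t / 4 * (V / t\<^sup>2) powr ((1 - q) / q) \<le> Lp_norm (ereal q) (\<lambda>(r, \<theta>, z). w r z t)"
        "k * t / 4 / (V / t\<^sup>2) \<le> Lp_norm \<infinity> (\<lambda>(r, \<theta>, z). w r z t)" for q
        by (rule Lp_norm_lower_bound[OF cw nw \<eta>(1) _ \<eta>V Vt \<eta>w kt]; use \<eta>(2) in simp)+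
      show ?thesis
      proof (cases p)
        case PInf
        have "c * t ^ 3 \<le> k / (4 * V) * t ^ 3" using c \<open>t > 0\<close> by (intro mult_right_mono) auto
        also have "\<dots> = k * t / 4 / (V / t\<^sup>2)" by (simp add: eval_nat_numeral)
        also have "\<dots> \<le> Lp_norm p (\<lambda>(r, \<theta>, z). w r z t)" using bound(2) PInf by simp
        finally show ?thesis using PInf \<open>t > 0\<close> by simp
      next
        case (real q)
        then have q: "1 \<le> q" using p by simp
        have "c * t powr (3 - 2 / q) \<le> k / (4 * V) * t powr (3 - 2 / q)"
          using c by (intro mult_right_mono) auto
        also have "\<dots> \<le> k * t / 4 * (V / t\<^sup>2) powr ((1 - q) / q)"
          by (rule layer_scaling[OF V \<open>t > 0\<close> q k])
        also have "\<dots> \<le> Lp_norm p (\<lambda>(r, \<theta>, z). w r z t)" using bound(1)[OF q] real by simp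
        finally show ?thesis using real q by simp
      next
        case MInf
        then show ?thesis using p by simp
      qed
    qed
    define U where "U = (\<lambda>r z. norm (vel_r \<psi> r z t, u r z t, vel_z \<psi> r z t))"
    have cU: "rz_continuous (- pi) pi U"
    proof -
      have "smooth_field T (\<lambda>r z t. - (d_z \<psi> r z t) / r)" "smooth_field T (\<lambda>r z t. d_r \<psi> r z t / r)"
        using sm(3) by simp_all
      from cont[OF this(1)] cont[OF this(2)] cont[OF sm(1)] show ?thesis
        unfolding U_def vel_r_def vel_z_def split_def by (simp add: continuous_on_norm continuous_on_Pair)
    qed
    have nU: "norm (velocity u \<psi> t (r, \<theta>, z)) = U r z" for r \<theta> z by (simp add: velocity_def U_def)
    let ?N = "Lp_norm \<infinity> (velocity u \<psi> t)"
    have "S.circulation t \<le> 4 * pi * ?N"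
    proof (rule S.circulation_le_velocity[OF t0 t(2)])
      fix r z :: real assume m: "pi \<le> r" "r \<le> 2*pi" "0 \<le> z" "z \<le> pi"
      have "U r z \<le> ?N" by (rule pointwise_le_Lp_norm_infinity[OF cU nU m])
      moreover have "\<bar>vel_r \<psi> r z t\<bar> \<le> U r z" "\<bar>vel_z \<psi> r z t\<bar> \<le> U r z"
        using norm_fst_le[of "vel_r \<psi> r z t" "(u r z t, vel_z \<psi> r z t)"]
          norm_snd_le[of "(u r z t, vel_z \<psi> r z t)" "vel_r \<psi> r z t"] norm_snd_le[of "vel_z \<psi> r z t" "u r z t"]
        by (simp_all add: U_def)
      ultimately show "\<bar>vel_r \<psi> r z t\<bar> \<le> ?N \<and> \<bar>vel_z \<psi> r z t\<bar> \<le> ?N" by linarith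
    qed
    then have "k / (8 * pi) * t \<le> ?N" using circ pi_gt_zero by (simp add: field_simps)
    moreover have "c * t \<le> k / (8 * pi) * t" using c t0 by (intro mult_right_mono) auto
    ultimately show ?thesis using vort by linarith
  qed
  show ?thesis
  proof (intro exI conjI impI allI)
    show "0 \<le> T0" "0 < c" by fact+
    show "T0 = 0" if "0 \<le> integral {0..pi} (\<lambda>z. integral {pi..2*pi} (\<lambda>r. w0 r z))"
      using that by (simp add: T0_def M0_def)
  next
    fix T u w \<psi> and p :: ereal and t :: real
    assume "maximal_euler_solution u0 w0 T u w \<psi>" "1 \<le> p \<and> T0 \<le> t \<and> ereal t < T"
    then show "Lp_norm p (\<lambda>(r, \<theta>, z). w r z t) \<ge> c * t powr (3 - real_of_ereal (2 / p))"
      using main unfolding maximal_euler_solution_def by blast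
  next
    fix T u w \<psi> and t :: real
    assume "maximal_euler_solution u0 w0 T u w \<psi>" "T0 \<le> t \<and> ereal t < T"
    then show "Lp_norm \<infinity> (velocity u \<psi> t) \<ge> c * t"
      using main[of T u w \<psi> 1 t] unfolding maximal_euler_solution_def by blast
  qed
qed

end
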